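(* Let $n\ge2$ and let $\mathcal{M}=\partial D\subset\mathbb{R}^n$ be the boundary of a bounded domain $D$, strictly starlike with respect to the origin, which satisfies the $\alpha$-tangent condition for some $\alpha\in(0,\pi/2]$. Let $G\subsetneq\mathbb{R}^n$ be a domain and let $f_{\mathcal{M}}:G\to f_{\mathcal{M}}(G)$ be the (restriction of the) quasi-inversion in $\mathcal{M}$. Then $f_{\mathcal{M}}$ is an $L^8$-bi-Lipschitz map with respect to both the Möbius metric and Ferrand's metric (that is, from $(G,\delta_G)$ to $(f_{\mathcal{M}}(G),\delta_{f_{\mathcal{M}}(G)})$ and from $(G,\sigma_G)$ to $(f_{\mathcal{M}}(G),\sigma_{f_{\mathcal{M}}(G)})$), where $$L=\max\left\{\frac{r_{\max}}{2},\frac{1}{2r_{\min}}\right\}\left(\sqrt{\csc^2\alpha-1}+\sqrt{\csc^2\alpha+3}\right),\qquad r_{\max}=\max_{w\in\mathcal{M}}|w|,\quad r_{\min}=\min_{w\in\mathcal{M}}|w|.$$ Moreover, if $\mathcal{M}_t$, $t\in[0,1]$, is a family of surfaces smoothly converging to the unit sphere $S^{n-1}$ as $t\to0$, then the bi-Lipschitz constants $L_t$ (with respect to these metrics) of the quasi-inversions $f_{\mathcal{M}_t}$ tend to $1$ as $t\to0$.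
   Context: $\overline{\mathbb{R}}^n=\mathbb{R}^n\cup\{\infty\}$, $S^{n-1}$ is the unit sphere, $S^{n-1}(r)$ the sphere of radius $r$ centered at $0$. A bounded domain $D\subset\mathbb{R}^n$ is strictly starlike with respect to the point $a$ if each ray emanating from $a$ meets $\partial D$ at exactly one point (in particular $a\in D$). Quasi-inversion: for $x\in\mathbb{R}^n\setminus\{0\}$ let $r_x=|w|$, where $w$ is the unique point of $\{tx:t>0\}\cap\mathcal{M}$. Then $f_{\mathcal{M}}(x)=\frac{r_x^2}{|x|^2}x$ for $x\in\mathbb{R}^n\setminus\{0\}$, $f_{\mathcal{M}}(0)=\infty$, $f_{\mathcal{M}}(\infty)=0$. Tangent condition: for $x,z\in\partial D$, $z\ne x$, let $\alpha(z,x)\in[0,\pi/2]$ be the acute angle which the segment $[z,x]$ makes with the ray from $0$ through $x$, i.e. $\cos\alpha(z,x)=\frac{|\langle z-x,x\rangle|}{|z-x||x|}$, and put $\alpha(x)=\liminf_{z\to x,\,z\in\partial D}\alpha(z,x)$. $D$ (and $\partial D$) satisfies the $\alpha$-tangent condition if $\alpha(x)\ge\alpha$ for every $x\in\partial D$. Metrics (boundaries are taken in $\overline{\mathbb{R}}^n$, and expressions involving the point $\infty$ are understood as limits, e.g. $\frac{|a-b|}{|x-a||x-b|}=\frac1{|x-b|}$ for $a=\infty$). Möbius metric: for an open $G\subset\overline{\mathbb{R}}^n$ with $\operatorname{card}\partial G\ge2$ and $x,y\in G$, $\delta_G(x,y)=\log\bigl(1+\sup_{a,b\in\partial G}|a,x,b,y|\bigr)$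 with $|a,x,b,y|=\frac{|a-b||x-y|}{|a-x||b-y|}$. Ferrand's metric: for a domain $G\subset\overline{\mathbb{R}}^n$ with $\operatorname{card}\partial G\ge2$, let $w_G(x)=\sup_{a,b\in\partial G}\frac{|a-b|}{|x-a||x-b|}$ for $x\in G\setminus\{\infty\}$, and $\sigma_G(x,y)=\inf_\gamma\int_\gamma w_G(t)\,|dt|$, the infimum over all rectifiable curves $\gamma$ joining $x$ and $y$ in $G$. A homeomorphism $f:(X,d_X)\to(Y,d_Y)$ is $C$-bi-Lipschitz if $d_X(x,y)/C\le d_Y(f(x),f(y))\le C\,d_X(x,y)$ for all $x,y$; the bi-Lipschitz constant is the smallest such $C$. Smooth convergence: for $t\in[0,1]$ let $\mathcal{M}_t$ be the boundary of a bounded domain strictly starlike with respect to $0$ which satisfies the $\alpha_{\mathcal{M}_t}$-tangent condition, and let $\varphi_t:\mathbb{R}^n\to\mathbb{R}^n$ be the radial extension which sends the unit sphere to $\mathcal{M}_t$, i.e. $\varphi_t(0)=0$ and, for $x\ne0$, $\varphi_t(x)=|x|\,\varphi^{(t)}(x/|x|)$, where $\varphi^{(t)}(u)$ is the unique point of $\mathcal{M}_t$ on the ray from $0$ through $u\in S^{n-1}$. $\mathcal{M}_t$ smoothly converges to $S^{n-1}(r)$ as $t\to0$ if $\lim_{t\to0}\operatorname{ess\,sup}_{|x|=1}|\varphi_t'(x)-r\mathbf{I}|=0$, where $\mathbf{I}$ is the identity matrix and $|\cdot|$ the operator norm (this in particular means $\alpha_{\mathcal{M}_t}\to\pi/2$).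 *)

theory Defs
  imports "HOL-Analysis.Analysis" "HOL-Probability.Essential_Supremum"
begin

section \<open>The extended space and its boundaries\<close>

text \<open>The one-point compactification of the space \<open>'a\<close> is modelled on \<open>'a option\<close>:
  \<open>None\<close> is the point at infinity.\<close>

abbreviation ext_space :: "'a::euclidean_space option topology" where
  "ext_space \<equiv> Alexandroff_compactification euclidean"

abbreviation ext_boundary :: "'a::euclidean_space option set \<Rightarrow> 'a option set" where
  "ext_boundary G \<equiv> ext_space frontier_of G"

text \<open>The convention \<open>\<bar>a - \<infinity>\<bar> = 1\<close> is not a metric.  It is only meant for quotients of
  products of distances in which, when a point tends to infinity, the factors containing it
  cancel asymptotically; there it yields the limit value.\<close>

fun ext_dist :: "'a::euclidean_space option \<Rightarrow> 'a option \<Rightarrow> real" where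
  "ext_dist (Some a) (Some b) = norm (a - b)"
| "ext_dist (Some a) None = 1"
| "ext_dist None (Some b) = 1"
| "ext_dist None None = 0"

section \<open>Strictly starlike domains and the tangent condition\<close>

definition strictly_starlike :: "'a::euclidean_space set \<Rightarrow> 'a \<Rightarrow> bool" where
  "strictly_starlike D a \<longleftrightarrow> open D \<and> connected D \<and> bounded D \<and> a \<in> D \<and>
     (\<forall>u. u \<noteq> 0 \<longrightarrow> (\<exists>!w. w \<in> frontier D \<and> (\<exists>t\<ge>0. w = a + t *\<^sub>R u)))"

definition tangent_angle :: "'a::euclidean_space \<Rightarrow> 'a \<Rightarrow> real" where
  "tangent_angle z x = arccos (\<bar>(z - x) \<bullet> x\<bar> / (norm (z - x) * norm x))"

definition tangent_condition :: "'a::euclidean_space set \<Rightarrow> real \<Rightarrow> bool" where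
  "tangent_condition M \<alpha> \<longleftrightarrow>
     (\<forall>x\<in>M. ereal \<alpha> \<le> Liminf (at x within M) (\<lambda>z. ereal (tangent_angle z x)))"

section \<open>Quasi-inversion\<close>

definition radial_point :: "'a::euclidean_space set \<Rightarrow> 'a \<Rightarrow> 'a" where
  "radial_point M x = (THE w. w \<in> M \<and> (\<exists>t>0. w = t *\<^sub>R x))"

fun quasi_inversion :: "'a::euclidean_space set \<Rightarrow> 'a option \<Rightarrow> 'a option" where
  "quasi_inversion M None = Some 0"
| "quasi_inversion M (Some x) =
     (if x = 0 then None
      else Some (((norm (radial_point M x))\<^sup>2 / (norm x)\<^sup>2) *\<^sub>R x))"

section \<open>The Moebius metric\<close>

definition abs_ratio ::
    "'a::euclidean_space option \<Rightarrow> 'a option \<Rightarrow> 'a option \<Rightarrow> 'a option \<Rightarrow> real" where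
  "abs_ratio a x b y = (ext_dist a b * ext_dist x y) / (ext_dist a x * ext_dist b y)"

definition moebius_metric ::
    "'a::euclidean_space option set \<Rightarrow> 'a option \<Rightarrow> 'a option \<Rightarrow> real" where
  "moebius_metric G x y =
     ln (1 + (SUP (a, b)\<in>ext_boundary G \<times> ext_boundary G. abs_ratio a x b y))"

section \<open>Ferrand's metric\<close>

definition ferrand_density :: "'a::euclidean_space option set \<Rightarrow> 'a \<Rightarrow> real" where
  "ferrand_density G x =
     (SUP (a, b)\<in>ext_boundary G \<times> ext_boundary G.
        ext_dist a b / (ext_dist (Some x) a * ext_dist (Some x) b))"

definition arc_length :: "(real \<Rightarrow> 'a::euclidean_space) \<Rightarrow> real \<Rightarrow> real \<Rightarrow> ennreal" where
  "arc_length g a b =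
     (SUP d\<in>{d. d division_of {a..b}}. \<Sum>k\<in>d. ennreal (dist (g (Inf k)) (g (Sup k))))"

text \<open>The Lebesgue-Stieltjes measure of the arc length function
  \<open>t \<mapsto> arc_length g a t\<close> on \<open>{a..b}\<close>, for a rectifiable \<open>g\<close> (no mass outside \<open>{a..b}\<close>).\<close>

definition arc_measure :: "(real \<Rightarrow> 'a::euclidean_space) \<Rightarrow> real \<Rightarrow> real \<Rightarrow> real measure" where
  "arc_measure g a b = interval_measure (\<lambda>t. enn2real (arc_length g a (min t b)))"

text \<open>A domain of the extended space may contain infinity, and then so may the curves in it; such
  a curve has infinite Euclidean length.  It is called rectifiable if all its closed subarcs that
  avoid infinity are, and the integral over it is the improper one: the supremum of the sums of
  the integrals over finitely many non-overlapping subarcs avoiding infinity.  For a curve avoiding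
  infinity these are the usual notions, by additivity of the integral.\<close>

definition rectifiable_curve :: "(real \<Rightarrow> 'a::euclidean_space option) \<Rightarrow> bool" where
  "rectifiable_curve g \<longleftrightarrow>
     (\<forall>a b. 0 \<le> a \<and> a \<le> b \<and> b \<le> 1 \<and> None \<notin> g ` {a..b} \<longrightarrow> arc_length (the \<circ> g) a b < \<infinity>)"

definition curve_integral ::
    "('a::euclidean_space \<Rightarrow> real) \<Rightarrow> (real \<Rightarrow> 'a option) \<Rightarrow> ennreal" where
  "curve_integral \<rho> g =
     (SUP d\<in>{d. d division_of {0..1}}.
        \<Sum>k\<in>{k\<in>d. None \<notin> g ` k}.
          \<integral>\<^sup>+t\<in>k. ennreal (\<rho> (the (g t))) \<partial>arc_measure (the \<circ> g) (Inf k) (Sup k))"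

text \<open>The infimum is finite for points of a domain, so that \<open>enn2real\<close> loses nothing.\<close>

definition ferrand_metric ::
    "'a::euclidean_space option set \<Rightarrow> 'a option \<Rightarrow> 'a option \<Rightarrow> real" where
  "ferrand_metric G x y =
     enn2real (INF g\<in>{g. pathin (subtopology ext_space G) g \<and> rectifiable_curve g \<and>
                         g 0 = x \<and> g 1 = y}.
                 curve_integral (ferrand_density G) g)"

section \<open>Bi-Lipschitz maps\<close>

definition metric_continuous ::
    "'p set \<Rightarrow> ('p \<Rightarrow> 'p \<Rightarrow> real) \<Rightarrow> ('q \<Rightarrow> 'q \<Rightarrow> real) \<Rightarrow> ('p \<Rightarrow> 'q) \<Rightarrow> bool" where
  "metric_continuous X dX dY f \<longleftrightarrow>
     (\<forall>x\<in>X. \<forall>e>0. \<exists>r>0. \<forall>y\<in>X. dX x y < r \<longrightarrow> dY (f x) (f y) < e)"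

definition metric_homeomorphism ::
    "'p set \<Rightarrow> ('p \<Rightarrow> 'p \<Rightarrow> real) \<Rightarrow> 'q set \<Rightarrow> ('q \<Rightarrow> 'q \<Rightarrow> real) \<Rightarrow> ('p \<Rightarrow> 'q) \<Rightarrow> bool" where
  "metric_homeomorphism X dX Y dY f \<longleftrightarrow>
     bij_betw f X Y \<and> metric_continuous X dX dY f \<and> metric_continuous Y dY dX (inv_into X f)"

definition bi_lipschitz ::
    "real \<Rightarrow> 'p set \<Rightarrow> ('p \<Rightarrow> 'p \<Rightarrow> real) \<Rightarrow> 'q set \<Rightarrow> ('q \<Rightarrow> 'q \<Rightarrow> real) \<Rightarrow> ('p \<Rightarrow> 'q) \<Rightarrow> bool"
  where
  "bi_lipschitz C X dX Y dY f \<longleftrightarrow>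
     0 < C \<and> metric_homeomorphism X dX Y dY f \<and>
     (\<forall>x\<in>X. \<forall>y\<in>X. dX x y / C \<le> dY (f x) (f y) \<and> dY (f x) (f y) \<le> C * dX x y)"

definition bi_lipschitz_constant ::
    "'p set \<Rightarrow> ('p \<Rightarrow> 'p \<Rightarrow> real) \<Rightarrow> 'q set \<Rightarrow> ('q \<Rightarrow> 'q \<Rightarrow> real) \<Rightarrow> ('p \<Rightarrow> 'q) \<Rightarrow> real" where
  "bi_lipschitz_constant X dX Y dY f = (LEAST C. bi_lipschitz C X dX Y dY f)"

section \<open>Smooth convergence\<close>

definition radial_extension :: "'a::euclidean_space set \<Rightarrow> 'a \<Rightarrow> 'a" where
  "radial_extension M x =
     (if x = 0 then 0 else norm x *\<^sub>R radial_point M (x /\<^sub>R norm x))"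

text \<open>Surface measure on the unit sphere in polar-coordinate form: the measure of \<open>A\<close> is \<open>n\<close> times
  the volume of the cone \<open>{t *\<^sub>R u | t u. 0 < t \<and> t \<le> 1 \<and> u \<in> A}\<close>.\<close>

definition sphere_measure :: "'a::euclidean_space measure" where
  "sphere_measure =
     scale_measure (of_nat DIM('a))
       (distr (restrict_space lborel (cball 0 1 - {0})) (restrict_space borel (sphere 0 1))
              (\<lambda>x. x /\<^sub>R norm x))"

text \<open>The value \<open>\<infinity>\<close> at points of non-differentiability expresses that the derivative has to exist
  almost everywhere for the essential supremum of its deviation to be finite; for radial extensions
  of surfaces with a tangent condition, which are Lipschitz, this is Rademacher's theorem.\<close>

definition derivative_deviation :: "('a::euclidean_space \<Rightarrow> 'a) \<Rightarrow> real \<Rightarrow> 'a \<Rightarrow> ereal" where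
  "derivative_deviation \<phi> r x =
     (if \<phi> differentiable (at x)
      then ereal (onorm (\<lambda>h. frechet_derivative \<phi> (at x) h - r *\<^sub>R h)) else \<infinity>)"

definition smoothly_converges :: "(real \<Rightarrow> 'a::euclidean_space set) \<Rightarrow> real \<Rightarrow> bool" where
  "smoothly_converges M r \<longleftrightarrow>
     (\<forall>t\<in>{0..1}. \<exists>D \<alpha>. strictly_starlike D 0 \<and> M t = frontier D \<and>
                    0 < \<alpha> \<and> \<alpha> \<le> pi / 2 \<and> tangent_condition (M t) \<alpha>) \<and>
     ((\<lambda>t. esssup sphere_measure (derivative_deviation (radial_extension (M t)) r)) \<longlongrightarrow> 0)
       (at 0 within {0..1})"

end

theory Submission
  imports Defs
begin

text \<open>Write \<open>\<rho> x\<close> for the norm of the point of \<open>M\<close> on the ray from the origin through \<open>x\<close>.  The radial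
  extension \<open>\<phi> x = \<rho> x *\<^sub>R x\<close> maps the unit sphere to \<open>M\<close>, and the quasi-inversion is the
  composition of \<open>\<phi>\<close>, the inversion in the unit sphere and the inverse of \<open>\<phi>\<close>.  The inversion
  preserves absolute ratios exactly.  If \<open>\<phi>\<close> and its inverse are \<open>\<Lambda>\<close>-Lipschitz, each of them
  changes an absolute ratio, a quotient of products of two distances, at most by the factor
  \<open>\<Lambda> ^ 4\<close>, so that the quasi-inversion changes it at most by \<open>\<Lambda> ^ 8\<close>.

  The points \<open>0\<close> and \<open>\<infinity>\<close>, which the quasi-inversion \<open>f\<close> exchanges, need no separate treatment once
  this is stated with weights: there is a positive function \<open>m\<close> on the extended space such that
  \<open>ext_dist (f p) (f q)\<close> agrees with \<open>ext_dist p q / (m p * m q)\<close> up to the factor \<open>\<Lambda>\<^sup>2\<close> for all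
  \<open>p\<close> and \<open>q\<close>.  The weights cancel in absolute ratios, which gives the bound for the Moebius metric
  by the concavity of the logarithm.  They almost cancel in Ferrand's density: it is multiplied by
  at most \<open>\<Lambda> ^ 6 * (m x)\<^sup>2\<close>, while \<open>f\<close> multiplies small distances near \<open>x\<close> by at most
  \<open>\<Lambda>\<^sup>2 / (m x)\<^sup>2\<close>.  As \<open>f\<close> is an involution, every upper bound is also a lower bound.

  The passage from densities to curves has one difficulty, a curve through \<open>\<infinity>\<close>: its image passes
  through \<open>0\<close>, and its rectifiability near \<open>0\<close> is not part of the hypothesis on the curve.  It
  follows from the finiteness of the integral over the curve.  The bound for a chord of the image,
  times the density, by the integral over the corresponding arc is proved first for arcs avoiding
  \<open>\<infinity>\<close>, by subdivision; an arc of the image meeting \<open>0\<close> is then split at its first and its last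
  visit to \<open>0\<close> (\<open>chord_bound\<close>).

  The Lipschitz constants of \<open>\<phi>\<close> and its inverse come from pointwise bounds.  The derivative of
  \<open>\<phi>\<close> is, where it exists, \<open>\<rho> x\<close> times a shear by at most \<open>cot \<alpha>\<close>, and the operator norm of the
  shear by \<open>k\<close>, as of its inverse, is \<open>(k + sqrt (k\<^sup>2 + 4)) / 2\<close>; this yields \<open>L\<close>.

  Under smooth convergence, \<open>\<phi>\<close> minus the identity is Lipschitz and has almost everywhere a
  derivative of norm at most \<open>\<epsilon>\<close>.  By Fubini's theorem the latter holds at almost every point of
  almost every translate of a given segment, so that \<open>\<phi>\<close> minus the identity is \<open>\<epsilon>\<close>-Lipschitz.
  Hence \<open>\<Lambda> = 1 / (1 - \<epsilon>)\<close> is admissible, and the bi-Lipschitz constants lie between \<open>1\<close> and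
  \<open>\<Lambda> ^ 8\<close>.\<close>

section \<open>Variations of interval functions and arc length\<close>

text \<open>The variation of a function of intervals over the divisions of \<open>{a..b}\<close>.  Both the arc length
  and the integral along a curve through infinity are of this form.\<close>

definition interval_variation :: "(real set \<Rightarrow> ennreal) \<Rightarrow> real \<Rightarrow> real \<Rightarrow> ennreal" where
  "interval_variation \<Phi> a b = (SUP d\<in>{d. d division_of {a..b}}. \<Sum>k\<in>d. \<Phi> k)"

lemma division_of_real_interval_cases:
  assumes "d division_of {a..b::real}" "k \<in> d"
  obtains s t where "k = {s..t}" "a \<le> s" "s \<le> t" "t \<le> b"
proof -
  obtain s t where k: "k = cbox s t" "k \<noteq> {}" "k \<subseteq> {a..b}"
    using division_ofD(2,3,4)[OF assms] by metis
  then have "s \<le> t" by auto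
  with k have "a \<le> s" "t \<le> b" by auto
  with k \<open>s \<le> t\<close> that show ?thesis by (auto simp: cbox_interval)
qed

lemma sum_division_telescope:
  fixes A :: "real \<Rightarrow> real"
  assumes d: "d division_of {a..b}" and "a \<le> b"
  shows "(\<Sum>k\<in>d. A (Sup k) - A (Inf k)) = A b - A a"
proof -
  let ?p = "(\<lambda>k. (Inf k, k)) ` d"
  have p: "?p tagged_division_of {a..b}"
  proof (rule tagged_division_ofI)
    show "finite ?p" using division_of_finite[OF d] by simp
    fix x K assume "(x, K) \<in> ?p"
    then have K: "K \<in> d" "x = Inf K" by auto
    then obtain s t where st: "K = {s..t}" "a \<le> s" "s \<le> t" "t \<le> b"
      using division_of_real_interval_cases[OF d] by metis
    then show "x \<in> K" "K \<subseteq> {a..b}" "\<exists>a b. K = cbox a b"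
      using K by (auto simp: cbox_interval)
    fix x' K' assume "(x', K') \<in> ?p" "(x, K) \<noteq> (x', K')"
    then show "interior K \<inter> interior K' = {}"
      using division_ofD(5)[OF d] K by fastforce
  next
    show "\<Union>{K. \<exists>x. (x, K) \<in> ?p} = {a..b}"
      using division_ofD(6)[OF d] by (auto simp: image_iff)
  qed
  have "(\<Sum>k\<in>d. A (Sup k) - A (Inf k)) = (\<Sum>(x, K)\<in>?p. A (Sup K) - A (Inf K))"
    by (subst sum.reindex) (auto simp: inj_on_def)
  also have "\<dots> = A b - A a"
    by (rule additive_tagged_division_1[OF \<open>a \<le> b\<close> p])
  finally show ?thesis .
qed

lemma interval_variation_ge:
  assumes "a \<le> b" shows "\<Phi> {a..b} \<le> interval_variation \<Phi> a b"
proof -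
  have "{{a..b}} division_of {a..b}"
    using assms division_of_self[of a b] by (simp add: cbox_interval)
  then show ?thesis unfolding interval_variation_def
    by (intro SUP_upper2[where i="{{a..b}}"]) auto
qed

lemma interval_variation_superadditive:
  assumes "a \<le> b" "b \<le> c" and "\<Phi> {b..b} = 0"
  shows "interval_variation \<Phi> a b + interval_variation \<Phi> b c \<le> interval_variation \<Phi> a c"
proof -
  have ne: "\<exists>d. d division_of {x..y::real}" for x y
    using elementary_interval[of x y] by (metis cbox_interval)
  have *: "(\<Sum>k\<in>d. \<Phi> k) + (\<Sum>k\<in>d'. \<Phi> k) \<le> interval_variation \<Phi> a c"
    if d: "d division_of {a..b}" and d': "d' division_of {b..c}" for d d'
  proof -
    have fin: "finite d" "finite d'" using d d' by auto
    have un: "(d \<union> d') division_of {a..c}"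
    proof -
      have "interior {a..b} \<inter> interior {b..c} = {}" by auto
      moreover have "{a..b} \<union> {b..c} = {a..c}" using assms by auto
      ultimately show ?thesis using division_disjoint_union[OF d d'] by simp
    qed
    have "\<Phi> k = 0" if "k \<in> d \<inter> d'" for k
    proof -
      from that have k: "k \<in> d" "k \<in> d'" by auto
      obtain s t where "k = {s..t}" "a \<le> s" "s \<le> t" "t \<le> b"
        by (rule division_of_real_interval_cases[OF d k(1)])
      moreover obtain s' t' where "k = {s'..t'}" "b \<le> s'" "s' \<le> t'" "t' \<le> c"
        by (rule division_of_real_interval_cases[OF d' k(2)])
      ultimately have "k = {b..b}" by (metis Icc_eq_Icc order_antisym order_trans)
      then show ?thesis using assms by simp
    qed
    then have "(\<Sum>k\<in>d \<inter> d'. \<Phi> k) = 0" by simp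
    then have "(\<Sum>k\<in>d. \<Phi> k) + (\<Sum>k\<in>d'. \<Phi> k) = (\<Sum>k\<in>d \<union> d'. \<Phi> k)"
      using sum.union_inter[OF fin, of \<Phi>] by simp
    then show ?thesis unfolding interval_variation_def using un
      by (auto intro!: SUP_upper)
  qed
  have **: "interval_variation \<Phi> a b + (\<Sum>k\<in>d'. \<Phi> k) \<le> interval_variation \<Phi> a c"
    if d': "d' division_of {b..c}" for d'
    unfolding interval_variation_def[of \<Phi> a b]
    by (subst ennreal_SUP_add_left[symmetric]) (auto intro!: SUP_least * that simp: ne)
  show ?thesis
    unfolding interval_variation_def[of \<Phi> b c]
    by (subst ennreal_SUP_add_right) (auto intro!: SUP_least ** simp: ne)
qed

lemma interval_variation_mono:
  assumes "a \<le> s" "s \<le> t" "t \<le> b" "\<And>x. \<Phi> {x..x} = 0"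
  shows "interval_variation \<Phi> s t \<le> interval_variation \<Phi> a b"
proof -
  have "interval_variation \<Phi> s t \<le> interval_variation \<Phi> a s + interval_variation \<Phi> s t"
    by simp
  also have "\<dots> \<le> interval_variation \<Phi> a t"
    using assms by (intro interval_variation_superadditive) auto
  also have "\<dots> \<le> interval_variation \<Phi> a t + interval_variation \<Phi> t b"
    by simp
  also have "\<dots> \<le> interval_variation \<Phi> a b"
    using assms by (intro interval_variation_superadditive) auto
  finally show ?thesis .
qed

text \<open>The increments of \<open>A\<close> telescope over a division, so that a bound for each interval by the
  increment of \<open>A\<close> gives the same bound for the variation.\<close>

lemma interval_variation_le:
  fixes A :: "real \<Rightarrow> real"
  assumes "a \<le> b"
    and le: "\<And>s t. a \<le> s \<Longrightarrow> s \<le> t \<Longrightarrow> t \<le> b \<Longrightarrow> \<Phi> {s..t} \<le> ennreal (A t - A s)"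
    and mono: "\<And>s t. a \<le> s \<Longrightarrow> s \<le> t \<Longrightarrow> t \<le> b \<Longrightarrow> A s \<le> A t"
  shows "interval_variation \<Phi> a b \<le> ennreal (A b - A a)"
  unfolding interval_variation_def
proof (rule SUP_least)
  fix d assume "d \<in> {d. d division_of {a..b}}"
  then have d: "d division_of {a..b}" by simp
  have *: "\<Phi> k \<le> ennreal (A (Sup k) - A (Inf k)) \<and> A (Inf k) \<le> A (Sup k)" if "k \<in> d" for k
    using division_of_real_interval_cases[OF d that] le mono by (metis cInf_atLeastAtMost cSup_atLeastAtMost)
  have "(\<Sum>k\<in>d. \<Phi> k) \<le> (\<Sum>k\<in>d. ennreal (A (Sup k) - A (Inf k)))"
    using * by (intro sum_mono) auto
  also have "\<dots> = ennreal (\<Sum>k\<in>d. A (Sup k) - A (Inf k))"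
    using * by (intro sum_ennreal) auto
  also have "\<dots> = ennreal (A b - A a)"
    by (simp add: sum_division_telescope[OF d \<open>a \<le> b\<close>])
  finally show "(\<Sum>k\<in>d. \<Phi> k) \<le> ennreal (A b - A a)" .
qed

lemma interval_variation_increment:
  assumes fin: "interval_variation \<Phi> a b < \<infinity>" and 0: "\<And>x. \<Phi> {x..x} = 0"
    and "a \<le> s" "s \<le> t" "t \<le> b"
  shows "interval_variation \<Phi> s t \<le> ennreal (enn2real (interval_variation \<Phi> a t)
           - enn2real (interval_variation \<Phi> a s))"
    and "enn2real (interval_variation \<Phi> a s) \<le> enn2real (interval_variation \<Phi> a t)"
    and "ennreal (enn2real (interval_variation \<Phi> a t)) = interval_variation \<Phi> a t"
proof -
  have fin': "interval_variation \<Phi> a x < \<infinity>" if "a \<le> x" "x \<le> b" for x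
    using interval_variation_mono[of a a x b \<Phi>] that 0 fin by (auto intro: le_less_trans)
  have s: "ennreal (enn2real (interval_variation \<Phi> a s)) = interval_variation \<Phi> a s"
    using fin'[of s] assms by (intro ennreal_enn2real) auto
  show t: "ennreal (enn2real (interval_variation \<Phi> a t)) = interval_variation \<Phi> a t"
    using fin'[of t] assms by (intro ennreal_enn2real) auto
  have le: "interval_variation \<Phi> a s + interval_variation \<Phi> s t \<le> interval_variation \<Phi> a t"
    using assms by (intro interval_variation_superadditive) auto
  show "enn2real (interval_variation \<Phi> a s) \<le> enn2real (interval_variation \<Phi> a t)"
    using fin'[of t] assms by (intro enn2real_mono interval_variation_mono) auto
  have "interval_variation \<Phi> s t \<le> interval_variation \<Phi> a t - interval_variation \<Phi> a s"
    using ennreal_minus_mono[OF le order_refl[of "interval_variation \<Phi> a s"]] fin'[of s] assms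
    by (simp add: ennreal_add_diff_cancel_left)
  also have "\<dots> = ennreal (enn2real (interval_variation \<Phi> a t) - enn2real (interval_variation \<Phi> a s))"
    by (subst ennreal_minus[symmetric]) (auto simp: s t)
  finally show "interval_variation \<Phi> s t \<le> \<dots>" .
qed

lemma arc_length_eq_interval_variation:
  "arc_length g = interval_variation (\<lambda>k. ennreal (dist (g (Inf k)) (g (Sup k))))"
  by (intro ext) (simp add: arc_length_def interval_variation_def)

lemma dist_le_arc_length: "a \<le> b \<Longrightarrow> ennreal (dist (g a) (g b)) \<le> arc_length g a b"
  unfolding arc_length_eq_interval_variation
  using interval_variation_ge[of a b "\<lambda>k. ennreal (dist (g (Inf k)) (g (Sup k)))"] by simp

lemma arc_length_mono:
  "a \<le> s \<Longrightarrow> s \<le> t \<Longrightarrow> t \<le> b \<Longrightarrow> arc_length g s t \<le> arc_length g a b"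
  unfolding arc_length_eq_interval_variation by (rule interval_variation_mono) auto

lemma arc_length_le:
  fixes A :: "real \<Rightarrow> real"
  assumes "a \<le> b"
    and le: "\<And>s t. a \<le> s \<Longrightarrow> s \<le> t \<Longrightarrow> t \<le> b \<Longrightarrow> dist (g s) (g t) \<le> A t - A s"
  shows "arc_length g a b \<le> ennreal (A b - A a)"
  unfolding arc_length_eq_interval_variation
proof (rule interval_variation_le[OF \<open>a \<le> b\<close>])
  fix s t assume st: "a \<le> s" "s \<le> t" "t \<le> b"
  show "ennreal (dist (g (Inf {s..t})) (g (Sup {s..t}))) \<le> ennreal (A t - A s)"
    using st le by (auto intro!: ennreal_leI)
  show "A s \<le> A t" using le[OF st] zero_le_dist[of "g s" "g t"] by linarith
qed

lemma arc_length_refl [simp]: "arc_length g a a = 0"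
proof -
  have "arc_length g a a \<le> ennreal (0 - 0)"
    by (rule arc_length_le[where A="\<lambda>_. 0"]) (auto simp: antisym_conv)
  then show ?thesis by simp
qed

lemma arc_length_empty: "b < a \<Longrightarrow> arc_length g a b = 0"
  by (simp add: arc_length_def)

text \<open>A rectifiable curve has additive arc length, and the arc length function
  \<open>t \<mapsto> arc_length g a t\<close> bounds the chords by its increments.\<close>

lemma arc_length_increment:
  assumes fin: "arc_length g a b < \<infinity>" and "a \<le> s" "s \<le> t" "t \<le> b"
  shows "arc_length g s t = ennreal (enn2real (arc_length g a t) - enn2real (arc_length g a s))"
    and "enn2real (arc_length g a s) \<le> enn2real (arc_length g a t)"
    and "ennreal (enn2real (arc_length g a t)) = arc_length g a t"
    and "dist (g s) (g t) \<le> enn2real (arc_length g a t) - enn2real (arc_length g a s)"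
proof -
  let ?\<Phi> = "\<lambda>k. ennreal (dist (g (Inf k)) (g (Sup k)))"
  let ?A = "\<lambda>x. enn2real (arc_length g a x)"
  note inc = interval_variation_increment[of ?\<Phi> a b, folded arc_length_eq_interval_variation, OF fin]
  have mono: "?A s \<le> ?A t" if "a \<le> s" "s \<le> t" "t \<le> b" for s t
    using inc that by auto
  have At: "ennreal (?A t) = arc_length g a t" if "a \<le> t" "t \<le> b" for t
    using inc that by auto
  have le: "arc_length g s t \<le> ennreal (?A t - ?A s)" if "a \<le> s" "s \<le> t" "t \<le> b" for s t
    using inc that by auto
  have dist: "dist (g s) (g t) \<le> ?A t - ?A s" if "a \<le> s" "s \<le> t" "t \<le> b" for s t
  proof -
    have "ennreal (dist (g s) (g t)) \<le> ennreal (?A t - ?A s)"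
      using dist_le_arc_length[of s t g] le[of s t] that by (auto intro: order_trans)
    then show ?thesis using mono[of s t] that by (subst (asm) ennreal_le_iff) auto
  qed
  show "?A s \<le> ?A t" "ennreal (?A t) = arc_length g a t" "dist (g s) (g t) \<le> ?A t - ?A s"
    using mono At dist assms by auto
  \<comment> \<open>The reverse inequality: extend the length from \<open>a\<close> to \<open>s\<close> by the length from \<open>s\<close>.\<close>
  have fin': "arc_length g s x < \<infinity>" if "s \<le> x" "x \<le> b" for x
    using arc_length_mono[of a s x b g] fin that assms by (auto intro: le_less_trans)
  let ?L = "\<lambda>x. enn2real (arc_length g s x)"
  have dist': "dist (g x) (g y) \<le> ?L y - ?L x" if "s \<le> x" "x \<le> y" "y \<le> t" for x y
  proof -
    note inc' = interval_variation_increment[of ?\<Phi> s t, folded arc_length_eq_interval_variation,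
      OF fin'[OF \<open>s \<le> t\<close> \<open>t \<le> b\<close>]]
    have "ennreal (dist (g x) (g y)) \<le> ennreal (?L y - ?L x)"
      using dist_le_arc_length[of x y g] inc'(1)[of x y] that by (auto intro: order_trans)
    moreover have "?L x \<le> ?L y" using inc'(2)[of x y] that by auto
    ultimately show ?thesis by (subst (asm) ennreal_le_iff) auto
  qed
  have "arc_length g a t \<le> ennreal ((if t \<le> s then ?A t else ?A s + ?L t) - (if a \<le> s then ?A a else ?A s + ?L a))"
  proof (rule arc_length_le)
    show "a \<le> t" using assms by simp
    fix x y assume xy: "a \<le> x" "x \<le> y" "y \<le> t"
    show "dist (g x) (g y) \<le> (if y \<le> s then ?A y else ?A s + ?L y) - (if x \<le> s then ?A x else ?A s + ?L x)"
    proof -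
      consider "y \<le> s" | "s < x" | "x \<le> s" "s < y" by linarith
      then show ?thesis
      proof cases
        case 3
        have "dist (g x) (g y) \<le> dist (g x) (g s) + dist (g s) (g y)" by (rule dist_triangle)
        also have "\<dots> \<le> (?A s - ?A x) + (?L y - ?L s)"
          using dist[of x s] dist'[of s y] 3 xy assms by auto
        finally show ?thesis using 3 by auto
      qed (use dist[of x y] dist'[of x y] xy assms in auto)
    qed
  qed
  also have "\<dots> \<le> ennreal (?A s + ?L t)"
    using assms by (intro ennreal_leI) (auto simp: antisym_conv)
  finally have "ennreal (?A t) \<le> ennreal (?A s + ?L t)" using At assms by auto
  then have "?A t \<le> ?A s + ?L t" by (subst (asm) ennreal_le_iff) auto
  then have "ennreal (?A t - ?A s) \<le> ennreal (?L t)" by (intro ennreal_leI) simp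
  also have "\<dots> = arc_length g s t"
    using fin'[of t] assms by (intro ennreal_enn2real) auto
  finally show "arc_length g s t = ennreal (?A t - ?A s)"
    using le[of s t] assms by (auto intro: antisym)
qed

text \<open>If the arc length of a continuous curve jumped to the right of \<open>s\<close> by at least \<open>e\<close>, then
  subtracting \<open>e\<close> would leave an upper bound for all chords, hence for the length itself.\<close>

lemma arc_length_small:
  fixes g :: "real \<Rightarrow> 'a::euclidean_space"
  assumes fin: "arc_length g s b < \<infinity>" and "s < b" and cont: "continuous_on {s..b} g" and "0 < e"
  shows "\<exists>t. s < t \<and> t \<le> b \<and> arc_length g s t < ennreal e"
proof (rule ccontr)
  assume no: "\<not> ?thesis"
  let ?A = "\<lambda>x. enn2real (arc_length g s x)"
  note inc = arc_length_increment[OF fin]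
  have ge: "e \<le> ?A t" if "s < t" "t \<le> b" for t
  proof (rule ccontr)
    assume "\<not> e \<le> ?A t"
    then have "ennreal (?A t) < ennreal e" by (intro ennreal_lessI \<open>0 < e\<close>) auto
    then have "arc_length g s t < ennreal e" using inc(3)[of t t] that by simp
    then show False using no that by blast
  qed
  have "arc_length g s b \<le> ennreal ((if b \<le> s then ?A b else ?A b - e) - (if s \<le> s then ?A s else ?A s - e))"
  proof (rule arc_length_le)
    show "s \<le> b" using assms by simp
    fix x y assume xy: "s \<le> x" "x \<le> y" "y \<le> b"
    have "dist (g s) (g y) \<le> ?A y - e" if "s < y"
    proof (rule field_le_epsilon)
      fix \<delta> :: real assume "0 < \<delta>"
      obtain r where r: "r > 0" "\<And>z. z \<in> {s..b} \<Longrightarrow> dist z s < r \<Longrightarrow> dist (g z) (g s) < \<delta>"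
        using cont \<open>0 < \<delta>\<close> xy unfolding continuous_on_iff by (metis atLeastAtMost_iff dual_order.trans order_refl)
      define z where "z = min y (s + r/2)"
      have z: "s < z" "z \<le> y" "dist z s < r" using r that by (auto simp: z_def dist_real_def)
      have "dist (g s) (g y) \<le> dist (g z) (g s) + dist (g z) (g y)" by (metis dist_commute dist_triangle)
      also have "\<dots> \<le> \<delta> + (?A y - ?A z)"
        using r(2)[of z] inc(4)[of z y] z xy by auto
      also have "\<dots> \<le> \<delta> + (?A y - e)" using ge[of z] z xy by auto
      finally show "dist (g s) (g y) \<le> ?A y - e + \<delta>" by simp
    qed
    then show "dist (g x) (g y) \<le> (if y \<le> s then ?A y else ?A y - e) - (if x \<le> s then ?A x else ?A x - e)"
      using inc(4)[of x y] xy by (cases "x = s") auto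
  qed
  also have "\<dots> = ennreal (?A b - e)" using \<open>s < b\<close> by simp
  finally have "ennreal (?A b) \<le> ennreal (?A b - e)" using inc(3)[of b b] \<open>s < b\<close> by simp
  then show False using ge[of b] \<open>s < b\<close> \<open>0 < e\<close> by (subst (asm) ennreal_le_iff) auto
qed

text \<open>By \<open>arc_length_small\<close> the arc length function of a continuous rectifiable curve is continuous
  from the right, as the Lebesgue-Stieltjes measure requires.\<close>

lemma
  fixes g :: "real \<Rightarrow> 'a::euclidean_space"
  assumes fin: "arc_length g a b < \<infinity>" and cont: "continuous_on {a..b} g" and "a \<le> b"
  shows emeasure_arc_measure_Ioc:
      "a \<le> u \<Longrightarrow> u \<le> v \<Longrightarrow> v \<le> b \<Longrightarrow> emeasure (arc_measure g a b) {u<..v} = arc_length g u v"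
    and emeasure_arc_measure_Icc: "emeasure (arc_measure g a b) {a..b} = arc_length g a b"
    and emeasure_arc_measure_singleton: "emeasure (arc_measure g a b) {a} = 0"
proof -
  define F where "F t = enn2real (arc_length g a (min t b))" for t
  note inc = arc_length_increment[OF fin]
  have F0: "F t = 0" if "t \<le> a" for t
  proof (cases "t = a")
    case True then show ?thesis using \<open>a \<le> b\<close> by (simp add: F_def)
  next
    case False
    then show ?thesis using that by (simp add: F_def arc_length_empty)
  qed
  have mono: "F x \<le> F y" if "x \<le> y" for x y
  proof (cases "a \<le> x")
    case True
    then show ?thesis using inc(2)[of "min x b" "min y b"] that \<open>a \<le> b\<close> by (auto simp: F_def)
  next
    case False
    then have "F x = 0" by (intro F0) auto
    then show ?thesis by (simp add: F_def)
  qed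
  have rc: "continuous (at_right s) F" for s
  proof -
    consider "s < a" | "b \<le> s" | "a \<le> s" "s < b" by linarith
    then show ?thesis
    proof cases
      case 1
      have "eventually (\<lambda>t. F t = F s) (at_right s)"
        using eventually_at_right_less[of s] eventually_at_right[of s a, OF 1] F0 1
        by (auto simp: eventually_at_right_field intro!: exI[of _ a])
      then show ?thesis unfolding continuous_within
        by (rule tendsto_eventually)
    next
      case 2
      have "eventually (\<lambda>t. F t = F s) (at_right s)"
        using 2 by (auto simp: eventually_at_right_field F_def intro!: exI[of _ "s+1"])
      then show ?thesis unfolding continuous_within
        by (rule tendsto_eventually)
    next
      case 3
      show ?thesis unfolding continuous_within
      proof (rule tendstoI)
        fix e :: real assume "0 < e"
        have fs: "arc_length g s b < \<infinity>"
          using arc_length_mono[of a s b b g] 3 fin by (auto intro: le_less_trans)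
        obtain t where t: "s < t" "t \<le> b" "arc_length g s t < ennreal e"
          using arc_length_small[OF fs \<open>s < b\<close> _ \<open>0 < e\<close>] cont 3
          by (metis atLeastatMost_subset_iff continuous_on_subset order_refl)
        have "ennreal (F t - F s) < ennreal e"
          using t 3 inc(1)[of s t] by (simp add: F_def)
        then have Ft: "F t - F s < e"
          using mono[of s t] t by (subst (asm) ennreal_less_iff) auto
        show "eventually (\<lambda>x. dist (F x) (F s) < e) (at_right s)"
          unfolding eventually_at_right_field
        proof (intro exI[of _ t] conjI allI impI)
          fix y assume "s < y" "y < t"
          then show "dist (F y) (F s) < e"
            using mono[of s y] mono[of y t] Ft by (auto simp: dist_real_def)
        qed (use t in auto)
      qed
    qed
  qed
  have \<mu>: "arc_measure g a b = interval_measure F"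
    by (simp add: arc_measure_def F_def[abs_def])
  note Ioc = emeasure_interval_measure_Ioc[OF _ mono rc]
  show Ioc': "emeasure (arc_measure g a b) {u<..v} = arc_length g u v" if "a \<le> u" "u \<le> v" "v \<le> b" for u v
    using that inc(1)[of u v] Ioc[of u v] by (simp add: \<mu> F_def min_absorb1)
  have "emeasure (interval_measure F) {a} \<le> emeasure (interval_measure F) {a - 1<..a}"
    by (intro emeasure_mono) auto
  also have "\<dots> = 0" using Ioc[of "a-1" a] F0 by simp
  finally show *: "emeasure (arc_measure g a b) {a} = 0" by (simp add: \<mu>)
  have "emeasure (arc_measure g a b) {a..b} = emeasure (arc_measure g a b) ({a} \<union> {a<..b})"
    using \<open>a \<le> b\<close> by (intro arg_cong2[where f=emeasure]) auto
  also have "\<dots> = arc_length g a b"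
    using * Ioc'[of a b] \<open>a \<le> b\<close> by (subst plus_emeasure[symmetric]) (auto simp: \<mu>)
  finally show "emeasure (arc_measure g a b) {a..b} = arc_length g a b" .
qed

lemma sets_arc_measure [measurable_cong, simp]: "sets (arc_measure g a b) = sets borel"
  by (simp add: arc_measure_def)

lemma space_arc_measure [simp]: "space (arc_measure g a b) = UNIV"
  by (simp add: arc_measure_def)

section \<open>Integration with respect to arc length\<close>

text \<open>Chord bounds that hold for all short intervals around each point hold for the whole interval.\<close>

lemma weighted_chord_le:
  fixes h :: "real \<Rightarrow> 'a::metric_space" and A :: "real \<Rightarrow> real"
  assumes "a \<le> b" "0 \<le> c"
    and local: "\<And>s. a \<le> s \<Longrightarrow> s \<le> b \<Longrightarrow> \<exists>\<delta>>0. \<forall>u v. a \<le> u \<and> u \<le> s \<and> s \<le> v \<and> v \<le> b \<and> v - u < \<delta>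
      \<longrightarrow> c * dist (h u) (h v) \<le> A v - A u"
  shows "c * dist (h a) (h b) \<le> A b - A a"
proof -
  define P where "P x y \<longleftrightarrow> (a \<le> x \<and> y \<le> b \<longrightarrow> c * dist (h x) (h y) \<le> A y - A x)" for x y
  have "P a b" using \<open>a \<le> b\<close>
  proof (induction rule: Bolzano)
    case (trans x y z)
    show ?case unfolding P_def
    proof
      assume "a \<le> x \<and> z \<le> b"
      then have "c * dist (h x) (h y) + c * dist (h y) (h z) \<le> A z - A x"
        using trans by (auto simp: P_def)
      moreover have "c * dist (h x) (h z) \<le> c * dist (h x) (h y) + c * dist (h y) (h z)"
        using mult_left_mono[OF dist_triangle[of "h x" "h z" "h y"] \<open>0 \<le> c\<close>] by (simp add: distrib_left)
      ultimately show "c * dist (h x) (h z) \<le> A z - A x" by simp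
    qed
  next
    case (local s)
    then show ?case unfolding P_def using assms(3)[of s] by meson
  qed
  then show ?thesis by (simp add: P_def)
qed

lemma nn_integral_arc_measure_ge:
  fixes g :: "real \<Rightarrow> 'a::euclidean_space"
  assumes "arc_length g a b < \<infinity>" "continuous_on {a..b} g" "a \<le> b"
    and "\<And>t. t \<in> {a..b} \<Longrightarrow> c \<le> F t"
  shows "ennreal c * arc_length g a b \<le> (\<integral>\<^sup>+t\<in>{a..b}. ennreal (F t) \<partial>arc_measure g a b)"
proof -
  have "ennreal c * arc_length g a b = (\<integral>\<^sup>+t\<in>{a..b}. ennreal c \<partial>arc_measure g a b)"
    by (subst nn_integral_cmult_indicator) (auto simp: emeasure_arc_measure_Icc[OF assms(1-3)])
  also have "\<dots> \<le> (\<integral>\<^sup>+t\<in>{a..b}. ennreal (F t) \<partial>arc_measure g a b)"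
    using assms(4) by (intro nn_integral_mono) (auto split: split_indicator intro!: ennreal_leI)
  finally show ?thesis .
qed

text \<open>The integral of \<open>F\<close> along \<open>h\<close> is controlled by chords alone: it suffices that each chord, times
  any lower bound of \<open>F\<close> on the interval that it spans, is bounded by the increment of \<open>A\<close>.\<close>

lemma
  fixes h :: "real \<Rightarrow> 'a::euclidean_space" and A :: "real \<Rightarrow> real"
  assumes "a \<le> b" and h: "continuous_on {a..b} h" and F: "continuous_on {a..b} F"
    and pos: "\<And>t. t \<in> {a..b} \<Longrightarrow> 0 < F t"
    and chord: "\<And>u v c. a \<le> u \<Longrightarrow> u \<le> v \<Longrightarrow> v \<le> b \<Longrightarrow> 0 \<le> c \<Longrightarrow> (\<And>t. t \<in> {u..v} \<Longrightarrow> c \<le> F t)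
        \<Longrightarrow> c * dist (h u) (h v) \<le> A v - A u"
  shows arc_length_finite_of_weighted_chords: "arc_length h a b < \<infinity>"
    and nn_integral_arc_measure_le:
      "(\<integral>\<^sup>+t\<in>{a..b}. ennreal (F t) \<partial>arc_measure h a b) \<le> ennreal (A b - A a)"
proof -
  have A: "A u \<le> A v" if "a \<le> u" "u \<le> v" "v \<le> b" for u v
    using chord[of u v 0] less_imp_le[OF pos] that by simp
  have len: "arc_length h u v \<le> ennreal ((A v - A u) / c)"
    if uv: "a \<le> u" "u \<le> v" "v \<le> b" and "0 < c" "\<And>t. t \<in> {u..v} \<Longrightarrow> c \<le> F t" for u v c
  proof -
    have "dist (h s) (h t) \<le> A t / c - A s / c" if "u \<le> s" "s \<le> t" "t \<le> v" for s t
    proof -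
      have "c * dist (h s) (h t) \<le> A t - A s" using uv that \<open>0 < c\<close> \<open>\<And>t. _ \<Longrightarrow> c \<le> F t\<close>
        by (intro chord) auto
      then show ?thesis using \<open>0 < c\<close> by (simp add: field_simps)
    qed
    then have "arc_length h u v \<le> ennreal (A v / c - A u / c)"
      by (intro arc_length_le[OF \<open>u \<le> v\<close>]) auto
    then show ?thesis by (simp add: diff_divide_distrib)
  qed
  obtain m where m: "m \<in> {a..b}" "\<And>t. t \<in> {a..b} \<Longrightarrow> F m \<le> F t"
    using continuous_attains_inf[OF _ _ F] \<open>a \<le> b\<close> by (auto simp: compact_Icc)
  show fin: "arc_length h a b < \<infinity>"
    using len[of a b "F m"] pos[OF m(1)] m(2) \<open>a \<le> b\<close> by (auto intro: le_less_trans)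
  note inc = arc_length_increment[OF fin]
  define V where "V t = enn2real (arc_length h a t)" for t
  have lenV: "c * (V v - V u) \<le> A v - A u"
    if uv: "a \<le> u" "u \<le> v" "v \<le> b" and "0 \<le> c" "\<And>t. t \<in> {u..v} \<Longrightarrow> c \<le> F t" for u v c
  proof (cases "c = 0")
    case True then show ?thesis using A uv by simp
  next
    case False
    then have "0 < c" using that by simp
    have "ennreal (V v - V u) \<le> ennreal ((A v - A u) / c)"
      using len[OF uv \<open>0 < c\<close> that(5)] inc(1)[OF uv] by (simp add: V_def)
    then have "V v - V u \<le> (A v - A u) / c"
      using A[OF uv] \<open>0 < c\<close> by (subst (asm) ennreal_le_iff) auto
    then show ?thesis using \<open>0 < c\<close> by (simp add: field_simps)
  qed
  let ?\<mu> = "arc_measure h a b"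
  define F' where "F' t = (if t \<in> {a..b} then F t else 0)" for t
  have [measurable]: "F' \<in> borel_measurable borel"
    unfolding F'_def by (intro borel_measurable_continuous_on_if F) auto
  have Veps: "(\<integral>\<^sup>+t\<in>{a..b}. ennreal (F t) \<partial>?\<mu>) \<le> ennreal (A b - A a + e * V b)" if "0 < e" for e
  proof -
    define P where "P x y \<longleftrightarrow> (a \<le> x \<and> y \<le> b \<longrightarrow>
      (\<integral>\<^sup>+t\<in>{x<..y}. ennreal (F' t) \<partial>?\<mu>) \<le> ennreal (A y - A x + e * (V y - V x)))" for x y
    \<comment> \<open>On short intervals \<open>F\<close> oscillates by less than \<open>e\<close>, which costs \<open>e\<close> times the length.\<close>
    have "P a b" using \<open>a \<le> b\<close>
    proof (induction rule: Bolzano)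
      case (trans x y z)
      show ?case unfolding P_def
      proof
        assume xz: "a \<le> x \<and> z \<le> b"
        have "(\<integral>\<^sup>+t\<in>{x<..z}. ennreal (F' t) \<partial>?\<mu>)
            = (\<integral>\<^sup>+t. (ennreal (F' t) * indicator {x<..y} t + ennreal (F' t) * indicator {y<..z} t) \<partial>?\<mu>)"
          using trans by (intro nn_integral_cong) (auto split: split_indicator)
        also have "\<dots> = (\<integral>\<^sup>+t\<in>{x<..y}. ennreal (F' t) \<partial>?\<mu>) + (\<integral>\<^sup>+t\<in>{y<..z}. ennreal (F' t) \<partial>?\<mu>)"
          by (intro nn_integral_add) auto
        also have "\<dots> \<le> ennreal (A y - A x + e * (V y - V x)) + ennreal (A z - A y + e * (V z - V y))"
          using trans xz by (intro add_mono) (auto simp: P_def)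
        also have "\<dots> = ennreal (A z - A x + e * (V z - V x))"
        proof -
          have "0 \<le> e * (V y - V x)" "0 \<le> e * (V z - V y)"
            using inc(2)[of x y] inc(2)[of y z] trans xz \<open>0 < e\<close> by (auto simp: V_def)
          then have "0 \<le> A y - A x + e * (V y - V x)" "0 \<le> A z - A y + e * (V z - V y)"
            using A[of x y] A[of y z] trans xz by auto
          then show ?thesis by (subst ennreal_plus[symmetric]) (auto simp: algebra_simps)
        qed
        finally show "(\<integral>\<^sup>+t\<in>{x<..z}. ennreal (F' t) \<partial>?\<mu>) \<le> ennreal (A z - A x + e * (V z - V x))" .
      qed
    next
      case (local s)
      then obtain d where d: "d > 0" "\<And>t. t \<in> {a..b} \<Longrightarrow> dist t s < d \<Longrightarrow> dist (F t) (F s) < e/2"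
        using F \<open>0 < e\<close> unfolding continuous_on_iff by (metis atLeastAtMost_iff half_gt_zero)
      show ?case unfolding P_def
      proof (intro exI[of _ d] conjI allI impI \<open>d > 0\<close>)
        fix u v assume *: "u \<le> s \<and> s \<le> v \<and> v - u < d" "a \<le> u \<and> v \<le> b"
        define c where "c = max 0 (F s - e/2)"
        have cF: "c \<le> F t \<and> F t \<le> c + e" if "t \<in> {u..v}" for t
        proof -
          have "dist t s < d" using * that by (auto simp: dist_real_def)
          then have "\<bar>F t - F s\<bar> < e/2" "0 < F t"
            using d(2)[of t] pos[of t] * that by (auto simp: dist_real_def)
          then show ?thesis unfolding c_def abs_less_iff by linarith
        qed
        have uv: "a \<le> u" "u \<le> v" "v \<le> b" "0 \<le> c" using * by (auto simp: c_def)
        have "(\<integral>\<^sup>+t\<in>{u<..v}. ennreal (F' t) \<partial>?\<mu>) \<le> (\<integral>\<^sup>+t\<in>{u<..v}. ennreal (c + e) \<partial>?\<mu>)"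
          using cF uv by (intro nn_integral_mono) (auto split: split_indicator intro!: ennreal_leI simp: F'_def)
        also have "\<dots> = ennreal (c + e) * arc_length h u v"
          using uv by (subst nn_integral_cmult_indicator)
            (auto simp: emeasure_arc_measure_Ioc[OF fin h \<open>a \<le> b\<close>])
        also have "\<dots> = ennreal ((c + e) * (V v - V u))"
          using uv inc(1)[of u v] \<open>0 < e\<close> by (simp add: V_def ennreal_mult')
        also have "\<dots> \<le> ennreal (A v - A u + e * (V v - V u))"
          using lenV[of u v c] uv cF by (intro ennreal_leI) (auto simp: algebra_simps)
        finally show "(\<integral>\<^sup>+t\<in>{u<..v}. ennreal (F' t) \<partial>?\<mu>) \<le> ennreal (A v - A u + e * (V v - V u))" .
      qed
    qed
    then have 1: "(\<integral>\<^sup>+t\<in>{a<..b}. ennreal (F' t) \<partial>?\<mu>) \<le> ennreal (A b - A a + e * V b)"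
      by (simp add: P_def V_def)
    have "(\<integral>\<^sup>+t\<in>{a..b}. ennreal (F t) \<partial>?\<mu>) = (\<integral>\<^sup>+t\<in>{a<..b}. ennreal (F' t) \<partial>?\<mu>)"
    proof (rule nn_integral_cong_AE)
      have "{a} \<in> null_sets ?\<mu>"
        using emeasure_arc_measure_singleton[OF fin h \<open>a \<le> b\<close>] by (intro null_setsI) auto
      then have "AE t in ?\<mu>. t \<notin> {a}" by (rule AE_not_in)
      then show "AE t in ?\<mu>. ennreal (F t) * indicator {a..b} t = ennreal (F' t) * indicator {a<..b} t"
        by eventually_elim (auto split: split_indicator simp: F'_def)
    qed
    with 1 show ?thesis by simp
  qed
  show "(\<integral>\<^sup>+t\<in>{a..b}. ennreal (F t) \<partial>?\<mu>) \<le> ennreal (A b - A a)"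
  proof (rule ennreal_le_epsilon)
    fix e :: real assume "0 < e"
    have V0: "0 \<le> V b" by (simp add: V_def)
    have "(\<integral>\<^sup>+t\<in>{a..b}. ennreal (F t) \<partial>?\<mu>) \<le> ennreal (A b - A a + e / (V b + 1) * V b)"
      using V0 \<open>0 < e\<close> by (intro Veps) auto
    also have "\<dots> \<le> ennreal (A b - A a + e)"
    proof (intro ennreal_leI add_left_mono)
      have "e * V b \<le> e * (V b + 1)" using \<open>0 < e\<close> by simp
      then show "e / (V b + 1) * V b \<le> e" using V0 by (simp add: field_simps)
    qed
    also have "\<dots> = ennreal (A b - A a) + ennreal e"
      using A[of a b] \<open>a \<le> b\<close> \<open>0 < e\<close> by (intro ennreal_plus) auto
    finally show "(\<integral>\<^sup>+t\<in>{a..b}. ennreal (F t) \<partial>?\<mu>) \<le> ennreal (A b - A a) + ennreal e" .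
  qed
qed

text \<open>The contribution of the interval \<open>k\<close> to \<open>curve_integral \<rho> g\<close>; it is \<open>0\<close> if the arc over \<open>k\<close>
  meets infinity.\<close>

definition piece_integral :: "('a::euclidean_space \<Rightarrow> real) \<Rightarrow> (real \<Rightarrow> 'a option) \<Rightarrow> real set \<Rightarrow> ennreal" where
  "piece_integral \<rho> g k = (if None \<in> g ` k then 0 else
     \<integral>\<^sup>+t\<in>k. ennreal (\<rho> (the (g t))) \<partial>arc_measure (the \<circ> g) (Inf k) (Sup k))"

lemma piece_integral_singleton: "piece_integral \<rho> g {x..x} = 0"
proof -
  have "emeasure (arc_measure (the \<circ> g) x x) {x} = 0"
    by (rule emeasure_arc_measure_singleton) auto
  then have "{x} \<in> null_sets (arc_measure (the \<circ> g) x x)" by (intro null_setsI) auto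
  then have "(\<integral>\<^sup>+t\<in>{x..x}. ennreal (\<rho> (the (g t))) \<partial>arc_measure (the \<circ> g) x x) = 0"
    using nn_integral_null_set[of "{x}" "arc_measure (the \<circ> g) x x"] by simp
  then show ?thesis by (simp add: piece_integral_def)
qed

lemma curve_integral_eq_interval_variation:
  "curve_integral \<rho> g = interval_variation (piece_integral \<rho> g) 0 1"
proof -
  have "(\<Sum>k\<in>{k\<in>d. None \<notin> g ` k}. \<integral>\<^sup>+t\<in>k. ennreal (\<rho> (the (g t))) \<partial>arc_measure (the \<circ> g) (Inf k) (Sup k))
      = (\<Sum>k\<in>d. piece_integral \<rho> g k)" if "d division_of {0..1}" for d
    using division_of_finite[OF that]
    by (subst sum.inter_filter) (auto simp: piece_integral_def intro!: sum.cong)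
  then show ?thesis unfolding curve_integral_def interval_variation_def
    by (intro SUP_cong) auto
qed

section \<open>Boundaries in the extended space and Ferrand's density\<close>

lemma ext_dist_commute: "ext_dist p q = ext_dist q p"
  by (cases p; cases q) (auto simp: norm_minus_commute)

lemma ext_dist_nonneg [simp]: "0 \<le> ext_dist p q"
  by (cases p; cases q) auto

lemma ext_dist_pos: "p \<noteq> q \<Longrightarrow> 0 < ext_dist p q"
  by (cases p; cases q) auto

lemma ext_dist_refl [simp]: "ext_dist p p = 0"
  by (cases p) auto

lemma ext_dist_triangle_finite:
  "ext_dist a b \<le> ext_dist (Some x) a + ext_dist (Some x) b"
  using norm_triangle_ineq4[of "x - the b" "x - the a"]
  by (cases a; cases b) auto

lemma ext_dist_perturb:
  assumes "0 < d" "d \<le> ext_dist (Some x) a"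
  shows "ext_dist (Some y) a \<le> (1 + norm (x - y) / d) * ext_dist (Some x) a"
proof (cases a)
  case None then show ?thesis using assms by simp
next
  case (Some z)
  have "norm (y - z) \<le> norm (x - z) + norm (x - y)"
    using norm_triangle_ineq4[of "x - z" "x - y"] by simp
  also have "norm (x - y) = norm (x - y) / d * d" using assms by simp
  also have "\<dots> \<le> norm (x - y) / d * norm (x - z)"
    using assms Some by (intro mult_left_mono) auto
  finally show ?thesis using Some by (simp add: algebra_simps)
qed

lemma open_finite_part: "openin ext_space X \<Longrightarrow> open {x. Some x \<in> X}"
  using openin_continuous_map_preimage[OF continuous_map_Some[of euclidean], of X] by simp

lemma ext_boundary_disjoint: "openin ext_space X \<Longrightarrow> a \<in> ext_boundary X \<Longrightarrow> a \<notin> X"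
  by (simp add: frontier_of_def interior_of_openin)

lemma ext_boundary_gap:
  assumes X: "openin ext_space X" and "Some x \<in> X"
  obtains d where "0 < d" "\<And>a. a \<in> ext_boundary X \<Longrightarrow> d \<le> ext_dist (Some x) a"
proof -
  obtain e where e: "e > 0" "ball x e \<subseteq> {x. Some x \<in> X}"
    using open_finite_part[OF X] assms(2) open_contains_ball by blast
  have "min 1 e \<le> ext_dist (Some x) a" if "a \<in> ext_boundary X" for a
  proof (cases a)
    case (Some z)
    then have "z \<notin> ball x e" using e ext_boundary_disjoint[OF X that] by auto
    then show ?thesis using Some by (simp add: dist_norm)
  qed simp
  then show ?thesis using that[of "min 1 e"] e by auto
qed

abbreviation ferrand_term :: "'a::euclidean_space \<Rightarrow> 'a option \<Rightarrow> 'a option \<Rightarrow> real" where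
  "ferrand_term x a b \<equiv> ext_dist a b / (ext_dist (Some x) a * ext_dist (Some x) b)"

lemma ferrand_term_bounded:
  assumes "0 < d" "d \<le> ext_dist (Some x) a" "d \<le> ext_dist (Some x) b"
  shows "ferrand_term x a b \<le> 2 / d"
proof -
  let ?p = "ext_dist (Some x) a" and ?q = "ext_dist (Some x) b"
  have pq: "0 < ?p" "0 < ?q" using assms by auto
  have "ferrand_term x a b \<le> (?p + ?q) / (?p * ?q)"
    using ext_dist_triangle_finite[of a b x] pq by (intro divide_right_mono) auto
  also have "\<dots> = 1 / ?q + 1 / ?p" using pq by (simp add: field_simps)
  also have "\<dots> \<le> 1 / d + 1 / d" using assms by (intro add_mono divide_left_mono) auto
  finally show ?thesis by simp
qed

lemma ferrand_density_bdd:
  assumes X: "openin ext_space X" and "Some x \<in> X"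
  shows "bdd_above ((\<lambda>(a, b). ferrand_term x a b) ` (ext_boundary X \<times> ext_boundary X))"
proof -
  obtain d where d: "0 < d" "\<And>a. a \<in> ext_boundary X \<Longrightarrow> d \<le> ext_dist (Some x) a"
    by (rule ext_boundary_gap[OF assms]) blast
  show ?thesis using ferrand_term_bounded[OF d(1) d(2) d(2)]
    by (intro bdd_aboveI[where M="2/d"]) auto
qed

lemma ferrand_density_ge:
  assumes "openin ext_space X" "Some x \<in> X" "a \<in> ext_boundary X" "b \<in> ext_boundary X"
  shows "ferrand_term x a b \<le> ferrand_density X x"
  unfolding ferrand_density_def
  using cSUP_upper[OF _ ferrand_density_bdd[OF assms(1,2)], of "(a, b)"] assms by auto

lemma ferrand_density_le:
  assumes "ext_boundary X \<noteq> {}"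
    and "\<And>a b. a \<in> ext_boundary X \<Longrightarrow> b \<in> ext_boundary X \<Longrightarrow> ferrand_term x a b \<le> c"
  shows "ferrand_density X x \<le> c"
  unfolding ferrand_density_def using assms by (intro cSUP_least) auto

lemma ferrand_density_pos:
  assumes "openin ext_space X" "Some x \<in> X" "a \<in> ext_boundary X" "b \<in> ext_boundary X" "a \<noteq> b"
  shows "0 < ferrand_density X x"
proof -
  have "Some x \<noteq> a" "Some x \<noteq> b" using assms(2-4) ext_boundary_disjoint[OF assms(1)] by auto
  then have "0 < ferrand_term x a b" using \<open>a \<noteq> b\<close> by (intro divide_pos_pos mult_pos_pos ext_dist_pos)
  then show ?thesis using ferrand_density_ge[OF assms(1-4)] by simp
qed

text \<open>The distance of \<open>y\<close> to a boundary point is at most \<open>1 + norm (x - y) / d\<close> times the distance of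
  \<open>x\<close> to it, where \<open>d\<close> bounds the latter from below; a Ferrand term contains two such distances.\<close>

lemma ferrand_density_perturb:
  assumes X: "openin ext_space X" "Some y \<in> X" and ne: "ext_boundary X \<noteq> {}"
    and d: "0 < d" "\<And>a. a \<in> ext_boundary X \<Longrightarrow> d \<le> ext_dist (Some x) a"
  shows "ferrand_density X x \<le> (1 + norm (x - y) / d)\<^sup>2 * ferrand_density X y"
proof (rule ferrand_density_le[OF ne])
  fix a b assume ab: "a \<in> ext_boundary X" "b \<in> ext_boundary X"
  define r where "r = 1 + norm (x - y) / d"
  have r: "1 \<le> r" using d by (simp add: r_def)
  have pos: "0 < ext_dist (Some y) a" "0 < ext_dist (Some y) b"
    "0 < ext_dist (Some x) a" "0 < ext_dist (Some x) b"
    using X(2) ext_boundary_disjoint[OF X(1)] ab d(1) d(2)[OF ab(1)] d(2)[OF ab(2)]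
    by (auto intro!: ext_dist_pos)
  have le: "ext_dist (Some y) a * ext_dist (Some y) b \<le>
      (r * ext_dist (Some x) a) * (r * ext_dist (Some x) b)"
    using ext_dist_perturb[OF d(1) d(2)[OF ab(1)], of y] ext_dist_perturb[OF d(1) d(2)[OF ab(2)], of y] r
    unfolding r_def[symmetric] by (intro mult_mono) auto
  have "ferrand_term x a b = r\<^sup>2 * (ext_dist a b / ((r * ext_dist (Some x) a) * (r * ext_dist (Some x) b)))"
    using r by (simp add: power2_eq_square)
  also have "\<dots> \<le> r\<^sup>2 * ferrand_term y a b"
    using le pos r by (intro mult_left_mono divide_left_mono) auto
  also have "\<dots> \<le> r\<^sup>2 * ferrand_density X y"
    using ferrand_density_ge[OF X ab] by (intro mult_left_mono) auto
  finally show "ferrand_term x a b \<le> (1 + norm (x - y) / d)\<^sup>2 * ferrand_density X y"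
    by (simp add: r_def)
qed

lemma continuous_on_ferrand_density:
  assumes X: "openin ext_space X" and ne: "ext_boundary X \<noteq> {}"
  shows "continuous_on {x. Some x \<in> X} (ferrand_density X)"
  unfolding continuous_on_def
proof
  fix x assume "x \<in> {x. Some x \<in> X}"
  then have x: "Some x \<in> X" by simp
  obtain d where d: "0 < d" "\<And>a. a \<in> ext_boundary X \<Longrightarrow> d \<le> ext_dist (Some x) a"
    by (rule ext_boundary_gap[OF X x]) blast
  let ?w = "ferrand_density X" and ?S = "{x. Some x \<in> X}"
  let ?r = "\<lambda>y. (1 + norm (x - y) / (d/2))\<^sup>2"
  have near: "\<forall>\<^sub>F y in at x within ?S. y \<in> ?S \<and> norm (x - y) < d/2"
    using d(1) by (auto simp: eventually_at dist_norm norm_minus_commute intro!: exI[of _ "d/2"])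
  have r: "(?r \<longlongrightarrow> 1) (at x within ?S)"
    by (rule tendsto_eq_intros refl | use d in simp)+
  show "(?w \<longlongrightarrow> ?w x) (at x within ?S)"
  proof (rule tendsto_sandwich)
    show "((\<lambda>y. ?w x / ?r y) \<longlongrightarrow> ?w x) (at x within ?S)"
      using tendsto_divide[OF tendsto_const r, of "?w x"] by simp
    show "((\<lambda>y. ?r y * ?w x) \<longlongrightarrow> ?w x) (at x within ?S)"
      using tendsto_mult[OF r tendsto_const, of "?w x"] by simp
    show "\<forall>\<^sub>F y in at x within ?S. ?w x / ?r y \<le> ?w y"
      using near
    proof eventually_elim
      case (elim y)
      have "?w x \<le> ?r y * ?w y"
      proof (rule ferrand_density_perturb[OF X _ ne])
        show "Some y \<in> X" "0 < d/2" using elim d by auto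
        show "d/2 \<le> ext_dist (Some x) a" if "a \<in> ext_boundary X" for a
          using d(1) d(2)[OF that] by simp
      qed
      moreover have "0 < ?r y" using d(1) by (intro zero_less_power add_pos_nonneg) auto
      ultimately show ?case by (simp add: pos_divide_le_eq mult.commute)
    qed
    show "\<forall>\<^sub>F y in at x within ?S. ?w y \<le> ?r y * ?w x"
      using near
    proof eventually_elim
      case (elim y)
      have "d/2 \<le> ext_dist (Some y) a" if "a \<in> ext_boundary X" for a
      proof (cases a)
        case None
        then show ?thesis using d(2)[OF that] d(1) by simp
      next
        case (Some z)
        have "norm (x - z) \<le> norm (x - y) + norm (y - z)" by (rule norm_diff_triangle_le) auto
        then show ?thesis using d(2)[OF that] elim Some by simp
      qed
      then show ?case
        using ferrand_density_perturb[OF X x ne, of "d/2" y] elim d by (simp add: norm_minus_commute)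
    qed
  qed
qed

lemma path_preimage_near:
  assumes g: "pathin (subtopology ext_space X) g" and U: "openin ext_space U"
    and t: "t \<in> {0..1}" "g t \<in> U"
  obtains \<delta> where "0 < \<delta>" "\<And>s. s \<in> {0..1} \<Longrightarrow> \<bar>s - t\<bar> < \<delta> \<Longrightarrow> g s \<in> U"
proof -
  have "continuous_map (top_of_set {0..1}) ext_space g"
    using g by (simp add: pathin_def continuous_map_in_subtopology)
  then have "openin (top_of_set {0..1}) {s \<in> {0..1}. g s \<in> U}"
    using openin_continuous_map_preimage[OF _ U] by fastforce
  then obtain e where "e > 0" "\<forall>s\<in>{0..1}. dist s t < e \<longrightarrow> s \<in> {s \<in> {0..1}. g s \<in> U}"
    using t unfolding openin_euclidean_subtopology_iff by blast
  then show ?thesis using that[of e] by (auto simp: dist_real_def)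
qed

lemma path_in_space: "pathin (subtopology ext_space X) g \<Longrightarrow> t \<in> {0..1} \<Longrightarrow> g t \<in> X"
  using continuous_map_image_subset_topspace[of "top_of_set {0..1}" "subtopology ext_space X" g]
  by (auto simp: pathin_def)

lemma continuous_on_path_finite:
  assumes g: "pathin (subtopology ext_space X) g" and "0 \<le> a" "b \<le> 1" and fin: "None \<notin> g ` {a..b}"
  shows "continuous_on {a..b} (the \<circ> g)"
  unfolding continuous_on_iff
proof (intro ballI allI impI)
  fix t e :: real assume t: "t \<in> {a..b}" and "0 < e"
  obtain x where x: "g t = Some x" using fin t by (metis imageI not_None_eq)
  have "openin ext_space (Some ` ball x e)" by simp
  then obtain \<delta> where \<delta>: "0 < \<delta>" "\<And>s. s \<in> {0..1} \<Longrightarrow> \<bar>s - t\<bar> < \<delta> \<Longrightarrow> g s \<in> Some ` ball x e"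
    using path_preimage_near[OF g, of "Some ` ball x e" t] t x \<open>0 < e\<close> assms by auto
  have "dist ((the \<circ> g) s) ((the \<circ> g) t) < e" if "s \<in> {a..b}" "dist s t < \<delta>" for s
    using \<delta>(2)[of s] that assms x by (auto simp: dist_real_def dist_commute)
  then show "\<exists>d>0. \<forall>s\<in>{a..b}. dist s t < d \<longrightarrow> dist ((the \<circ> g) s) ((the \<circ> g) t) < e"
    using \<delta>(1) by blast
qed

lemma ext_boundary_two_points:
  fixes G :: "'a::euclidean_space set"
  assumes G: "open G" "G \<noteq> {}" "G \<noteq> UNIV"
  obtains a b where "a \<in> ext_boundary (Some ` G)" "b \<in> ext_boundary (Some ` G)" "a \<noteq> b"
proof -
  have op: "openin ext_space (Some ` G)" using G by simp
  have fr: "p \<in> ext_boundary (Some ` G) \<longleftrightarrow> p \<in> ext_space closure_of (Some ` G) \<and> p \<notin> Some ` G" for p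
    by (auto simp: frontier_of_def interior_of_openin[OF op])
  have fin: "Some a \<in> ext_boundary (Some ` G)" if "a \<in> frontier G" for a
  proof -
    have "a \<in> closure G" "a \<notin> G" using that G by (auto simp: frontier_def interior_open)
    moreover have "\<exists>y. y \<in> Some ` G \<and> y \<in> T" if "Some a \<in> T" "openin ext_space T" for T
    proof -
      have "open {x. Some x \<in> T}" using open_finite_part[OF that(2)] .
      then have "{x. Some x \<in> T} \<inter> G \<noteq> {}"
        using \<open>a \<in> closure G\<close> that open_Int_closure_eq_empty[of "{x. Some x \<in> T}" G] by auto
      then show ?thesis by blast
    qed
    ultimately show ?thesis by (auto simp: fr in_closure_of)
  qed
  obtain a where a: "a \<in> frontier G" using G frontier_eq_empty[of G] by blast
  show ?thesis
  proof (cases "bounded G")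
    case False
    have "\<exists>y. y \<in> Some ` G \<and> y \<in> T" if "None \<in> T" "openin ext_space T" for T
    proof -
      have "\<exists>C. compact C \<and> T = insert None (Some ` (UNIV - C))"
        using that unfolding openin_Alexandroff_compactification by auto
      then obtain C where C: "compact C" "T = insert None (Some ` (UNIV - C))" by blast
      then have "\<not> G \<subseteq> C" using False compact_imp_bounded bounded_subset by blast
      then show ?thesis using C by auto
    qed
    then have "None \<in> ext_boundary (Some ` G)" by (auto simp: fr in_closure_of)
    then show ?thesis using that fin[OF a] by blast
  next
    case True
    \<comment> \<open>The ray from \<open>x\<close> away from \<open>a\<close> leaves the bounded set \<open>G\<close> at a boundary point other than \<open>a\<close>.\<close>
    obtain x where x: "x \<in> G" using G by blast
    have xa: "x \<noteq> a" using a x G by (auto simp: frontier_def interior_open)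
    obtain d where d: "0 < d" "x + d *\<^sub>R (x - a) \<in> frontier G"
      using ray_to_frontier[of G x "x - a"] True x xa G by (auto simp: interior_open)
    have "x + d *\<^sub>R (x - a) \<noteq> a"
    proof
      assume "x + d *\<^sub>R (x - a) = a"
      then have "(1 + d) *\<^sub>R (x - a) = 0" by (simp add: algebra_simps)
      then show False using d xa by simp
    qed
    then show ?thesis using that fin[OF a] fin[OF d(2)] by blast
  qed
qed

section \<open>Quasi-Moebius involutions and Ferrand's metric\<close>

lemma ratio_distortion:
  fixes U V U' V' P k l :: real
  assumes "0 < V" "0 < V'" "0 \<le> U'" "0 \<le> l" "0 < Q" and U: "U' * P \<le> k * U" and V: "V \<le> l * (V' * P * Q)"
  shows "U' / V' \<le> k * l * Q * (U / V)"
proof -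
  have "U' * V \<le> U' * (l * (V' * P * Q))" using assms by (intro mult_left_mono) auto
  also have "\<dots> = (U' * P) * (l * V' * Q)" by simp
  also have "\<dots> \<le> (k * U) * (l * V' * Q)" using assms by (intro mult_right_mono) auto
  finally have "U' * V \<le> k * l * Q * U * V'" by (simp add: mult_ac)
  then show ?thesis using assms by (simp add: field_simps)
qed

text \<open>An involution of the extended space that exchanges \<open>0\<close> and infinity and transforms distances,
  up to the factor \<open>K\<close>, as an inversion does: \<open>ext_dist p q\<close> is divided by \<open>m p * m q\<close>.  For the
  inversion in the unit sphere, \<open>K = 1\<close> and \<open>m (Some x) = norm x\<close> for \<open>x \<noteq> 0\<close>; the convention for
  distances to infinity makes \<open>m None = m (Some 0) = 1\<close> the right choice at the two exceptional
  points.\<close>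

locale quasi_moebius_involution =
  fixes f :: "'a::euclidean_space option \<Rightarrow> 'a option" and m :: "'a option \<Rightarrow> real" and K :: real
  assumes cont: "continuous_map ext_space ext_space f"
    and invol [simp]: "f (f p) = p"
    and f_None [simp]: "f None = Some 0"
    and m_pos: "0 < m p"
    and m_cont: "continuous_on (- {0}) (\<lambda>x. m (Some x))"
    and K_ge_1: "1 \<le> K"
    and upper: "ext_dist (f p) (f q) * (m p * m q) \<le> K * ext_dist p q"
    and lower: "ext_dist p q \<le> K * (ext_dist (f p) (f q) * (m p * m q))"
begin

lemma f_zero [simp]: "f (Some 0) = None"
  using invol[of None] by simp

lemma f_eq_iff [simp]: "f p = f q \<longleftrightarrow> p = q"
  by (metis invol)

lemma f_eq_None_iff [simp]: "f p = None \<longleftrightarrow> p = Some 0"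
  by (metis invol f_None)

lemma f_eq_zero_iff [simp]: "f p = Some 0 \<longleftrightarrow> p = None"
  by (metis invol f_None)

lemma image_image [simp]: "f ` f ` X = X"
  by (simp add: image_image)

lemma inj_f [simp]: "inj_on f X"
  by (simp add: inj_on_def)

lemma homeomorphic: "homeomorphic_map ext_space ext_space f"
  using homeomorphic_maps_map[of ext_space ext_space f f] cont
  by (simp add: homeomorphic_maps_def)

lemma open_image: "openin ext_space X \<Longrightarrow> openin ext_space (f ` X)"
  using homeomorphic_map_openness_eq[OF homeomorphic, of X] by (simp add: UNIV_option_conv[symmetric])

lemma boundary_image: "ext_boundary (f ` X) = f ` ext_boundary X"
  by (rule homeomorphic_map_frontier_of[OF homeomorphic]) (simp add: UNIV_option_conv[symmetric])

lemma path_image: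
  assumes "pathin (subtopology ext_space X) g"
  shows "pathin (subtopology ext_space (f ` X)) (f \<circ> g)"
  using assms cont
  by (auto simp: pathin_def continuous_map_in_subtopology intro: continuous_map_compose)

lemma abs_ratio_distortion:
  assumes "a \<noteq> x" "b \<noteq> y"
  shows "abs_ratio (f a) (f x) (f b) (f y) \<le> K ^ 4 * abs_ratio a x b y"
proof -
  have "ext_dist (f a) (f b) * ext_dist (f x) (f y) * (m a * m b * m x * m y)
      = (ext_dist (f a) (f b) * (m a * m b)) * (ext_dist (f x) (f y) * (m x * m y))" by (simp add: mult_ac)
  also have "\<dots> \<le> (K * ext_dist a b) * (K * ext_dist x y)"
    using K_ge_1 by (intro mult_mono upper) (auto intro!: mult_nonneg_nonneg less_imp_le[OF m_pos])
  finally have 1: "ext_dist (f a) (f b) * ext_dist (f x) (f y) * (m a * m b * m x * m y)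
     \<le> K\<^sup>2 * (ext_dist a b * ext_dist x y)" by (simp add: power2_eq_square mult_ac)
  have "ext_dist a x * ext_dist b y \<le>
      (K * (ext_dist (f a) (f x) * (m a * m x))) * (K * (ext_dist (f b) (f y) * (m b * m y)))"
    using K_ge_1 by (intro mult_mono lower) (auto intro!: mult_nonneg_nonneg less_imp_le[OF m_pos])
  then have 2: "ext_dist a x * ext_dist b y \<le>
      K\<^sup>2 * (ext_dist (f a) (f x) * ext_dist (f b) (f y) * (m a * m b * m x * m y) * 1)"
    by (simp add: power2_eq_square mult_ac)
  have "abs_ratio (f a) (f x) (f b) (f y) \<le> K\<^sup>2 * K\<^sup>2 * 1 * abs_ratio a x b y"
    unfolding abs_ratio_def
    by (rule ratio_distortion[OF _ _ _ _ _ 1 2]) (use assms in \<open>auto intro!: mult_pos_pos ext_dist_pos\<close>)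
  then show ?thesis by (simp flip: power_add)
qed

lemma ferrand_term_distortion:
  assumes "f (Some x) = Some y" "a \<noteq> Some x" "b \<noteq> Some x"
  shows "ferrand_term y (f a) (f b) \<le> K ^ 3 * (m (Some x))\<^sup>2 * ferrand_term x a b"
proof -
  let ?m = "m (Some x)"
  have "ext_dist (Some x) a * ext_dist (Some x) b \<le>
      (K * (ext_dist (f (Some x)) (f a) * (?m * m a))) * (K * (ext_dist (f (Some x)) (f b) * (?m * m b)))"
    using K_ge_1 by (intro mult_mono lower) (auto intro!: mult_nonneg_nonneg less_imp_le[OF m_pos])
  then have 2: "ext_dist (Some x) a * ext_dist (Some x) b \<le>
      K\<^sup>2 * (ext_dist (Some y) (f a) * ext_dist (Some y) (f b) * (m a * m b) * ?m\<^sup>2)"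
    by (simp add: power2_eq_square mult_ac assms(1))
  have "Some y \<noteq> f a" "Some y \<noteq> f b" using assms by (metis f_eq_iff)+
  then have "ferrand_term y (f a) (f b) \<le> K * K\<^sup>2 * ?m\<^sup>2 * ferrand_term x a b"
    using assms m_pos[of "Some x"]
    by (intro ratio_distortion[OF _ _ _ _ _ upper 2]) (auto intro!: mult_pos_pos ext_dist_pos)
  then show ?thesis by (simp add: power2_eq_square power3_eq_cube)
qed

lemma ferrand_density_distortion:
  assumes X: "openin ext_space X" and x: "Some x \<in> X" and y: "f (Some x) = Some y"
    and ne: "ext_boundary X \<noteq> {}"
  shows "ferrand_density (f ` X) y \<le> K ^ 3 * (m (Some x))\<^sup>2 * ferrand_density X x"
proof (rule ferrand_density_le)
  show "ext_boundary (f ` X) \<noteq> {}" using ne by (simp add: boundary_image)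
  fix a' b' assume "a' \<in> ext_boundary (f ` X)" "b' \<in> ext_boundary (f ` X)"
  then obtain a b where ab: "a' = f a" "b' = f b" "a \<in> ext_boundary X" "b \<in> ext_boundary X"
    by (auto simp: boundary_image)
  have "ferrand_term y a' b' \<le> K ^ 3 * (m (Some x))\<^sup>2 * ferrand_term x a b"
    using ab x ext_boundary_disjoint[OF X] unfolding ab(1,2) by (intro ferrand_term_distortion y) auto
  also have "\<dots> \<le> K ^ 3 * (m (Some x))\<^sup>2 * ferrand_density X x"
    using ferrand_density_ge[OF X x ab(3,4)] K_ge_1 by (intro mult_left_mono) auto
  finally show "ferrand_term y a' b' \<le> K ^ 3 * (m (Some x))\<^sup>2 * ferrand_density X x" .
qed

end

lemma chord_limit_left:
  fixes h :: "real \<Rightarrow> 'a::metric_space"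
  assumes "continuous_on {u..z} h" "u < z" "\<And>s. u \<le> s \<Longrightarrow> s < z \<Longrightarrow> c * dist (h u) (h s) \<le> B"
  shows "c * dist (h u) (h z) \<le> B"
proof (rule tendsto_upperbound)
  have "(h \<longlongrightarrow> h z) (at z within {u..z})"
    using assms by (auto simp: continuous_on_def)
  then have "(h \<longlongrightarrow> h z) (at_left z)" using at_within_Icc_at_left[OF \<open>u < z\<close>] by simp
  then show "((\<lambda>s. c * dist (h u) (h s)) \<longlongrightarrow> c * dist (h u) (h z)) (at_left z)"
    by (intro tendsto_intros)
  show "\<forall>\<^sub>F s in at_left z. c * dist (h u) (h s) \<le> B"
    using assms by (auto simp: eventually_at_left_field intro!: exI[of _ u])
qed simp

lemma chord_limit_right:
  fixes h :: "real \<Rightarrow> 'a::metric_space"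
  assumes "continuous_on {z..v} h" "z < v" "\<And>s. z < s \<Longrightarrow> s \<le> v \<Longrightarrow> c * dist (h s) (h v) \<le> B"
  shows "c * dist (h z) (h v) \<le> B"
proof (rule tendsto_upperbound)
  have "(h \<longlongrightarrow> h z) (at z within {z..v})"
    using assms by (auto simp: continuous_on_def)
  then have "(h \<longlongrightarrow> h z) (at_right z)" using at_within_Icc_at_right[OF \<open>z < v\<close>] by simp
  then show "((\<lambda>s. c * dist (h s) (h v)) \<longlongrightarrow> c * dist (h z) (h v)) (at_right z)"
    by (intro tendsto_intros)
  show "\<forall>\<^sub>F s in at_right z. c * dist (h s) (h v) \<le> B"
    using assms by (auto simp: eventually_at_right_field intro!: exI[of _ v])
qed simp

text \<open>The image \<open>h\<close> of a rectifiable curve \<open>g\<close> of finite Ferrand length.  The factor \<open>C\<close> exceeds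
  \<open>K ^ 4\<close>, which leaves room for the oscillation of the density and of \<open>m\<close> on short arcs.\<close>

locale ferrand_curve = quasi_moebius_involution f m K
  for f :: "'a::euclidean_space option \<Rightarrow> 'a option" and m and K +
  fixes X :: "'a option set" and g :: "real \<Rightarrow> 'a option" and C :: real
  assumes X: "openin ext_space X" and two: "\<exists>a\<in>ext_boundary X. \<exists>b\<in>ext_boundary X. a \<noteq> b"
    and path: "pathin (subtopology ext_space X) g" and rect: "rectifiable_curve g"
    and fin: "curve_integral (ferrand_density X) g < \<infinity>" and C: "K ^ 4 < C"
begin

text \<open>\<open>T s t\<close> is the Ferrand length of the arc of \<open>g\<close> between \<open>s\<close> and \<open>t\<close>, and \<open>\<tau>\<close> is the
  corresponding length function.  The points of the image \<open>h\<close> are taken in the finite part; \<open>h\<close> is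
  only used on intervals where the image avoids infinity.\<close>

abbreviation "T \<equiv> interval_variation (piece_integral (ferrand_density X) g)"
definition "\<tau> t = enn2real (T 0 t)"
definition "h = the \<circ> (f \<circ> g)"

lemma C_pos: "0 < C"
  using C K_ge_1 by (meson less_trans zero_less_power less_le_trans zero_less_one)

lemma
  assumes "0 \<le> u" "u \<le> v" "v \<le> 1"
  shows T_le: "T u v \<le> ennreal (\<tau> v - \<tau> u)" and \<tau>_mono: "\<tau> u \<le> \<tau> v"
proof -
  have "T 0 1 < \<infinity>" using fin by (simp add: curve_integral_eq_interval_variation)
  from interval_variation_increment[OF this piece_integral_singleton assms]
  show "T u v \<le> ennreal (\<tau> v - \<tau> u)" "\<tau> u \<le> \<tau> v" by (simp_all add: \<tau>_def)
qed

lemma boundary_ne: "ext_boundary X \<noteq> {}" "ext_boundary (f ` X) \<noteq> {}"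
  using two by (auto simp: boundary_image)

lemma chord_le_increment:
  assumes "0 \<le> u" "u \<le> v" "v \<le> 1" and "None \<notin> g ` {u..v}"
    and c: "\<And>t. t \<in> {u..v} \<Longrightarrow> c \<le> ferrand_density X (the (g t))" "0 \<le> c"
  shows "c * dist (the (g u)) (the (g v)) \<le> \<tau> v - \<tau> u"
proof -
  have ct: "continuous_on {u..v} (the \<circ> g)"
    using assms by (intro continuous_on_path_finite[OF path])
  have len: "arc_length (the \<circ> g) u v < \<infinity>"
    using rect assms by (auto simp: rectifiable_curve_def)
  have "ennreal (c * dist (the (g u)) (the (g v))) = ennreal c * ennreal (dist ((the \<circ> g) u) ((the \<circ> g) v))"
    using c by (simp add: ennreal_mult')
  also have "\<dots> \<le> ennreal c * arc_length (the \<circ> g) u v"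
    using \<open>u \<le> v\<close> by (intro mult_left_mono dist_le_arc_length) auto
  also have "\<dots> \<le> piece_integral (ferrand_density X) g {u..v}"
    using nn_integral_arc_measure_ge[OF len ct \<open>u \<le> v\<close>, of c "\<lambda>t. ferrand_density X (the (g t))"] c assms
    by (simp add: piece_integral_def)
  also have "\<dots> \<le> T u v" by (rule interval_variation_ge[OF \<open>u \<le> v\<close>])
  also have "\<dots> \<le> ennreal (\<tau> v - \<tau> u)" using assms by (intro T_le)
  finally show ?thesis using \<tau>_mono[OF assms(1-3)] by (subst (asm) ennreal_le_iff) auto
qed

text \<open>The infinitesimal form of the distortion bound.  The numbers \<open>p\<close> and \<open>q\<close> are the values of the
  weight and the density at \<open>x\<close>; near \<open>x\<close> neither falls below \<open>l\<close> times its value, and three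
  factors \<open>l\<close> are lost in the comparison, two with the weights and one with the density.\<close>

lemma local_chord:
  assumes s: "s \<in> {0..1}" and gs: "g s = Some x" "x \<noteq> 0"
  shows "\<exists>\<delta>>0. \<forall>u v. 0 \<le> u \<and> u \<le> s \<and> s \<le> v \<and> v \<le> 1 \<and> v - u < \<delta> \<longrightarrow>
    ferrand_density (f ` X) (h s) * dist (h u) (h v) \<le> C * \<tau> v - C * \<tau> u"
proof -
  have xX: "Some x \<in> X" using path_in_space[OF path s] gs by simp
  obtain y where y: "f (Some x) = Some y" using gs by (cases "f (Some x)") auto
  define p q where "p = m (Some x)" and "q = ferrand_density X x"
  have p: "0 < p" by (simp add: p_def m_pos)
  have q: "0 < q" using two ferrand_density_pos[OF X xX] by (auto simp: q_def)
  obtain l :: real where l: "0 < l" "l < 1" "K ^ 4 \<le> C * l ^ 3"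
  proof -
    have "((\<lambda>l. C * l ^ 3) \<longlongrightarrow> C * 1 ^ 3) (at_left (1::real))"
      by (intro tendsto_intros)
    then have "\<forall>\<^sub>F l in at_left (1::real). K ^ 4 < C * l ^ 3"
      using order_tendstoD(1) C by fastforce
    moreover have "\<forall>\<^sub>F l in at_left (1::real). l \<in> {0<..<1}"
      by (rule eventually_at_left_real) simp
    ultimately have "\<forall>\<^sub>F l in at_left (1::real). 0 < l \<and> l < 1 \<and> K ^ 4 \<le> C * l ^ 3"
      by eventually_elim auto
    then show ?thesis using that eventually_happens trivial_limit_at_left_real by blast
  qed
  define U where "U = {z \<in> - {0}. l * p < m (Some z)} \<inter> {z \<in> {z. Some z \<in> X}. l * q < ferrand_density X z}"
  have "open U" unfolding U_def
  proof (intro open_Int)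
    have "open (- {0} \<inter> (\<lambda>z. m (Some z)) -` {l * p<..})"
      by (rule continuous_open_preimage[OF m_cont]) auto
    then show "open {z \<in> - {0}. l * p < m (Some z)}" by (simp add: Int_def vimage_def)
    have "open ({z. Some z \<in> X} \<inter> ferrand_density X -` {l * q<..})"
      by (rule continuous_open_preimage[OF continuous_on_ferrand_density[OF X boundary_ne(1)]])
        (auto intro: open_finite_part[OF X])
    then show "open {z \<in> {z. Some z \<in> X}. l * q < ferrand_density X z}" by (simp add: Int_def vimage_def)
  qed
  moreover have "x \<in> U" using gs xX p q l by (auto simp: U_def p_def[symmetric] q_def[symmetric])
  ultimately obtain \<delta> where \<delta>: "0 < \<delta>" "\<And>t. t \<in> {0..1} \<Longrightarrow> \<bar>t - s\<bar> < \<delta> \<Longrightarrow> g t \<in> Some ` U"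
    using path_preimage_near[OF path, of "Some ` U" s] s gs by auto
  show ?thesis
  proof (intro exI[of _ \<delta>] conjI allI impI \<delta>(1))
    fix u v assume uv: "0 \<le> u \<and> u \<le> s \<and> s \<le> v \<and> v \<le> 1 \<and> v - u < \<delta>"
    have gt: "g t \<in> Some ` U" if "t \<in> {u..v}" for t
      using that uv by (intro \<delta>(2)) auto
    obtain xu where xu: "g u = Some xu" "xu \<in> U" using gt[of u] uv by auto
    obtain xv where xv: "g v = Some xv" "xv \<in> U" using gt[of v] uv by auto
    obtain yu where yu: "f (Some xu) = Some yu" using xu by (cases "f (Some xu)") (auto simp: U_def)
    obtain yv where yv: "f (Some xv) = Some yv" using xv by (cases "f (Some xv)") (auto simp: U_def)
    have inc: "l * q * dist xu xv \<le> \<tau> v - \<tau> u"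
    proof -
      have "l * q * dist (the (g u)) (the (g v)) \<le> \<tau> v - \<tau> u"
      proof (rule chord_le_increment)
        show "None \<notin> g ` {u..v}" using gt by fastforce
        show "l * q \<le> ferrand_density X (the (g t))" if "t \<in> {u..v}" for t
          using gt[OF that] by (auto simp: U_def)
      qed (use uv l q in auto)
      then show ?thesis using xu xv by simp
    qed
    have muv: "(l * p) * (l * p) \<le> m (Some xu) * m (Some xv)"
      using xu xv l p less_imp_le[OF m_pos] by (intro mult_mono) (auto simp: U_def)
    have "dist yu yv * ((l * p) * (l * p)) \<le> dist yu yv * (m (Some xu) * m (Some xv))"
      by (intro mult_left_mono muv) auto
    also have "\<dots> \<le> K * dist xu xv"
      using upper[of "Some xu" "Some xv"] yu yv by (simp add: dist_norm)
    finally have d: "dist yu yv * (l\<^sup>2 * p\<^sup>2) \<le> K * dist xu xv" by (simp add: power2_eq_square mult_ac)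
    have w: "ferrand_density (f ` X) y \<le> K ^ 3 * p\<^sup>2 * q"
      using ferrand_density_distortion[OF X xX y boundary_ne(1)] by (simp add: p_def q_def)
    have "ferrand_density (f ` X) y * dist yu yv * l\<^sup>2 \<le> (K ^ 3 * p\<^sup>2 * q) * dist yu yv * l\<^sup>2"
      by (intro mult_right_mono w) auto
    also have "\<dots> = K ^ 3 * q * (dist yu yv * (l\<^sup>2 * p\<^sup>2))" by (simp add: mult_ac)
    also have "\<dots> \<le> K ^ 3 * q * (K * dist xu xv)" using K_ge_1 q by (intro mult_left_mono d) auto
    also have "\<dots> = K ^ 4 * (q * dist xu xv)" by (simp add: power_numeral_reduce mult_ac)
    also have "\<dots> \<le> C * l ^ 3 * (q * dist xu xv)" using l q by (intro mult_right_mono) auto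
    also have "\<dots> = C * (l * q * dist xu xv) * l\<^sup>2" by (simp add: power_numeral_reduce mult_ac)
    also have "\<dots> \<le> C * (\<tau> v - \<tau> u) * l\<^sup>2" using C_pos by (intro mult_right_mono mult_left_mono inc) auto
    finally have "ferrand_density (f ` X) y * dist yu yv \<le> C * (\<tau> v - \<tau> u)"
      using l by (simp add: mult_le_cancel_right)
    then show "ferrand_density (f ` X) (h s) * dist (h u) (h v) \<le> C * \<tau> v - C * \<tau> u"
      using gs xu xv y yu yv by (simp add: h_def right_diff_distrib)
  qed
qed

text \<open>The zeros of \<open>h\<close> are the visits of \<open>g\<close> to infinity.  An arc without zeros is treated by
  subdivision.  Otherwise \<open>z1\<close> and \<open>z2\<close> are the first and the last zero; the part between them does
  not contribute to the chord, as \<open>h z1 = h z2\<close>, and the outer parts are limits of arcs without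
  zeros.\<close>

lemma chord_bound:
  assumes ab: "0 \<le> a" "b \<le> 1" and avoid: "None \<notin> (f \<circ> g) ` {a..b}"
    and uv: "a \<le> u" "u \<le> v" "v \<le> b" and c: "0 \<le> c" "\<And>t. t \<in> {u..v} \<Longrightarrow> c \<le> ferrand_density (f ` X) (h t)"
  shows "c * dist (h u) (h v) \<le> C * \<tau> v - C * \<tau> u"
proof -
  have h: "continuous_on {a..b} h"
    unfolding h_def using ab avoid by (intro continuous_on_path_finite[OF path_image[OF path]])
  have \<tau>: "C * \<tau> s \<le> C * \<tau> t" if "a \<le> s" "s \<le> t" "t \<le> b" for s t
    using \<tau>_mono[of s t] that ab C_pos by simp
  have h0: "h t = 0 \<longleftrightarrow> g t = None" if "t \<in> {a..b}" for t
  proof -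
    have "f (g t) \<noteq> None" using avoid that by force
    then obtain y where y: "f (g t) = Some y" by blast
    then show ?thesis by (metis comp_apply f_eq_zero_iff h_def option.sel)
  qed
  have A: "c * dist (h u') (h v') \<le> C * \<tau> v' - C * \<tau> u'"
    if uv': "u \<le> u'" "u' \<le> v'" "v' \<le> v" and ne: "None \<notin> g ` {u'..v'}" for u' v'
  proof (rule weighted_chord_le[OF \<open>u' \<le> v'\<close> \<open>0 \<le> c\<close>])
    fix s assume s: "u' \<le> s" "s \<le> v'"
    obtain x where x: "g s = Some x" using ne s by (metis atLeastAtMost_iff imageI not_None_eq)
    have "s \<in> {a..b}" using s uv uv' by auto
    then have "f (g s) \<noteq> None" using avoid by force
    then have "x \<noteq> 0" using x by auto
    then obtain \<delta> where \<delta>: "0 < \<delta>" "\<And>u v. 0 \<le> u \<and> u \<le> s \<and> s \<le> v \<and> v \<le> 1 \<and> v - u < \<delta> \<Longrightarrow>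
        ferrand_density (f ` X) (h s) * dist (h u) (h v) \<le> C * \<tau> v - C * \<tau> u"
      using local_chord[of s x] x s uv uv' ab by auto
    have "c * dist (h u'') (h v'') \<le> C * \<tau> v'' - C * \<tau> u''"
      if "u' \<le> u'' \<and> u'' \<le> s \<and> s \<le> v'' \<and> v'' \<le> v' \<and> v'' - u'' < \<delta>" for u'' v''
    proof -
      have "c * dist (h u'') (h v'') \<le> ferrand_density (f ` X) (h s) * dist (h u'') (h v'')"
        using c(2)[of s] s uv' by (intro mult_right_mono) auto
      also have "\<dots> \<le> C * \<tau> v'' - C * \<tau> u''" using \<delta>(2) that uv uv' ab by auto
      finally show ?thesis .
    qed
    then show "\<exists>\<delta>>0. \<forall>u v. u' \<le> u \<and> u \<le> s \<and> s \<le> v \<and> v \<le> v' \<and> v - u < \<delta> \<longrightarrow>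
        c * dist (h u) (h v) \<le> C * \<tau> v - C * \<tau> u"
      using \<delta>(1) by blast
  qed
  define Z where "Z = {t \<in> {u..v}. h t = 0}"
  show ?thesis
  proof (cases "Z = {}")
    case True
    then have "None \<notin> g ` {u..v}" using h0 uv by (force simp: Z_def)
    then show ?thesis using A[of u v] uv by simp
  next
    case False
    have "closed ({u..v} \<inter> h -` {0})"
      using uv by (intro continuous_closed_preimage continuous_on_subset[OF h]) auto
    moreover have "Z = {u..v} \<inter> h -` {0}" by (auto simp: Z_def)
    ultimately have "closed Z" by simp
    have bd: "bdd_below Z" "bdd_above Z" by (auto simp: Z_def)
    define z1 z2 where "z1 = Inf Z" and "z2 = Sup Z"
    have z: "z1 \<in> Z" "z2 \<in> Z"
      using closed_contains_Inf[OF False bd(1) \<open>closed Z\<close>] closed_contains_Sup[OF False bd(2) \<open>closed Z\<close>]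
      by (auto simp: z1_def z2_def)
    have zle: "z1 \<le> t" "t \<le> z2" if "t \<in> Z" for t
      using cInf_lower[OF that bd(1)] cSup_upper[OF that bd(2)] by (auto simp: z1_def z2_def)
    have z': "u \<le> z1" "z1 \<le> z2" "z2 \<le> v" "h z1 = 0" "h z2 = 0"
      using z zle by (auto simp: Z_def)
    have L: "c * dist (h u) (h z1) \<le> C * \<tau> z1 - C * \<tau> u"
    proof (cases "u = z1")
      case False
      show ?thesis
      proof (rule chord_limit_left)
        show "continuous_on {u..z1} h" using uv z' by (intro continuous_on_subset[OF h]) auto
        show "u < z1" using False z' by simp
        fix s assume s: "u \<le> s" "s < z1"
        have "None \<notin> g ` {u..s}"
        proof
          assume "None \<in> g ` {u..s}"
          then obtain t where t: "t \<in> {u..s}" "g t = None" by force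
          then have "t \<in> Z" using h0[of t] s z' uv by (auto simp: Z_def)
          then show False using zle(1)[of t] t s by auto
        qed
        then have "c * dist (h u) (h s) \<le> C * \<tau> s - C * \<tau> u" using A[of u s] s z' by auto
        also have "\<dots> \<le> C * \<tau> z1 - C * \<tau> u" using \<tau>[of s z1] s z' uv by auto
        finally show "c * dist (h u) (h s) \<le> C * \<tau> z1 - C * \<tau> u" .
      qed
    qed auto
    have R: "c * dist (h z2) (h v) \<le> C * \<tau> v - C * \<tau> z2"
    proof (cases "v = z2")
      case False
      show ?thesis
      proof (rule chord_limit_right)
        show "continuous_on {z2..v} h" using uv z' by (intro continuous_on_subset[OF h]) auto
        show "z2 < v" using False z' by simp
        fix s assume s: "z2 < s" "s \<le> v"
        have "None \<notin> g ` {s..v}"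
        proof
          assume "None \<in> g ` {s..v}"
          then obtain t where t: "t \<in> {s..v}" "g t = None" by force
          then have "t \<in> Z" using h0[of t] s z' uv by (auto simp: Z_def)
          then show False using zle(2)[of t] t s by auto
        qed
        then have "c * dist (h s) (h v) \<le> C * \<tau> v - C * \<tau> s" using A[of s v] s z' by auto
        also have "\<dots> \<le> C * \<tau> v - C * \<tau> z2" using \<tau>[of z2 s] s z' uv by auto
        finally show "c * dist (h s) (h v) \<le> C * \<tau> v - C * \<tau> z2" .
      qed
    qed auto
    have "c * dist (h u) (h v) \<le> c * (dist (h u) (h z1) + dist (h z2) (h v))"
      using dist_triangle[of "h u" "h v" "h z1"] z' c by (intro mult_left_mono) auto
    also have "\<dots> \<le> (C * \<tau> z1 - C * \<tau> u) + (C * \<tau> v - C * \<tau> z2)"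
      using L R by (simp add: distrib_left)
    also have "\<dots> \<le> C * \<tau> v - C * \<tau> u" using \<tau>[of z1 z2] z' uv by auto
    finally show ?thesis .
  qed
qed

lemma image_piece:
  assumes ab: "0 \<le> a" "a \<le> b" "b \<le> 1" and avoid: "None \<notin> (f \<circ> g) ` {a..b}"
  shows "arc_length h a b < \<infinity>"
    and "(\<integral>\<^sup>+t\<in>{a..b}. ennreal (ferrand_density (f ` X) (h t)) \<partial>arc_measure h a b)
      \<le> ennreal (C * \<tau> b - C * \<tau> a)"
proof -
  have h: "continuous_on {a..b} h"
    unfolding h_def using ab avoid by (intro continuous_on_path_finite[OF path_image[OF path]])
  have hX: "Some (h t) \<in> f ` X" if "t \<in> {a..b}" for t
  proof -
    have "f (g t) \<noteq> None" using avoid that by force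
    then have "Some (h t) = f (g t)" by (simp add: h_def)
    then show ?thesis using path_in_space[OF path, of t] that ab by auto
  qed
  have F: "continuous_on {a..b} (\<lambda>t. ferrand_density (f ` X) (h t))"
    using hX by (intro continuous_on_compose2[OF continuous_on_ferrand_density[OF open_image[OF X] boundary_ne(2)] h]) auto
  have pos: "0 < ferrand_density (f ` X) (h t)" if "t \<in> {a..b}" for t
  proof -
    obtain a b where "a \<in> ext_boundary X" "b \<in> ext_boundary X" "a \<noteq> b" using two by blast
    then show ?thesis
      by (intro ferrand_density_pos[OF open_image[OF X] hX[OF that], of "f a" "f b"])
        (auto simp: boundary_image)
  qed
  show "arc_length h a b < \<infinity>"
    by (rule arc_length_finite_of_weighted_chords[OF ab(2) h F pos chord_bound[OF ab(1,3) avoid]])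
  show "(\<integral>\<^sup>+t\<in>{a..b}. ennreal (ferrand_density (f ` X) (h t)) \<partial>arc_measure h a b)
      \<le> ennreal (C * \<tau> b - C * \<tau> a)"
    by (rule nn_integral_arc_measure_le[OF ab(2) h F pos chord_bound[OF ab(1,3) avoid]])
qed

lemma rectifiable_image: "rectifiable_curve (f \<circ> g)"
  using image_piece(1) unfolding rectifiable_curve_def h_def by blast

lemma curve_integral_image:
  "curve_integral (ferrand_density (f ` X)) (f \<circ> g) \<le> ennreal C * curve_integral (ferrand_density X) g"
proof -
  have "interval_variation (piece_integral (ferrand_density (f ` X)) (f \<circ> g)) 0 1 \<le> ennreal (C * \<tau> 1 - C * \<tau> 0)"
  proof (rule interval_variation_le)
    fix s t :: real assume st: "0 \<le> s" "s \<le> t" "t \<le> 1"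
    show "C * \<tau> s \<le> C * \<tau> t" using \<tau>_mono[OF st] C_pos by simp
    show "piece_integral (ferrand_density (f ` X)) (f \<circ> g) {s..t} \<le> ennreal (C * \<tau> t - C * \<tau> s)"
      using image_piece(2)[OF st] st by (auto simp: piece_integral_def h_def)
  qed simp
  also have "\<dots> \<le> ennreal (C * \<tau> 1)" using C_pos by (intro ennreal_leI) (auto simp: \<tau>_def)
  also have "\<dots> = ennreal C * ennreal (\<tau> 1)" using C_pos by (simp add: ennreal_mult')
  also have "ennreal (\<tau> 1) = curve_integral (ferrand_density X) g"
    using fin by (simp add: \<tau>_def curve_integral_eq_interval_variation)
  finally show ?thesis by (simp only: curve_integral_eq_interval_variation)
qed

end

text \<open>The infimum of the Ferrand lengths before its conversion to a real number, by which an infinite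
  infimum would become \<open>0\<close>.\<close>

definition ferrand_inf :: "'a::euclidean_space option set \<Rightarrow> 'a option \<Rightarrow> 'a option \<Rightarrow> ennreal" where
  "ferrand_inf G x y =
     (INF g\<in>{g. pathin (subtopology ext_space G) g \<and> rectifiable_curve g \<and> g 0 = x \<and> g 1 = y}.
        curve_integral (ferrand_density G) g)"

lemma ferrand_metric_eq: "ferrand_metric G x y = enn2real (ferrand_inf G x y)"
  by (simp add: ferrand_metric_def ferrand_inf_def)

context quasi_moebius_involution begin

lemma ferrand_inf_image_le:
  assumes X: "openin ext_space X" and two: "\<exists>a\<in>ext_boundary X. \<exists>b\<in>ext_boundary X. a \<noteq> b"
  shows "ferrand_inf (f ` X) (f x) (f y) \<le> ennreal (K ^ 4) * ferrand_inf X x y"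
proof -
  have K4: "0 < K ^ 4" using K_ge_1 by simp
  let ?I = "ferrand_inf (f ` X) (f x) (f y)"
  have curve: "?I \<le> ennreal (K ^ 4) * curve_integral (ferrand_density X) g"
    if g: "pathin (subtopology ext_space X) g" "rectifiable_curve g" "g 0 = x" "g 1 = y" for g
  proof (cases "curve_integral (ferrand_density X) g < \<infinity>")
    case False
    then have "curve_integral (ferrand_density X) g = \<infinity>" by (simp add: less_top[symmetric])
    then show ?thesis using K4 by (simp add: ennreal_mult_top)
  next
    case True
    then obtain c where c: "0 \<le> c" "curve_integral (ferrand_density X) g = ennreal c"
      by (metis ennreal_cases infinity_ennreal_def less_irrefl)
    show ?thesis
    proof (rule ennreal_le_epsilon)
      fix e :: real assume "0 < e"
      define C where "C = K ^ 4 + e / (c + 1)"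
      have "K ^ 4 < C" using c \<open>0 < e\<close> by (simp add: C_def)
      then interpret ferrand_curve f m K X g C
        using X two g True by unfold_locales auto
      have "?I \<le> curve_integral (ferrand_density (f ` X)) (f \<circ> g)"
        unfolding ferrand_inf_def
        using path_image[OF g(1)] rectifiable_image g by (intro INF_lower) auto
      also have "\<dots> \<le> ennreal C * ennreal c" using curve_integral_image c by simp
      also have "\<dots> = ennreal (C * c)" using c by (simp add: ennreal_mult'')
      also have "\<dots> \<le> ennreal (K ^ 4 * c + e)"
      proof (rule ennreal_leI)
        have "e / (c + 1) * c \<le> e" using c \<open>0 < e\<close> by (simp add: field_simps)
        then show "C * c \<le> K ^ 4 * c + e" by (simp add: C_def algebra_simps)
      qed
      also have "\<dots> = ennreal (K ^ 4) * curve_integral (ferrand_density X) g + ennreal e"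
        using c \<open>0 < e\<close> K4 by (simp add: ennreal_mult)
      finally show "?I \<le> ennreal (K ^ 4) * curve_integral (ferrand_density X) g + ennreal e" .
    qed
  qed
  \<comment> \<open>The factor \<open>K ^ 4\<close> is moved to the left-hand side, in front of a constant, to take the infimum.\<close>
  have inv: "ennreal (1 / K ^ 4) * (ennreal (K ^ 4) * z) = z" "ennreal (K ^ 4) * (ennreal (1 / K ^ 4) * z) = z" for z
    using K4 by (simp_all add: mult.assoc[symmetric] ennreal_mult'[symmetric])
  have "ennreal (1 / K ^ 4) * ?I \<le> ferrand_inf X x y"
    unfolding ferrand_inf_def[of X]
  proof (rule INF_greatest)
    fix g assume "g \<in> {g. pathin (subtopology ext_space X) g \<and> rectifiable_curve g \<and> g 0 = x \<and> g 1 = y}"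
    then have "ennreal (1 / K ^ 4) * ?I \<le> ennreal (1 / K ^ 4) * (ennreal (K ^ 4) * curve_integral (ferrand_density X) g)"
      by (intro mult_left_mono curve) auto
    then show "ennreal (1 / K ^ 4) * ?I \<le> curve_integral (ferrand_density X) g"
      by (simp add: inv)
  qed
  then have "ennreal (K ^ 4) * (ennreal (1 / K ^ 4) * ?I) \<le> ennreal (K ^ 4) * ferrand_inf X x y"
    by (intro mult_left_mono) auto
  then show ?thesis by (simp add: inv)
qed

lemma two_boundary_points_image:
  "\<exists>a\<in>ext_boundary X. \<exists>b\<in>ext_boundary X. a \<noteq> b \<Longrightarrow>
    \<exists>a\<in>ext_boundary (f ` X). \<exists>b\<in>ext_boundary (f ` X). a \<noteq> b"
  by (auto simp: boundary_image)

lemma ferrand_metric_image_le: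
  assumes X: "openin ext_space X" and two: "\<exists>a\<in>ext_boundary X. \<exists>b\<in>ext_boundary X. a \<noteq> b"
  shows "ferrand_metric (f ` X) (f x) (f y) \<le> K ^ 4 * ferrand_metric X x y"
    and "ferrand_metric X x y \<le> K ^ 4 * ferrand_metric (f ` X) (f x) (f y)"
proof -
  have K4: "0 \<le> K ^ 4" using K_ge_1 by simp
  let ?I = "ferrand_inf (f ` X) (f x) (f y)" and ?J = "ferrand_inf X x y"
  have 1: "?I \<le> ennreal (K ^ 4) * ?J" by (rule ferrand_inf_image_le[OF assms])
  have 2: "?J \<le> ennreal (K ^ 4) * ?I"
    using ferrand_inf_image_le[OF open_image[OF X] two_boundary_points_image[OF two], of "f x" "f y"]
    by simp
  \<comment> \<open>The two bounds together show that \<open>I\<close> and \<open>J\<close> are both finite or both infinite.\<close>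
  have *: "enn2real I \<le> K ^ 4 * enn2real J" if "I \<le> ennreal (K ^ 4) * J" "J \<le> ennreal (K ^ 4) * I" for I J
  proof (cases "J = \<infinity>")
    case True
    then have "I = \<infinity>" using that(2) by (cases I) (auto simp: ennreal_mult'[symmetric] K4 top_unique)
    then show ?thesis using True K4 by simp
  next
    case False
    then have "enn2real I \<le> enn2real (ennreal (K ^ 4) * J)"
      using that(1) by (intro enn2real_mono) (auto simp: ennreal_mult_less_top less_top)
    then show ?thesis using K4 by (simp add: enn2real_mult)
  qed
  show "ferrand_metric (f ` X) (f x) (f y) \<le> K ^ 4 * ferrand_metric X x y"
       "ferrand_metric X x y \<le> K ^ 4 * ferrand_metric (f ` X) (f x) (f y)"
    using *[OF 1 2] *[OF 2 1] by (simp_all add: ferrand_metric_eq)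
qed

end

section \<open>The Moebius metric and bi-Lipschitz constants\<close>

lemma ln_one_plus_mult_le:
  fixes C s :: real
  assumes "1 \<le> C" "0 \<le> s"
  shows "ln (1 + C * s) \<le> C * ln (1 + s)"
proof -
  have "concave_on {0<..} (ln :: real \<Rightarrow> real)" by (rule ln_concave)
  then have le: "(1 - 1 / C) * ln 1 + 1 / C * ln (1 + C * s) \<le> ln ((1 - 1 / C) *\<^sub>R 1 + (1 / C) *\<^sub>R (1 + C * s))"
    using assms by (intro concave_onD) (auto intro: add_pos_nonneg)
  have eq: "(1 - 1 / C) *\<^sub>R 1 + (1 / C) *\<^sub>R (1 + C * s) = 1 + s"
    using assms by (simp add: field_simps)
  have "1 / C * ln (1 + C * s) \<le> ln (1 + s)" using le unfolding eq by simp
  then show ?thesis using assms by (simp add: pos_divide_le_eq mult.commute)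
qed

abbreviation ratio_set :: "'a::euclidean_space option set \<Rightarrow> 'a option \<Rightarrow> 'a option \<Rightarrow> real set" where
  "ratio_set X p q \<equiv> (\<lambda>(a, b). abs_ratio a p b q) ` (ext_boundary X \<times> ext_boundary X)"

lemma bdd_above_ratio_set:
  assumes X: "openin ext_space X" and x: "Some x \<in> X" and y: "Some y \<in> X"
  shows "bdd_above (ratio_set X (Some x) (Some y))"
proof -
  obtain d where d: "0 < d" "\<And>a. a \<in> ext_boundary X \<Longrightarrow> d \<le> ext_dist (Some x) a"
    by (rule ext_boundary_gap[OF X x]) blast
  obtain e where e: "0 < e" "\<And>a. a \<in> ext_boundary X \<Longrightarrow> e \<le> ext_dist (Some y) a"
    by (rule ext_boundary_gap[OF X y]) blast
  define r where "r = 1 + norm (y - x) / e"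
  have r: "0 < r" using e by (simp add: r_def add_pos_nonneg)
  show ?thesis
  proof (intro bdd_aboveI[where M="(1 / e + r / d) * norm (x - y)"], clarsimp)
    fix a b assume ab: "a \<in> ext_boundary X" "b \<in> ext_boundary X"
    let ?p = "ext_dist (Some x) a" and ?q = "ext_dist (Some y) b"
    have pq: "d \<le> ?p" "e \<le> ?q" using d e ab by auto
    then have pos: "0 < ?p" "0 < ?q" using d e by auto
    have "ext_dist a b \<le> ?p + ext_dist (Some x) b" by (rule ext_dist_triangle_finite)
    also have "\<dots> \<le> ?p + r * ?q" using ext_dist_perturb[OF e(1) e(2)[OF ab(2)], of x] by (simp add: r_def)
    finally have "ext_dist a b / (?p * ?q) \<le> (?p + r * ?q) / (?p * ?q)"
      using pos by (intro divide_right_mono) auto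
    also have "\<dots> = 1 / ?q + r / ?p" using pos by (simp add: field_simps)
    also have "\<dots> \<le> 1 / e + r / d" using pq d e r by (intro add_mono divide_left_mono) auto
    finally have "ext_dist a b / (?p * ?q) * norm (x - y) \<le> (1 / e + r / d) * norm (x - y)"
      by (intro mult_right_mono) auto
    then show "abs_ratio a (Some x) b (Some y) \<le> (1 / e + r / d) * norm (x - y)"
      by (simp add: abs_ratio_def ext_dist_commute)
  qed
qed

lemma SUP_ratio_nonneg:
  assumes "bdd_above (ratio_set X p q)" "ext_boundary X \<noteq> {}"
  shows "0 \<le> Sup (ratio_set X p q)"
proof -
  obtain a where "a \<in> ext_boundary X" using assms by blast
  then have "abs_ratio a p a q \<le> Sup (ratio_set X p q)"
    by (intro cSup_upper assms) auto
  then show ?thesis by (simp add: abs_ratio_def)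
qed

lemma moebius_metric_pos:
  assumes X: "openin ext_space X" and xy: "p \<in> X" "q \<in> X" "p \<noteq> q"
    and bdd: "bdd_above (ratio_set X p q)" and two: "\<exists>a\<in>ext_boundary X. \<exists>b\<in>ext_boundary X. a \<noteq> b"
  shows "0 < moebius_metric X p q"
proof -
  obtain a b where ab: "a \<in> ext_boundary X" "b \<in> ext_boundary X" "a \<noteq> b" using two by blast
  have "a \<noteq> p" "b \<noteq> q" using ab ext_boundary_disjoint[OF X] xy by auto
  then have "0 < abs_ratio a p b q"
    unfolding abs_ratio_def using ab xy by (intro divide_pos_pos mult_pos_pos ext_dist_pos)
  also have "\<dots> \<le> Sup (ratio_set X p q)" using ab by (intro cSup_upper bdd) auto
  finally show ?thesis by (simp add: moebius_metric_def)
qed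

context quasi_moebius_involution begin

lemma moebius_image:
  assumes X: "openin ext_space X" and ne: "ext_boundary X \<noteq> {}" and pq: "p \<in> X" "q \<in> X"
    and bdd: "bdd_above (ratio_set X p q)"
  shows "bdd_above (ratio_set (f ` X) (f p) (f q))"
    and "moebius_metric (f ` X) (f p) (f q) \<le> K ^ 4 * moebius_metric X p q"
proof -
  have K4: "1 \<le> K ^ 4" using K_ge_1 by (rule one_le_power)
  let ?S = "Sup (ratio_set X p q)" and ?S' = "Sup (ratio_set (f ` X) (f p) (f q))"
  have le: "z \<le> K ^ 4 * ?S" if "z \<in> ratio_set (f ` X) (f p) (f q)" for z
  proof -
    from that obtain a b where ab: "a \<in> ext_boundary X" "b \<in> ext_boundary X"
      "z = abs_ratio (f a) (f p) (f b) (f q)" by (auto simp: boundary_image)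
    have "z \<le> K ^ 4 * abs_ratio a p b q"
      unfolding ab(3) using ab ext_boundary_disjoint[OF X] pq by (intro abs_ratio_distortion) auto
    also have "\<dots> \<le> K ^ 4 * ?S" using ab K4 by (intro mult_left_mono cSup_upper bdd) auto
    finally show ?thesis .
  qed
  then show bdd': "bdd_above (ratio_set (f ` X) (f p) (f q))" by (rule bdd_aboveI)
  have S: "0 \<le> ?S" by (rule SUP_ratio_nonneg[OF bdd ne])
  have ne': "ext_boundary (f ` X) \<noteq> {}" using ne by (simp add: boundary_image)
  have S': "0 \<le> ?S'" by (rule SUP_ratio_nonneg[OF bdd' ne'])
  have "?S' \<le> K ^ 4 * ?S" using le ne' by (intro cSup_least) auto
  then have "ln (1 + ?S') \<le> ln (1 + K ^ 4 * ?S)" using S' by simp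
  also have "\<dots> \<le> K ^ 4 * ln (1 + ?S)" by (rule ln_one_plus_mult_le[OF K4 S])
  finally show "moebius_metric (f ` X) (f p) (f q) \<le> K ^ 4 * moebius_metric X p q"
    by (simp add: moebius_metric_def)
qed

end

lemma bi_lipschitzI:
  assumes "1 \<le> C" and bij: "bij_betw f X Y"
    and le: "\<And>x y. x \<in> X \<Longrightarrow> y \<in> X \<Longrightarrow> dY (f x) (f y) \<le> C * dX x y"
    and ge: "\<And>x y. x \<in> X \<Longrightarrow> y \<in> X \<Longrightarrow> dX x y \<le> C * dY (f x) (f y)"
  shows "bi_lipschitz C X dX Y dY f"
proof -
  have C: "0 < C" using assms by simp
  have inv: "inv_into X f y \<in> X" "f (inv_into X f y) = y" if "y \<in> Y" for y
    using bij that by (auto simp: bij_betw_def inv_into_into f_inv_into_f)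
  have "metric_continuous X dX dY f"
    unfolding metric_continuous_def
  proof (intro ballI allI impI)
    fix x and e :: real assume "x \<in> X" "0 < e"
    then show "\<exists>r>0. \<forall>y\<in>X. dX x y < r \<longrightarrow> dY (f x) (f y) < e"
      using C le by (intro exI[of _ "e / C"]) (fastforce simp: field_simps)
  qed
  moreover have "metric_continuous Y dY dX (inv_into X f)"
    unfolding metric_continuous_def
  proof (intro ballI allI impI)
    fix x and e :: real assume "x \<in> Y" "0 < e"
    then show "\<exists>r>0. \<forall>y\<in>Y. dY x y < r \<longrightarrow> dX (inv_into X f x) (inv_into X f y) < e"
      using C ge inv by (intro exI[of _ "e / C"]) (fastforce simp: field_simps)
  qed
  ultimately show ?thesis
    using C bij le ge by (auto simp: bi_lipschitz_def metric_homeomorphism_def field_simps)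
qed

text \<open>The admissible constants form a closed set, bounded from below by \<open>1\<close> as soon as two points have
  positive distance; so the smallest one exists.  If all distances were \<open>0\<close>, every positive constant
  would be admissible.\<close>

lemma bi_lipschitz_constant_bounds:
  assumes bl: "bi_lipschitz C X dX Y dY f" and xy: "x \<in> X" "y \<in> X" "0 < dX x y"
  shows "1 \<le> bi_lipschitz_constant X dX Y dY f" and "bi_lipschitz_constant X dX Y dY f \<le> C"
proof -
  define S where "S = {C. bi_lipschitz C X dX Y dY f}"
  have ge1: "1 \<le> c" if "c \<in> S" for c
  proof -
    have c: "0 < c" "dX x y \<le> c * dY (f x) (f y)" "dY (f x) (f y) \<le> c * dX x y"
      using that xy by (auto simp: S_def bi_lipschitz_def field_simps)
    then have "dX x y \<le> c * (c * dX x y)" by (meson less_imp_le mult_left_mono order_trans)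
    then have "1 * dX x y \<le> (c * c) * dX x y" by simp
    then have "1 * 1 \<le> c * c" using xy by (simp only: mult_le_cancel_right) auto
    then show ?thesis using mult_left_mono[of c 1 c] c(1) by linarith
  qed
  have C: "C \<in> S" using bl by (simp add: S_def)
  have bdd: "bdd_below S" using ge1 by (intro bdd_belowI)
  have I: "Inf S \<in> S"
  proof -
    have I1: "1 \<le> Inf S" using C ge1 by (intro cInf_greatest) auto
    have "dX u v / Inf S \<le> dY (f u) (f v) \<and> dY (f u) (f v) \<le> Inf S * dX u v" if uv: "u \<in> X" "v \<in> X" for u v
    proof -
      have c: "dX u v \<le> c * dY (f u) (f v)" "dY (f u) (f v) \<le> c * dX u v" if "c \<in> S" for c
        using that uv by (auto simp: S_def bi_lipschitz_def field_simps)
      have cl: "closed ({c. dX u v \<le> c * dY (f u) (f v)} \<inter> {c. dY (f u) (f v) \<le> c * dX u v})"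
        by (intro closed_Int closed_Collect_le continuous_intros)
      have "Inf S \<in> closure S" using C bdd by (intro closure_contains_Inf) auto
      also have "closure S \<subseteq> {c. dX u v \<le> c * dY (f u) (f v)} \<inter> {c. dY (f u) (f v) \<le> c * dX u v}"
        using c by (intro closure_minimal[OF _ cl]) auto
      finally show ?thesis using I1 by (auto simp: pos_divide_le_eq mult.commute)
    qed
    then show ?thesis using I1 bl by (auto simp: S_def bi_lipschitz_def)
  qed
  have "bi_lipschitz_constant X dX Y dY f = Inf S"
    unfolding bi_lipschitz_constant_def
    by (rule Least_equality) (use I bdd in \<open>auto simp: S_def intro: cInf_lower\<close>)
  then show "1 \<le> bi_lipschitz_constant X dX Y dY f" "bi_lipschitz_constant X dX Y dY f \<le> C"
    using ge1[OF I] cInf_lower[OF C bdd] by auto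
qed

lemma arc_length_segment:
  fixes x v :: "'a::euclidean_space"
  assumes "a \<le> b"
  shows "arc_length (\<lambda>t. x + t *\<^sub>R v) a b < \<infinity>"
proof -
  have "arc_length (\<lambda>t. x + t *\<^sub>R v) a b \<le> ennreal (b * norm v - a * norm v)"
  proof (rule arc_length_le[OF assms, where A="\<lambda>t. t * norm v"])
    fix s t :: real assume "s \<le> t"
    then show "dist (x + s *\<^sub>R v) (x + t *\<^sub>R v) \<le> t * norm v - s * norm v"
      by (simp add: dist_norm flip: scaleR_left_diff_distrib left_diff_distrib)
  qed
  then show ?thesis by (auto intro: le_less_trans)
qed

text \<open>Two points on a short segment in \<open>G\<close>.  Their distance is finite because the segment has finite
  Ferrand length, and positive because each curve from \<open>x\<close> to \<open>y\<close> contains an arc from \<open>x\<close> to the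
  sphere around \<open>x\<close> through \<open>y\<close>, inside of which the density is bounded from below.\<close>

lemma ferrand_metric_pos:
  fixes G :: "'a::euclidean_space set"
  assumes G: "open G" "G \<noteq> {}" "G \<noteq> UNIV"
  obtains x y where "x \<in> G" "y \<in> G" "x \<noteq> y" "0 < ferrand_metric (Some ` G) (Some x) (Some y)"
proof -
  let ?X = "Some ` G"
  let ?w = "ferrand_density ?X"
  have X: "openin ext_space ?X" using G by simp
  obtain p q where pq: "p \<in> ext_boundary ?X" "q \<in> ext_boundary ?X" "p \<noteq> q"
    by (rule ext_boundary_two_points[OF G])
  have ne: "ext_boundary ?X \<noteq> {}" using pq by auto
  have wpos: "0 < ?w z" if "z \<in> G" for z
    using ferrand_density_pos[OF X _ pq] that by auto
  have wcont: "continuous_on G ?w"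
    using continuous_on_ferrand_density[OF X ne] by (simp add: inj_image_mem_iff)
  obtain x where x: "x \<in> G" using G by blast
  then obtain r where r: "r > 0" "ball x r \<subseteq> G" using G open_contains_ball by blast
  obtain b :: 'a where b: "b \<in> Basis" using nonempty_Basis by blast
  define v where "v = (r / 2) *\<^sub>R b"
  define y where "y = x + v"
  have v: "norm v = r / 2" using r b by (simp add: v_def)
  have seg: "x + t *\<^sub>R v \<in> G" if "0 \<le> t" "t \<le> 1" for t
  proof -
    have "norm (t *\<^sub>R v) = t * norm v" using that by simp
    also have "\<dots> \<le> 1 * norm v" using that by (intro mult_right_mono) auto
    finally have "norm (t *\<^sub>R v) \<le> r / 2" using v by (simp only: mult_1)
    then have "x + t *\<^sub>R v \<in> ball x r" using r by (simp add: dist_norm)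
    then show ?thesis using r by blast
  qed
  have y: "y \<in> G" "y \<noteq> x" using seg[of 1] v r by (auto simp: y_def)
  have fin: "ferrand_inf ?X (Some x) (Some y) < \<infinity>"
  proof -
    define g where "g t = Some (x + t *\<^sub>R v)" for t :: real
    have the_g: "the \<circ> g = (\<lambda>t. x + t *\<^sub>R v)" by (auto simp: g_def)
    have path: "pathin (subtopology ext_space ?X) g"
    proof -
      have "continuous_map (top_of_set {0..1}) euclidean (\<lambda>t. x + t *\<^sub>R v)"
        by (auto intro!: continuous_intros)
      then have "continuous_map (top_of_set {0..1}) ext_space (Some \<circ> (\<lambda>t. x + t *\<^sub>R v))"
        by (rule continuous_map_compose) (rule continuous_map_Some)
      then show ?thesis using seg by (auto simp: pathin_def continuous_map_in_subtopology g_def[abs_def] o_def)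
    qed
    have rect: "rectifiable_curve g"
      unfolding rectifiable_curve_def the_g using arc_length_segment by blast
    have comp: "compact ((\<lambda>t. x + t *\<^sub>R v) ` {0..1})"
      by (intro compact_continuous_image continuous_intros) auto
    obtain B where B: "\<And>t. t \<in> {0..1} \<Longrightarrow> ?w (x + t *\<^sub>R v) \<le> B"
    proof -
      have "continuous_on ((\<lambda>t. x + t *\<^sub>R v) ` {0..1}) ?w"
        using seg by (intro continuous_on_subset[OF wcont]) auto
      from continuous_attains_sup[OF comp _ this] obtain z where
        "\<forall>y\<in>(\<lambda>t. x + t *\<^sub>R v) ` {0..1}. ?w y \<le> ?w z" by auto
      then show ?thesis using that[of "?w z"] by auto
    qed
    have B0: "0 \<le> B" using B[of 0] wpos[OF x] by simp
    have "curve_integral ?w g \<le> ennreal (B * norm v * 1 - B * norm v * 0)"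
      unfolding curve_integral_eq_interval_variation
    proof (rule interval_variation_le)
      fix s t :: real assume st: "0 \<le> s" "s \<le> t" "t \<le> 1"
      show "B * norm v * s \<le> B * norm v * t" using st B0 by (intro mult_left_mono) auto
      have "(\<integral>\<^sup>+u\<in>{s..t}. ennreal (?w (x + u *\<^sub>R v)) \<partial>arc_measure (\<lambda>t. x + t *\<^sub>R v) s t)
          \<le> ennreal (B * norm v * t - B * norm v * s)"
      proof (rule nn_integral_arc_measure_le[OF \<open>s \<le> t\<close>])
        show "continuous_on {s..t} (\<lambda>t. x + t *\<^sub>R v)" by (intro continuous_intros)
        then show "continuous_on {s..t} (\<lambda>u. ?w (x + u *\<^sub>R v))"
          using seg st by (intro continuous_on_compose2[OF wcont]) auto
        show "0 < ?w (x + u *\<^sub>R v)" if "u \<in> {s..t}" for u using wpos seg that st by auto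
        fix u u' c assume u: "s \<le> u" "u \<le> u'" "u' \<le> t" and c: "0 \<le> c" "\<And>t. t \<in> {u..u'} \<Longrightarrow> c \<le> ?w (x + t *\<^sub>R v)"
        have "c \<le> B" using c(2)[of u] B[of u] u st by auto
        have "dist (x + u *\<^sub>R v) (x + u' *\<^sub>R v) = (u' - u) * norm v"
          using u by (simp add: dist_norm flip: scaleR_left_diff_distrib)
        then have "c * dist (x + u *\<^sub>R v) (x + u' *\<^sub>R v) \<le> B * ((u' - u) * norm v)"
          using \<open>c \<le> B\<close> u by (auto intro!: mult_right_mono)
        then show "c * dist (x + u *\<^sub>R v) (x + u' *\<^sub>R v) \<le> B * norm v * u' - B * norm v * u"
          by (simp add: algebra_simps)
      qed
      then show "piece_integral ?w g {s..t} \<le> ennreal (B * norm v * t - B * norm v * s)"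
        using st by (auto simp: piece_integral_def the_g) (auto simp: g_def)
    qed simp
    moreover have "ferrand_inf ?X (Some x) (Some y) \<le> curve_integral ?w g"
      unfolding ferrand_inf_def using path rect by (intro INF_lower) (auto simp: g_def y_def)
    ultimately have "ferrand_inf ?X (Some x) (Some y) \<le> ennreal (B * norm v * 1 - B * norm v * 0)"
      by (rule order_trans[rotated])
    then show ?thesis by (rule le_less_trans) simp
  qed
  obtain d where d: "0 < d" "\<And>a. a \<in> ext_boundary ?X \<Longrightarrow> d \<le> ext_dist (Some x) a"
    by (rule ext_boundary_gap[OF X]) (use x in auto)
  define R where "R = dist x y"
  have R: "0 < R" using y by (simp add: R_def)
  define c where "c = ?w x / (1 + R / d)\<^sup>2"
  have den: "0 < (1 + R / d)\<^sup>2" using R d by (intro zero_less_power add_pos_pos) auto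
  have c: "0 < c" using wpos[OF x] den by (simp add: c_def)
  have cw: "c \<le> ?w z" if "z \<in> G" "dist x z \<le> R" for z
  proof -
    have "?w x \<le> (1 + norm (x - z) / d)\<^sup>2 * ?w z"
      using that by (intro ferrand_density_perturb[OF X _ ne d]) auto
    also have "\<dots> \<le> (1 + R / d)\<^sup>2 * ?w z"
      using that d wpos[of z] by (intro mult_right_mono power_mono add_left_mono divide_right_mono)
        (auto simp: dist_norm)
    finally show ?thesis using den by (simp add: c_def pos_divide_le_eq mult.commute)
  qed
  have "ennreal (c * R) \<le> ferrand_inf ?X (Some x) (Some y)"
    unfolding ferrand_inf_def
  proof (rule INF_greatest, clarsimp)
    fix g assume path: "pathin (subtopology ext_space ?X) g" and rect: "rectifiable_curve g"
      and g01: "g 0 = Some x" "g 1 = Some y"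
    have gG: "g t \<in> ?X" if "t \<in> {0..1}" for t using path_in_space[OF path that] .
    have nN: "None \<notin> g ` {a..b}" if "0 \<le> a" "b \<le> 1" for a b
    proof
      assume "None \<in> g ` {a..b}"
      then obtain t where "t \<in> {a..b}" "g t = None" by force
      then show False using gG[of t] that by auto
    qed
    define h where "h = the \<circ> g"
    have hG: "h t \<in> G" if "t \<in> {0..1}" for t using gG[OF that] by (auto simp: h_def)
    have hc: "continuous_on {0..1} h" unfolding h_def by (intro continuous_on_path_finite[OF path] nN) auto
    have h01: "h 0 = x" "h 1 = y" using g01 by (auto simp: h_def)
    \<comment> \<open>\<open>u\<close> is the first time at which the curve reaches the sphere.\<close>
    define S where "S = {0..1} \<inter> (\<lambda>t. dist x (h t)) -` {R..}"
    have S: "closed S" unfolding S_def by (intro continuous_closed_preimage continuous_intros hc)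
    have S1: "1 \<in> S" using h01 by (simp add: S_def R_def)
    have bdd: "bdd_below S" by (rule bdd_belowI[of _ 0]) (auto simp: S_def)
    define u where "u = Inf S"
    have uS: "u \<in> S" unfolding u_def using S1 by (intro closed_contains_Inf bdd S) auto
    have before: "dist x (h t) < R" if "0 \<le> t" "t < u" for t
    proof (rule ccontr)
      assume "\<not> dist x (h t) < R"
      moreover have "t \<le> 1" using that uS by (auto simp: S_def)
      ultimately have "t \<in> S" using that by (auto simp: S_def)
      then have "u \<le> t" unfolding u_def by (rule cInf_lower[OF _ bdd])
      then show False using that by simp
    qed
    have u01: "0 \<le> u" "u \<le> 1" "R \<le> dist x (h u)" using uS by (auto simp: S_def)
    have "u \<noteq> 0" using u01 h01 R by auto
    then have u0: "0 < u" using u01 by simp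
    have at_u: "dist x (h u) \<le> R"
      using chord_limit_left[of 0 u h 1 R] before u01 u0 continuous_on_subset[OF hc, of "{0..u}"] h01
      by (auto simp: less_imp_le)
    have "ennreal (c * R) \<le> ennreal c * ennreal (dist (h 0) (h u))"
      using u01 c R h01 by (subst ennreal_mult[symmetric]) (auto intro!: ennreal_leI)
    also have "\<dots> \<le> ennreal c * arc_length h 0 u"
      using u0 by (intro mult_left_mono dist_le_arc_length) auto
    also have "\<dots> \<le> piece_integral ?w g {0..u}"
    proof -
      have "ennreal c * arc_length h 0 u \<le> (\<integral>\<^sup>+t\<in>{0..u}. ennreal (?w (h t)) \<partial>arc_measure h 0 u)"
      proof (rule nn_integral_arc_measure_ge)
        show "arc_length h 0 u < \<infinity>" using rect nN[of 0 u] u01 by (auto simp: rectifiable_curve_def h_def)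
        show "continuous_on {0..u} h" using u01 by (intro continuous_on_subset[OF hc]) auto
        show "c \<le> ?w (h t)" if "t \<in> {0..u}" for t
          using before[of t] at_u that u01 hG[of t] by (intro cw) (cases "t = u"; auto)+
      qed (use u01 in auto)
      then show ?thesis using nN[of 0 u] u01 by (simp add: piece_integral_def h_def)
    qed
    also have "\<dots> \<le> interval_variation (piece_integral ?w g) 0 u" using u01 by (intro interval_variation_ge)
    also have "\<dots> \<le> curve_integral ?w g"
      unfolding curve_integral_eq_interval_variation
      using u01 by (intro interval_variation_mono piece_integral_singleton) auto
    finally show "ennreal (c * R) \<le> curve_integral ?w g" .
  qed
  then have "0 < ferrand_inf ?X (Some x) (Some y)"
    using c R by (meson ennreal_less_zero_iff less_le_trans mult_pos_pos)
  then have "0 < ferrand_metric ?X (Some x) (Some y)"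
    using fin by (simp add: ferrand_metric_eq enn2real_positive_iff)
  then show ?thesis using that x y by metis
qed

section \<open>Radial inversions\<close>

text \<open>The quasi-inversion in the surface \<open>{w. norm w = \<rho> w}\<close>, in terms of a positive function \<open>\<rho>\<close>
  that is constant on rays.\<close>

fun radial_inversion :: "('a::euclidean_space \<Rightarrow> real) \<Rightarrow> 'a option \<Rightarrow> 'a option" where
  "radial_inversion \<rho> None = Some 0"
| "radial_inversion \<rho> (Some x) = (if x = 0 then None else Some (((\<rho> x)\<^sup>2 / (norm x)\<^sup>2) *\<^sub>R x))"

lemma norm_inversion_diff:
  fixes z w :: "'a::real_inner"
  assumes "z \<noteq> 0" "w \<noteq> 0"
  shows "norm ((1 / (norm z)\<^sup>2) *\<^sub>R z - (1 / (norm w)\<^sup>2) *\<^sub>R w) * (norm z * norm w) = norm (z - w)"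
proof -
  have sq: "(norm (a *\<^sub>R z - b *\<^sub>R w))\<^sup>2 = a\<^sup>2 * (norm z)\<^sup>2 - 2 * a * b * (z \<bullet> w) + b\<^sup>2 * (norm w)\<^sup>2"
    for a b :: real
    unfolding power2_norm_eq_inner
    by (simp add: inner_diff_left inner_diff_right inner_commute[of w z] algebra_simps power2_eq_square)
  have nz: "norm z \<noteq> 0" "norm w \<noteq> 0" using assms by auto
  have "(norm ((1 / (norm z)\<^sup>2) *\<^sub>R z - (1 / (norm w)\<^sup>2) *\<^sub>R w) * (norm z * norm w))\<^sup>2
      = (norm (1 *\<^sub>R z - 1 *\<^sub>R w))\<^sup>2"
    unfolding power_mult_distrib sq using nz by (simp add: field_simps)
  then show ?thesis by (simp add: power2_eq_iff_nonneg)
qed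

text \<open>A positive function that is constant on the open rays from the origin, where its value is
  arbitrary.\<close>

locale radial_function =
  fixes \<rho> :: "'a::euclidean_space \<Rightarrow> real"
  assumes pos: "x \<noteq> 0 \<Longrightarrow> 0 < \<rho> x"
    and hom: "x \<noteq> 0 \<Longrightarrow> 0 < c \<Longrightarrow> \<rho> (c *\<^sub>R x) = \<rho> x"
    and cont: "continuous_on (- {0}) \<rho>"

text \<open>The maps \<open>x \<mapsto> \<rho> x *\<^sub>R x\<close> and \<open>x \<mapsto> (1 / \<rho> x) *\<^sub>R x\<close> are inverse to each other; both are
  \<open>\<Lambda>\<close>-Lipschitz.  The values at \<open>0\<close> are \<open>0\<close> whatever \<open>\<rho> 0\<close> is.\<close>

locale bilipschitz_radial_function = radial_function \<rho> for \<rho> :: "'a::euclidean_space \<Rightarrow> real" +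
  fixes \<Lambda> :: real
  assumes stretch: "norm (\<rho> x *\<^sub>R x - \<rho> y *\<^sub>R y) \<le> \<Lambda> * norm (x - y)"
    and shrink: "norm ((1 / \<rho> x) *\<^sub>R x - (1 / \<rho> y) *\<^sub>R y) \<le> \<Lambda> * norm (x - y)"
begin

abbreviation "f \<equiv> radial_inversion \<rho>"

text \<open>\<open>g\<close> is \<open>f\<close> on the finite nonzero points, and \<open>m\<close> the weight with which \<open>f\<close> is a quasi-Moebius
  involution.\<close>

definition "g x = ((\<rho> x)\<^sup>2 / (norm x)\<^sup>2) *\<^sub>R x"

fun m :: "'a option \<Rightarrow> real" where
  "m None = 1"
| "m (Some x) = (if x = 0 then 1 else norm x / \<rho> x)"

lemma rho_le: assumes "x \<noteq> 0" shows "\<rho> x \<le> \<Lambda>" "1 / \<rho> x \<le> \<Lambda>"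
proof -
  have "\<rho> x * norm x \<le> \<Lambda> * norm x" using stretch[of x 0] pos[OF assms] by simp
  then show "\<rho> x \<le> \<Lambda>" using assms by simp
  have "1 / \<rho> x * norm x \<le> \<Lambda> * norm x" using shrink[of x 0] pos[OF assms] by simp
  then show "1 / \<rho> x \<le> \<Lambda>" using assms by (metis mult_le_cancel_right_pos zero_less_norm_iff)
qed

lemma Lambda_ge_1: "1 \<le> \<Lambda>"
proof -
  obtain b :: 'a where "b \<in> Basis" using nonempty_Basis by blast
  then have b: "b \<noteq> 0" by auto
  have "1 \<le> \<rho> b \<or> 1 \<le> 1 / \<rho> b" using pos[OF b] by (simp add: field_simps) linarith
  then show ?thesis using rho_le[OF b] by auto
qed

lemma g_nonzero: "x \<noteq> 0 \<Longrightarrow> g x \<noteq> 0"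
  using pos[of x] by (simp add: g_def)

lemma rho_g: "x \<noteq> 0 \<Longrightarrow> \<rho> (g x) = \<rho> x"
  using pos[of x] unfolding g_def by (intro hom) auto

lemma norm_g: "x \<noteq> 0 \<Longrightarrow> norm (g x) = (\<rho> x)\<^sup>2 / norm x"
  by (simp add: g_def power2_eq_square)

lemma g_g: "x \<noteq> 0 \<Longrightarrow> g (g x) = x"
proof -
  assume x: "x \<noteq> 0"
  have "g (g x) = ((\<rho> x)\<^sup>2 / (norm (g x))\<^sup>2 * ((\<rho> x)\<^sup>2 / (norm x)\<^sup>2)) *\<^sub>R x"
    using rho_g[OF x] unfolding g_def[of "g x"] by (simp add: g_def[of x])
  also have "(\<rho> x)\<^sup>2 / (norm (g x))\<^sup>2 * ((\<rho> x)\<^sup>2 / (norm x)\<^sup>2) = 1"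
    using x pos[OF x] by (simp add: norm_g field_simps power2_eq_square)
  finally show ?thesis by simp
qed

lemma f_simps: "f (Some x) = (if x = 0 then None else Some (g x))"
  by (simp add: g_def)

lemma f_f: "f (f p) = p"
  by (cases p) (auto simp: f_simps g_nonzero g_g simp del: radial_inversion.simps(2))

lemma g_cont: "continuous_on (- {0}) g"
  unfolding g_def[abs_def] by (intro continuous_intros cont) auto

lemma norm_g_bounds:
  assumes "x \<noteq> 0" shows "norm (g x) * norm x \<le> \<Lambda>\<^sup>2" "1 \<le> \<Lambda>\<^sup>2 * (norm (g x) * norm x)"
proof -
  have eq: "norm (g x) * norm x = (\<rho> x)\<^sup>2" using assms by (simp add: norm_g)
  show "norm (g x) * norm x \<le> \<Lambda>\<^sup>2" unfolding eq using rho_le[OF assms] pos[OF assms] by (intro power_mono) auto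
  have "1 \<le> \<Lambda> * \<rho> x" using rho_le[OF assms] pos[OF assms] by (simp add: field_simps)
  then have "1 \<le> (\<Lambda> * \<rho> x)\<^sup>2" by (simp add: one_le_power)
  then show "1 \<le> \<Lambda>\<^sup>2 * (norm (g x) * norm x)" by (simp add: eq power_mult_distrib)
qed

lemma f_continuous: "continuous_map ext_space ext_space f"
  unfolding continuous_map_def
proof (intro conjI allI impI)
  show "f \<in> topspace ext_space \<rightarrow> topspace ext_space" by (simp add: UNIV_option_conv[symmetric])
  fix V :: "'a option set" assume V: "openin ext_space V"
  define P where "P U = {x \<in> - {0}. g x \<in> U}" for U
  have openP: "open (P U)" if "open U" for U
    using continuous_open_preimage[OF g_cont _ that] by (auto simp: P_def Int_def vimage_def open_Compl)
  have "openin ext_space {p. f p \<in> V}"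
  proof -
    from V consider U where "open U" "V = Some ` U"
      | C where "compact C" "V = insert None (Some ` (UNIV - C))"
      unfolding openin_Alexandroff_compactification by auto
    then show ?thesis
    proof cases
      case 1
      show ?thesis
      proof (cases "0 \<in> U")
        case False
        have "{p. f p \<in> V} = Some ` P U"
        proof (intro set_eqI)
          fix p show "p \<in> {p. f p \<in> V} \<longleftrightarrow> p \<in> Some ` P U"
            using False by (cases p) (auto simp: 1 P_def f_simps simp del: radial_inversion.simps(2))
        qed
        then show ?thesis using openP[OF 1(1)] by simp
      next
        case True
        obtain e where e: "e > 0" "ball 0 e \<subseteq> U" using 1 True open_contains_ball by blast
        have "norm x \<le> \<Lambda>\<^sup>2 / e" if "x \<in> - P U" for x
        proof (cases "x = 0")
          case False
          then have "g x \<notin> ball 0 e" using that e by (auto simp: P_def)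
          then have "e * norm x \<le> norm (g x) * norm x" by (intro mult_right_mono) auto
          also have "\<dots> \<le> \<Lambda>\<^sup>2" by (rule norm_g_bounds[OF False])
          finally show ?thesis using e by (simp add: field_simps)
        qed (use e in auto)
        then have "bounded (- P U)" by (auto simp: bounded_iff)
        then have "compact (- P U)" using openP[OF 1(1)] by (simp add: compact_eq_bounded_closed closed_Compl)
        moreover have "{p. f p \<in> V} = insert None (Some ` (UNIV - - P U))"
        proof (intro set_eqI)
          fix p show "p \<in> {p. f p \<in> V} \<longleftrightarrow> p \<in> insert None (Some ` (UNIV - - P U))"
            using True by (cases p) (auto simp: 1 P_def f_simps simp del: radial_inversion.simps(2))
        qed
        ultimately show ?thesis unfolding openin_Alexandroff_compactification
          by (auto intro: compact_imp_closed)
      qed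
    next
      case 2
      show ?thesis
      proof (cases "0 \<in> C")
        case True
        obtain B where B: "0 < B" "\<And>x. x \<in> C \<Longrightarrow> norm x \<le> B"
          using compact_imp_bounded[OF 2(1)] by (auto simp: bounded_pos)
        define e where "e = 1 / (\<Lambda>\<^sup>2 * B)"
        have e: "0 < e" using B Lambda_ge_1 by (simp add: e_def)
        have "g x \<notin> C" if "x \<noteq> 0" "norm x < e" for x
        proof
          assume "g x \<in> C"
          then have "norm (g x) * norm x \<le> B * norm x" using B by (intro mult_right_mono) auto
          then have "\<Lambda>\<^sup>2 * (norm (g x) * norm x) \<le> \<Lambda>\<^sup>2 * (B * norm x)" by (intro mult_left_mono) auto
          also have "\<dots> < \<Lambda>\<^sup>2 * (B * e)" using that B Lambda_ge_1 by (intro mult_strict_left_mono) auto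
          also have "\<dots> = 1" using B Lambda_ge_1 by (simp add: e_def)
          finally show False using norm_g_bounds(2)[OF that(1)] by simp
        qed
        then have W: "{p. f p \<in> V} = Some ` (ball 0 e \<union> P (- C))"
          using True e
        proof (intro set_eqI)
          fix p show "p \<in> {p. f p \<in> V} \<longleftrightarrow> p \<in> Some ` (ball 0 e \<union> P (- C))"
          proof (cases p)
            case None then show ?thesis using True by (auto simp: 2)
          next
            case (Some x)
            then show ?thesis using e \<open>\<And>x. x \<noteq> 0 \<Longrightarrow> norm x < e \<Longrightarrow> g x \<notin> C\<close>
              by (cases "x = 0") (auto simp: 2 P_def f_simps simp del: radial_inversion.simps(2))
          qed
        qed
        have "open (ball 0 e \<union> P (- C))"
          using 2 by (intro open_Un openP open_Compl compact_imp_closed) auto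
        then show ?thesis unfolding W by simp
      next
        case False
        have C': "compact (g ` C)" using False
          by (intro compact_continuous_image 2 continuous_on_subset[OF g_cont]) auto
        have "{p. f p \<in> V} = insert None (Some ` (UNIV - g ` C))"
        proof (intro set_eqI)
          fix p show "p \<in> {p. f p \<in> V} \<longleftrightarrow> p \<in> insert None (Some ` (UNIV - g ` C))"
          proof (cases p)
            case None then show ?thesis using False by (auto simp: 2)
          next
            case (Some x)
            have "x \<in> g ` C \<longleftrightarrow> x \<noteq> 0 \<and> g x \<in> C"
            proof
              assume "x \<in> g ` C"
              then obtain c where c: "c \<in> C" "x = g c" by blast
              then have "c \<noteq> 0" using False by auto
              then show "x \<noteq> 0 \<and> g x \<in> C" using c g_nonzero g_g by auto
            next
              assume "x \<noteq> 0 \<and> g x \<in> C"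
              then show "x \<in> g ` C" using g_g[of x] by (metis imageI)
            qed
            then show ?thesis using Some
              by (auto simp: 2 f_simps simp del: radial_inversion.simps(2))
          qed
        qed
        then show ?thesis using C' unfolding openin_Alexandroff_compactification
          by (auto intro: compact_imp_closed)
      qed
    qed
  qed
  then show "openin ext_space {p \<in> topspace ext_space. f p \<in> V}"
    by (simp add: UNIV_option_conv[symmetric])
qed

lemma finite_distortion:
  assumes x: "x \<noteq> 0" and y: "y \<noteq> 0"
  shows "norm (g x - g y) * (norm x / \<rho> x * (norm y / \<rho> y)) \<le> \<Lambda>\<^sup>2 * norm (x - y)"
    and "norm (x - y) \<le> \<Lambda>\<^sup>2 * (norm (g x - g y) * (norm x / \<rho> x * (norm y / \<rho> y)))"
proof -
  \<comment> \<open>\<open>z = (1 / \<rho> x) x\<close> and \<open>w = (1 / \<rho> y) y\<close> are inverted in the unit sphere.\<close>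
  define z w where "z = (1 / \<rho> x) *\<^sub>R x" and "w = (1 / \<rho> y) *\<^sub>R y"
  define z' w' where "z' = (1 / (norm z)\<^sup>2) *\<^sub>R z" and "w' = (1 / (norm w)\<^sup>2) *\<^sub>R w"
  note p = pos[OF x] pos[OF y]
  have z0: "z \<noteq> 0" "w \<noteq> 0" using x y p by (auto simp: z_def w_def)
  have nz: "norm z = norm x / \<rho> x" "norm w = norm y / \<rho> y" using p by (auto simp: z_def w_def)
  have rz: "\<rho> z = \<rho> x" "\<rho> w = \<rho> y" using p unfolding z_def w_def by (auto intro!: hom x y)
  have rz': "\<rho> z' = \<rho> x" "\<rho> w' = \<rho> y" using rz z0 unfolding z'_def w'_def
    by (auto simp: hom)
  have zx: "\<rho> z *\<^sub>R z = x" "\<rho> w *\<^sub>R w = y" using rz p by (auto simp: z_def w_def)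
  have z'g: "\<rho> z' *\<^sub>R z' = g x" "\<rho> w' *\<^sub>R w' = g y" "(1 / \<rho> (g x)) *\<^sub>R g x = z'" "(1 / \<rho> (g y)) *\<^sub>R g y = w'"
    using rz' p x y rho_g[OF x] rho_g[OF y] unfolding z'_def w'_def nz
    by (auto simp: g_def z_def w_def field_simps power2_eq_square)
  have inv: "norm (z' - w') * (norm z * norm w) = norm (z - w)"
    unfolding z'_def w'_def by (rule norm_inversion_diff[OF z0])
  have L: "0 \<le> \<Lambda>" using Lambda_ge_1 by simp
  have "norm (g x - g y) * (norm z * norm w) \<le> (\<Lambda> * norm (z' - w')) * (norm z * norm w)"
    using stretch[of z' w'] unfolding z'g by (intro mult_right_mono) auto
  also have "\<dots> = \<Lambda> * norm (z - w)" using inv by simp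
  also have "\<dots> \<le> \<Lambda> * (\<Lambda> * norm (x - y))"
    using shrink[of x y] L unfolding z_def[symmetric] w_def[symmetric] by (intro mult_left_mono) auto
  finally show "norm (g x - g y) * (norm x / \<rho> x * (norm y / \<rho> y)) \<le> \<Lambda>\<^sup>2 * norm (x - y)"
    by (simp add: nz power2_eq_square mult_ac)
  have "norm (x - y) \<le> \<Lambda> * norm (z - w)" using stretch[of z w] by (simp add: zx)
  also have "\<dots> = \<Lambda> * (norm (z' - w') * (norm z * norm w))" by (simp add: inv)
  also have "\<dots> \<le> \<Lambda> * ((\<Lambda> * norm (g x - g y)) * (norm z * norm w))"
    using shrink[of "g x" "g y"] L unfolding z'g by (intro mult_left_mono mult_right_mono) auto
  finally show "norm (x - y) \<le> \<Lambda>\<^sup>2 * (norm (g x - g y) * (norm x / \<rho> x * (norm y / \<rho> y)))"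
    by (simp add: nz power2_eq_square mult_ac)
qed

lemma norm_g_m:
  assumes y: "y \<noteq> 0"
  shows "norm (g y) * m (Some y) = \<rho> y"
  using y pos[OF y] by (simp add: norm_g field_simps power2_eq_square)

lemma Lambda_sq: "\<Lambda> \<le> \<Lambda>\<^sup>2" "1 \<le> \<Lambda>\<^sup>2"
  using Lambda_ge_1 power_increasing[of 1 2 \<Lambda>] by auto

lemma distortion:
  "ext_dist (f p) (f q) * (m p * m q) \<le> \<Lambda>\<^sup>2 * ext_dist p q \<and>
   ext_dist p q \<le> \<Lambda>\<^sup>2 * (ext_dist (f p) (f q) * (m p * m q))"
proof -
  let ?P = "\<lambda>p q. ext_dist (f p) (f q) * (m p * m q) \<le> \<Lambda>\<^sup>2 * ext_dist p q \<and>
   ext_dist p q \<le> \<Lambda>\<^sup>2 * (ext_dist (f p) (f q) * (m p * m q))"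
  have sym: "?P q p" if "?P p q" for p q
    using that by (simp add: ext_dist_commute mult_ac)
  have z: "?P (Some 0) (Some y)" if y: "y \<noteq> 0" for y
  proof -
    have "norm y / \<rho> y \<le> \<Lambda> * norm y"
      using mult_right_mono[OF rho_le(2)[OF y], of "norm y"] by simp
    also have "\<dots> \<le> \<Lambda>\<^sup>2 * norm y" using Lambda_sq by (intro mult_right_mono) auto
    finally have 1: "norm y / \<rho> y \<le> \<Lambda>\<^sup>2 * norm y" .
    have "norm y = \<rho> y * (norm y / \<rho> y)" using pos[OF y] by simp
    also have "\<dots> \<le> \<Lambda>\<^sup>2 * (norm y / \<rho> y)"
      using rho_le(1)[OF y] Lambda_sq pos[OF y] by (intro mult_right_mono) auto
    finally have 2: "norm y \<le> \<Lambda>\<^sup>2 * (norm y / \<rho> y)" .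
    from 1 2 y show ?thesis by simp
  qed
  have n: "?P None (Some y)" if y: "y \<noteq> 0" for y
  proof -
    have 1: "\<rho> y \<le> \<Lambda>\<^sup>2" using rho_le(1)[OF y] Lambda_sq by simp
    have "1 = 1 / \<rho> y * \<rho> y" using pos[OF y] by simp
    also have "\<dots> \<le> \<Lambda>\<^sup>2 * \<rho> y" using rho_le(2)[OF y] Lambda_sq pos[OF y] by (intro mult_right_mono) auto
    finally have 2: "1 \<le> \<Lambda>\<^sup>2 * \<rho> y" .
    have "ext_dist (f None) (f (Some y)) * (m None * m (Some y)) = \<rho> y"
      using norm_g_m[OF y] y by (simp add: f_simps del: radial_inversion.simps(2) m.simps(2))
    then show ?thesis using 1 2 by simp
  qed
  have nz: "?P None (Some 0)" using Lambda_sq by simp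
  show ?thesis
  proof (cases p)
    case None
    show ?thesis
    proof (cases q)
      case (Some y)
      then show ?thesis using n[of y] nz None by (cases "y = 0") blast+
    qed (simp add: None)
  next
    case (Some x)
    show ?thesis
    proof (cases q)
      case None
      then show ?thesis using sym[OF n[of x]] sym[OF nz] Some by (cases "x = 0") blast+
    next
      case (Some y)
      show ?thesis
      proof (cases "x = 0 \<or> y = 0")
        case True
        have 0: "?P (Some 0) (Some 0)" by simp
        from True consider "x = 0" "y = 0" | "x = 0" "y \<noteq> 0" | "x \<noteq> 0" "y = 0" by blast
        then show ?thesis
          using 0 z[of y] sym[OF z[of x]] unfolding \<open>p = Some x\<close> Some by cases blast+
      next
        case False
        then show ?thesis using finite_distortion[of x y] \<open>p = Some x\<close> Some
          by (simp add: f_simps del: radial_inversion.simps(2))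
      qed
    qed
  qed
qed

lemma quasi_moebius: "quasi_moebius_involution f m (\<Lambda>\<^sup>2)"
proof
  show "0 < m p" for p using pos by (cases p) auto
  show "continuous_on (- {0}) (\<lambda>x. m (Some x))"
  proof -
    have "continuous_on (- {0}) (\<lambda>x. norm x / \<rho> x)"
      by (intro continuous_intros cont) (auto dest: pos)
    then show ?thesis by (rule continuous_on_cong[THEN iffD1, rotated -1]) auto
  qed
qed (use f_continuous f_f distortion Lambda_sq in auto)

end

section \<open>Boundaries of strictly starlike domains\<close>

locale starlike_surface =
  fixes D M :: "'a::euclidean_space set"
  assumes starlike: "strictly_starlike D 0" and M: "M = frontier D"
begin

text \<open>For \<open>x \<noteq> 0\<close> the distance from the origin to \<open>M\<close> in the direction of \<open>x\<close>.\<close>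

abbreviation "\<rho> x \<equiv> norm (radial_point M x)"

lemma zero_notin: "0 \<notin> M"
  using starlike M by (auto simp: strictly_starlike_def frontier_def interior_open)

lemma compact_M: "compact M"
  using starlike M by (auto simp: strictly_starlike_def intro: compact_frontier_bounded)

lemma radial_point_ex1: assumes "u \<noteq> 0" shows "\<exists>!w. w \<in> M \<and> (\<exists>t>0. w = t *\<^sub>R u)"
proof -
  have "\<exists>!w. w \<in> M \<and> (\<exists>t\<ge>0. w = t *\<^sub>R u)"
    using starlike assms M by (simp add: strictly_starlike_def)
  moreover have "(\<exists>t\<ge>0. w = t *\<^sub>R u) \<longleftrightarrow> (\<exists>t>0. w = t *\<^sub>R u)" if "w \<in> M" for w
    using that zero_notin by (metis less_eq_real_def scale_zero_left)
  ultimately show ?thesis by metis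
qed

lemma radial_point: assumes "u \<noteq> 0" shows "radial_point M u \<in> M" "\<exists>t>0. radial_point M u = t *\<^sub>R u"
  using theI'[OF radial_point_ex1[OF assms]] by (auto simp: radial_point_def)

lemma radial_point_unique: assumes "w \<in> M" "w = t *\<^sub>R u" "0 < t" shows "radial_point M u = w"
proof -
  have "u \<noteq> 0" using assms zero_notin by auto
  from the1_equality[OF radial_point_ex1[OF this]] show ?thesis using assms by (auto simp: radial_point_def)
qed

lemma rho_pos: "x \<noteq> 0 \<Longrightarrow> 0 < \<rho> x"
  using radial_point(1) zero_notin by (metis zero_less_norm_iff)

lemma radial_point_eq: assumes "x \<noteq> 0" shows "radial_point M x = (\<rho> x / norm x) *\<^sub>R x"
proof -
  obtain t where "t > 0" "radial_point M x = t *\<^sub>R x" using radial_point(2)[OF assms] by blast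
  then show ?thesis using assms by simp
qed

lemma radial_point_scale: assumes "x \<noteq> 0" "0 < c" shows "radial_point M (c *\<^sub>R x) = radial_point M x"
proof (rule radial_point_unique)
  show "radial_point M x \<in> M" using radial_point assms by auto
  show "radial_point M x = (\<rho> x / norm x / c) *\<^sub>R (c *\<^sub>R x)"
    using radial_point_eq[OF assms(1)] assms by simp
  show "0 < \<rho> x / norm x / c" using rho_pos assms by simp
qed

text \<open>The central projection of the compact set \<open>M\<close> to the unit sphere is a continuous bijection, so
  its inverse is continuous.\<close>

lemma radial_point_continuous: "continuous_on (- {0}) (radial_point M)"
proof -
  let ?s = "\<lambda>w::'a. w /\<^sub>R norm w"
  have cs: "continuous_on M ?s"
    using zero_notin by (intro continuous_intros) auto
  have inv: "radial_point M (?s w) = w" if "w \<in> M" for w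
  proof -
    have "w \<noteq> 0" using that zero_notin by auto
    then show ?thesis using that by (intro radial_point_unique[where t="norm w"]) auto
  qed
  have c: "continuous_on (?s ` M) (radial_point M)"
    using inv by (intro continuous_on_inv[OF cs compact_M]) auto
  have im: "?s x \<in> ?s ` M" if x: "x \<noteq> 0" for x
  proof -
    obtain t where "t > 0" "radial_point M x = t *\<^sub>R x" using radial_point(2)[OF x] by blast
    then have "?s x = ?s (radial_point M x)" by simp
    then show ?thesis by (rule image_eqI) (rule radial_point(1)[OF x])
  qed
  have "continuous_on (- {0}) (\<lambda>x. radial_point M (?s x))"
    using im by (intro continuous_on_compose2[OF c] continuous_intros) auto
  then show ?thesis
    by (rule continuous_on_cong[THEN iffD1, rotated -1]) (auto intro!: radial_point_scale)
qed

lemma radial_function: "radial_function \<rho>"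
  using rho_pos radial_point_scale radial_point_continuous
  by unfold_locales (auto intro: continuous_on_norm)

lemma quasi_inversion_eq: "quasi_inversion M = radial_inversion \<rho>"
proof
  fix p show "quasi_inversion M p = radial_inversion \<rho> p" by (cases p) auto
qed

lemma radial_extension_eq: "radial_extension M x = \<rho> x *\<^sub>R x"
proof (cases "x = 0")
  case False
  then have "radial_point M (x /\<^sub>R norm x) = radial_point M x" by (intro radial_point_scale) auto
  then show ?thesis
    using False arg_cong[OF radial_point_eq[OF False], of "\<lambda>w. norm x *\<^sub>R w"]
    by (simp add: radial_extension_def)
qed (simp add: radial_extension_def)

end

section \<open>Lipschitz bounds from pointwise Lipschitz bounds\<close>

text \<open>The upper limit of \<open>norm (g w - g x) / norm (w - x)\<close> for \<open>w\<close> tending to \<open>x\<close> is at most \<open>\<epsilon>\<close>.\<close>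

definition pointwise_lipschitz :: "('a::real_normed_vector \<Rightarrow> 'b::real_normed_vector) \<Rightarrow> real \<Rightarrow> 'a \<Rightarrow> bool" where
  "pointwise_lipschitz g \<epsilon> x \<longleftrightarrow> (\<forall>e>0. \<forall>\<^sub>F w in at x. norm (g w - g x) \<le> (\<epsilon> + e) * norm (w - x))"

lemma pointwise_lipschitzD:
  assumes "pointwise_lipschitz g \<epsilon> x" "0 < e"
  obtains d where "0 < d" "\<And>w. norm (w - x) < d \<Longrightarrow> norm (g w - g x) \<le> (\<epsilon> + e) * norm (w - x)"
proof -
  from assms obtain d where d: "0 < d"
    "\<And>w. w \<noteq> x \<Longrightarrow> dist w x < d \<Longrightarrow> norm (g w - g x) \<le> (\<epsilon> + e) * norm (w - x)"
    unfolding pointwise_lipschitz_def eventually_at by blast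
  show ?thesis
  proof (rule that[OF d(1)])
    fix w assume "norm (w - x) < d"
    then show "norm (g w - g x) \<le> (\<epsilon> + e) * norm (w - x)"
      using d(2)[of w] by (cases "w = x") (auto simp: dist_norm)
  qed
qed

lemma pointwise_lipschitzI:
  assumes "\<And>e. 0 < e \<Longrightarrow> \<exists>d>0. \<forall>w. norm (w - x) < d \<longrightarrow> norm (g w - g x) \<le> (\<epsilon> + e) * norm (w - x)"
  shows "pointwise_lipschitz g \<epsilon> x"
  unfolding pointwise_lipschitz_def eventually_at dist_norm using assms by meson

text \<open>The exceptional null set is covered by an open set \<open>U\<close> of small measure.  The chords of \<open>\<gamma>\<close> are
  locally bounded by the increments of \<open>A\<close>, which grows with slope \<open>\<epsilon> + e\<close>, and by \<open>K\<close> more on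
  \<open>U\<close>.  The Lipschitz bound \<open>K\<close> matters at exceptional points only.\<close>

lemma lipschitz_of_ae_pointwise_real:
  fixes \<gamma> :: "real \<Rightarrow> 'b::real_normed_vector"
  assumes K: "0 \<le> K" and lip: "\<And>s t. N \<noteq> {} \<Longrightarrow> norm (\<gamma> s - \<gamma> t) \<le> K * \<bar>s - t\<bar>"
    and N: "N \<in> null_sets lborel" and \<epsilon>: "0 \<le> \<epsilon>"
    and pl: "\<And>t. t \<in> {0..1} \<Longrightarrow> t \<notin> N \<Longrightarrow> pointwise_lipschitz \<gamma> \<epsilon> t"
  shows "norm (\<gamma> 0 - \<gamma> 1) \<le> \<epsilon>"
proof (rule field_le_epsilon)
  fix e' :: real assume "0 < e'"
  define e where "e = e' / 2"
  have e: "0 < e" using \<open>0 < e'\<close> by (simp add: e_def)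
  have "0 < e / (K + 1)" using e K by simp
  have "N \<in> sets borel" using N by auto
  obtain U where U: "open U" "N \<subseteq> U" "emeasure lborel (U - N) < e / (K + 1)"
    by (rule outer_regular_lborel[OF \<open>N \<in> sets borel\<close> \<open>0 < e / (K + 1)\<close>])
  have "emeasure lborel U \<le> emeasure lborel (U - N) + emeasure lborel N"
  proof -
    have "emeasure lborel U \<le> emeasure lborel ((U - N) \<union> N)" using U N by (intro emeasure_mono) auto
    also have "\<dots> \<le> emeasure lborel (U - N) + emeasure lborel N" using U N by (intro emeasure_subadditive) auto
    finally show ?thesis .
  qed
  then have eU: "emeasure lborel U \<le> e / (K + 1)" using U N by auto
  have finU: "emeasure lborel (U \<inter> B) < \<infinity>" if "B \<in> sets borel" for B
  proof -
    have "emeasure lborel (U \<inter> B) \<le> emeasure lborel U" using U by (intro emeasure_mono) auto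
    also have "\<dots> \<le> ennreal (e / (K + 1))" by (rule eU)
    also have "\<dots> < \<infinity>" by simp
    finally show ?thesis .
  qed
  define \<mu> where "\<mu> t = measure lborel (U \<inter> {0..t})" for t
  have \<mu>_diff: "\<mu> v - \<mu> u = measure lborel (U \<inter> {u<..v})" if "0 \<le> u" "u \<le> v" for u v
  proof -
    have "U \<inter> {0..v} = (U \<inter> {0..u}) \<union> (U \<inter> {u<..v})" using that by auto
    then have "\<mu> v = measure lborel (U \<inter> {0..u}) + measure lborel (U \<inter> {u<..v})"
      unfolding \<mu>_def using U finU
      by (simp add: measure_Union less_top[symmetric]) (subst measure_Union; auto simp: less_top)
    then show ?thesis by (simp add: \<mu>_def)
  qed
  define A where "A t = (\<epsilon> + e) * t + K * \<mu> t" for t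
  have "1 * dist (\<gamma> 0) (\<gamma> 1) \<le> A 1 - A 0"
  proof (rule weighted_chord_le)
    fix s :: real assume s: "0 \<le> s" "s \<le> 1"
    show "\<exists>\<delta>>0. \<forall>u v. 0 \<le> u \<and> u \<le> s \<and> s \<le> v \<and> v \<le> 1 \<and> v - u < \<delta> \<longrightarrow>
        1 * dist (\<gamma> u) (\<gamma> v) \<le> A v - A u"
    proof (cases "s \<in> N")
      case True
      then obtain \<delta> where \<delta>: "0 < \<delta>" "ball s \<delta> \<subseteq> U" using U open_contains_ball by blast
      show ?thesis
      proof (intro exI[of _ \<delta>] conjI allI impI \<delta>(1))
        fix u v assume uv: "0 \<le> u \<and> u \<le> s \<and> s \<le> v \<and> v \<le> 1 \<and> v - u < \<delta>"
        have "{u<..v} \<subseteq> ball s \<delta>" using uv by (auto simp: dist_real_def)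
        then have "U \<inter> {u<..v} = {u<..v}" using \<delta> by auto
        then have "\<mu> v - \<mu> u = v - u" using \<mu>_diff[of u v] uv by simp
        then have "K * (v - u) = K * \<mu> v - K * \<mu> u" by (metis right_diff_distrib)
        moreover have "0 \<le> (\<epsilon> + e) * (v - u)" using uv e \<epsilon> by (intro mult_nonneg_nonneg) auto
        moreover have "dist (\<gamma> u) (\<gamma> v) \<le> K * (v - u)" using lip[of u v] True uv by (auto simp: dist_norm)
        ultimately show "1 * dist (\<gamma> u) (\<gamma> v) \<le> A v - A u" by (simp add: A_def right_diff_distrib)
      qed
    next
      case False
      then have "pointwise_lipschitz \<gamma> \<epsilon> s" using pl s by auto
      from pointwise_lipschitzD[OF this e] obtain \<delta> where \<delta>: "0 < \<delta>"
        "\<And>w. norm (w - s) < \<delta> \<Longrightarrow> norm (\<gamma> w - \<gamma> s) \<le> (\<epsilon> + e) * norm (w - s)" by blast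
      show ?thesis
      proof (intro exI[of _ \<delta>] conjI allI impI \<delta>(1))
        fix u v assume uv: "0 \<le> u \<and> u \<le> s \<and> s \<le> v \<and> v \<le> 1 \<and> v - u < \<delta>"
        have "dist (\<gamma> u) (\<gamma> v) \<le> norm (\<gamma> u - \<gamma> s) + norm (\<gamma> v - \<gamma> s)"
          using norm_triangle_ineq4[of "\<gamma> u - \<gamma> s" "\<gamma> v - \<gamma> s"] by (simp add: dist_norm)
        also have "\<dots> \<le> (\<epsilon> + e) * norm (u - s) + (\<epsilon> + e) * norm (v - s)"
          using uv by (intro add_mono \<delta>(2)) auto
        also have "\<dots> = (\<epsilon> + e) * (v - u)" using uv by (simp add: algebra_simps)
        also have "\<dots> \<le> A v - A u"
        proof -
          have "0 \<le> K * (\<mu> v - \<mu> u)" using K uv \<mu>_diff[of u v] by simp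
          then show ?thesis by (simp add: A_def algebra_simps)
        qed
        finally show "1 * dist (\<gamma> u) (\<gamma> v) \<le> A v - A u" by simp
      qed
    qed
  qed auto
  also have "A 1 - A 0 = \<epsilon> + e + K * (\<mu> 1 - \<mu> 0)" by (simp add: A_def algebra_simps)
  also have "\<dots> \<le> \<epsilon> + e + K * (e / (K + 1))"
  proof -
    have "\<mu> 1 - \<mu> 0 = measure lborel (U \<inter> {0<..1})" by (rule \<mu>_diff) auto
    also have "\<dots> \<le> e / (K + 1)"
    proof -
      have "emeasure lborel (U \<inter> {0<..1}) \<le> emeasure lborel U" using U by (intro emeasure_mono) auto
      also have "\<dots> \<le> ennreal (e / (K + 1))" by (rule eU)
      finally have "ennreal (measure lborel (U \<inter> {0<..1})) \<le> ennreal (e / (K + 1))"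
        using finU[of "{0<..1}"] by (simp add: emeasure_eq_ennreal_measure less_top)
      then show ?thesis using \<open>0 < e / (K + 1)\<close> by (subst (asm) ennreal_le_iff) auto
    qed
    finally show ?thesis using K by (intro add_left_mono mult_left_mono) auto
  qed
  also have "\<dots> \<le> \<epsilon> + e + e"
  proof -
    have "K * e \<le> (K + 1) * e" using e by simp
    then have "K * (e / (K + 1)) \<le> e" using K by (simp add: field_simps)
    then show ?thesis by simp
  qed
  also have "\<dots> = \<epsilon> + e'" by (simp add: e_def)
  finally show "norm (\<gamma> 0 - \<gamma> 1) \<le> \<epsilon> + e'" by (simp add: dist_norm)
qed

lemma pointwise_lipschitz_line:
  assumes pl: "pointwise_lipschitz g \<epsilon> (x + t *\<^sub>R v)" and "v \<noteq> 0"
  shows "pointwise_lipschitz (\<lambda>s. g (x + s *\<^sub>R v)) (\<epsilon> * norm v) t"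
proof (rule pointwise_lipschitzI)
  have n: "0 < norm v" using \<open>v \<noteq> 0\<close> by simp
  fix e :: real assume "0 < e"
  then have "0 < e / norm v" using n by simp
  from pointwise_lipschitzD[OF pl this] obtain d where d: "0 < d"
    "\<And>w. norm (w - (x + t *\<^sub>R v)) < d \<Longrightarrow>
      norm (g w - g (x + t *\<^sub>R v)) \<le> (\<epsilon> + e / norm v) * norm (w - (x + t *\<^sub>R v))" by blast
  show "\<exists>d>0. \<forall>w. norm (w - t) < d \<longrightarrow>
      norm (g (x + w *\<^sub>R v) - g (x + t *\<^sub>R v)) \<le> (\<epsilon> * norm v + e) * norm (w - t)"
  proof (intro exI[of _ "d / norm v"] conjI allI impI)
    show "0 < d / norm v" using d n by simp
    fix w assume w: "norm (w - t) < d / norm v"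
    have nw: "norm ((x + w *\<^sub>R v) - (x + t *\<^sub>R v)) = norm (w - t) * norm v"
      by (simp flip: scaleR_left_diff_distrib)
    have "norm ((x + w *\<^sub>R v) - (x + t *\<^sub>R v)) < d"
      unfolding nw using w n by (simp add: pos_less_divide_eq)
    from d(2)[OF this] have "norm (g (x + w *\<^sub>R v) - g (x + t *\<^sub>R v))
        \<le> (\<epsilon> + e / norm v) * (norm (w - t) * norm v)" unfolding nw .
    also have "\<dots> = (\<epsilon> * norm v + e) * norm (w - t)" using n by (simp add: field_simps)
    finally show "norm (g (x + w *\<^sub>R v) - g (x + t *\<^sub>R v)) \<le> (\<epsilon> * norm v + e) * norm (w - t)" .
  qed
qed

lemma lipschitz_of_pointwise:
  assumes "0 \<le> C" and pl: "\<And>z. pointwise_lipschitz g C z"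
  shows "norm (g x - g y) \<le> C * norm (x - y)"
proof (cases "x = y")
  case False
  have "norm (g (x + 0 *\<^sub>R (y - x)) - g (x + 1 *\<^sub>R (y - x))) \<le> C * norm (y - x)"
    using assms False
    by (intro lipschitz_of_ae_pointwise_real[where K=0 and N="{}"] pointwise_lipschitz_line pl) auto
  then show ?thesis by (simp add: norm_minus_commute)
qed simp

lemma AE_null_set:
  assumes "AE x in M. P x"
  obtains N where "N \<in> null_sets M" "\<And>x. x \<in> space M \<Longrightarrow> x \<notin> N \<Longrightarrow> P x"
proof -
  obtain N where N: "N \<in> null_sets M" "{x \<in> space M. \<not> P x} \<subseteq> N"
    using assms unfolding eventually_ae_filter by (rule bexE)
  show ?thesis by (rule that[OF N(1)]) (use N(2) in auto)
qed

text \<open>Almost every translate of the segment from \<open>x\<close> to \<open>y\<close> meets the exceptional set in a null set of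
  parameters; arbitrarily small translations \<open>h\<close> of this kind exist.\<close>

lemma lipschitz_of_ae_pointwise:
  fixes g :: "'a::euclidean_space \<Rightarrow> 'b::real_normed_vector"
  assumes K: "0 \<le> K" and lip: "\<And>x y. norm (g x - g y) \<le> K * norm (x - y)" and \<epsilon>: "0 \<le> \<epsilon>"
    and ae: "AE z in lborel. norm z < r \<longrightarrow> pointwise_lipschitz g \<epsilon> z"
    and x: "norm x < r" and y: "norm y < r"
  shows "norm (g x - g y) \<le> \<epsilon> * norm (x - y)"
proof (cases "x = y")
  case False
  obtain N where N: "N \<in> null_sets lborel" "\<And>z. norm z < r \<Longrightarrow> z \<notin> N \<Longrightarrow> pointwise_lipschitz g \<epsilon> z"
    using ae by (rule AE_null_set) simp
  have [measurable]: "N \<in> sets borel" using N(1) by auto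
  have pair: "pair_sigma_finite (lborel :: real measure) (lborel :: 'a measure)" ..
  have "AE h in lborel. c + h \<notin> N" for c :: 'a
  proof -
    have "AE h in distr lborel borel ((+) c). h \<notin> N"
      unfolding lborel_distr_plus using N(1) by (rule AE_not_in)
    then show ?thesis by (rule AE_distrD[rotated]) simp
  qed
  from this[of "x + t *\<^sub>R (y - x)" for t]
  have "AE t in (lborel :: real measure). AE h in lborel. (x + h) + t *\<^sub>R (y - x) \<notin> N"
    by (simp add: add_ac)
  moreover have "{z \<in> space (lborel \<Otimes>\<^sub>M lborel). (x + snd z) + fst z *\<^sub>R (y - x) \<notin> N} \<in> sets ((lborel :: real measure) \<Otimes>\<^sub>M lborel)"
    by measurable
  ultimately have AE: "AE h in lborel. AE t in (lborel :: real measure). (x + h) + t *\<^sub>R (y - x) \<notin> N"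
    by (subst (asm) pair_sigma_finite.AE_commute[OF pair]) auto
  have shifted: "norm (g (x + h) - g (y + h)) \<le> \<epsilon> * norm (x - y)"
    if h: "AE t in (lborel :: real measure). (x + h) + t *\<^sub>R (y - x) \<notin> N" "norm (x + h) < r" "norm (y + h) < r" for h
  proof -
    obtain N' where N': "N' \<in> null_sets (lborel :: real measure)" "\<And>t. t \<notin> N' \<Longrightarrow> (x + h) + t *\<^sub>R (y - x) \<notin> N"
      using h(1) by (rule AE_null_set) simp
    have "norm (g ((x + h) + 0 *\<^sub>R (y - x)) - g ((x + h) + 1 *\<^sub>R (y - x))) \<le> \<epsilon> * norm (y - x)"
    proof (rule lipschitz_of_ae_pointwise_real[OF _ _ N'(1)])
      show "0 \<le> K * norm (y - x)" "0 \<le> \<epsilon> * norm (y - x)" using K \<epsilon> by auto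
      show "norm (g ((x + h) + s *\<^sub>R (y - x)) - g ((x + h) + t *\<^sub>R (y - x))) \<le> K * norm (y - x) * \<bar>s - t\<bar>" for s t
        using lip[of "(x + h) + s *\<^sub>R (y - x)" "(x + h) + t *\<^sub>R (y - x)"]
        by (simp add: mult_ac flip: scaleR_left_diff_distrib)
      fix t :: real assume t: "t \<in> {0..1}" "t \<notin> N'"
      have "(x + h) + t *\<^sub>R (y - x) = (1 - t) *\<^sub>R (x + h) + t *\<^sub>R (y + h)" by (simp add: algebra_simps)
      also have "\<dots> \<in> ball 0 r" using t h by (intro convexD[OF convex_ball]) auto
      finally have "pointwise_lipschitz g \<epsilon> ((x + h) + t *\<^sub>R (y - x))" using N(2) N'(2)[OF t(2)] by simp
      then show "pointwise_lipschitz (\<lambda>t. g ((x + h) + t *\<^sub>R (y - x))) (\<epsilon> * norm (y - x)) t"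
        by (rule pointwise_lipschitz_line) (use False in simp)
    qed
    then show ?thesis by (simp add: norm_minus_commute[of y x] add.commute)
  qed
  show ?thesis
  proof (rule field_le_epsilon)
    fix e :: real assume "0 < e"
    define \<delta> where "\<delta> = min (e / (2 * K + 1)) (min (r - norm x) (r - norm y))"
    have \<delta>: "0 < \<delta>" using \<open>0 < e\<close> K x y by (simp add: \<delta>_def)
    have "\<exists>h\<in>ball 0 \<delta>. AE t in (lborel :: real measure). (x + h) + t *\<^sub>R (y - x) \<notin> N"
    proof (rule ccontr)
      assume no: "\<not> ?thesis"
      from AE have "AE h in lborel. h \<notin> ball (0::'a) \<delta>" by eventually_elim (use no in auto)
      then have "emeasure lborel (ball (0::'a) \<delta>) = 0" by (subst (asm) AE_iff_measurable[of "ball 0 \<delta>"]) auto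
      moreover have "emeasure lborel (ball (0::'a) \<delta>) \<noteq> 0"
        using \<delta> open_not_negligible[of "ball (0::'a) \<delta>"] by (auto simp: negligible_iff_emeasure0 fmeasurableD)
      ultimately show False by simp
    qed
    then obtain h where h: "norm h < \<delta>" "AE t in (lborel :: real measure). (x + h) + t *\<^sub>R (y - x) \<notin> N" by auto
    have "norm (x + h) < r" "norm (y + h) < r"
      using norm_triangle_ineq[of x h] norm_triangle_ineq[of y h] h(1) by (auto simp: \<delta>_def)
    from shifted[OF h(2) this] have s: "norm (g (x + h) - g (y + h)) \<le> \<epsilon> * norm (x - y)" .
    have "norm (g x - g y) \<le> norm (g x - g (x + h)) + norm (g (x + h) - g (y + h)) + norm (g (y + h) - g y)"
      using dist_triangle[of "g x" "g y" "g (x + h)"] dist_triangle[of "g (x + h)" "g y" "g (y + h)"]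
      by (simp add: dist_norm)
    also have "\<dots> \<le> K * norm h + \<epsilon> * norm (x - y) + K * norm h"
      using lip[of x "x + h"] lip[of "y + h" y] s by (intro add_mono) auto
    also have "\<dots> \<le> \<epsilon> * norm (x - y) + e"
    proof -
      have "(2 * K + 1) * norm h \<le> (2 * K + 1) * (e / (2 * K + 1))"
        using h(1) K by (intro mult_left_mono) (auto simp: \<delta>_def)
      also have "\<dots> = e" using K by simp
      finally have "2 * K * norm h + norm h \<le> e" by (simp add: algebra_simps)
      then have "2 * K * norm h \<le> e" using norm_ge_zero[of h] by linarith
      then show ?thesis by simp
    qed
    finally show "norm (g x - g y) \<le> \<epsilon> * norm (x - y) + e" .
  qed
qed simp

lemma pointwise_lipschitz_scale:
  assumes hom: "\<And>z. g (c *\<^sub>R z) = c *\<^sub>R g z" and c: "0 < c"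
    and pl: "pointwise_lipschitz g \<epsilon> (c *\<^sub>R x)"
  shows "pointwise_lipschitz g \<epsilon> x"
proof (rule pointwise_lipschitzI)
  fix e :: real assume "0 < e"
  from pointwise_lipschitzD[OF pl this] obtain d where d: "0 < d"
    "\<And>w. norm (w - c *\<^sub>R x) < d \<Longrightarrow> norm (g w - g (c *\<^sub>R x)) \<le> (\<epsilon> + e) * norm (w - c *\<^sub>R x)" by blast
  show "\<exists>d>0. \<forall>w. norm (w - x) < d \<longrightarrow> norm (g w - g x) \<le> (\<epsilon> + e) * norm (w - x)"
  proof (intro exI[of _ "d / c"] conjI allI impI)
    show "0 < d / c" using d c by simp
    fix w assume "norm (w - x) < d / c"
    then have w: "c * norm (w - x) < d" using c by (simp add: field_simps)
    have n: "norm (c *\<^sub>R w - c *\<^sub>R x) = c * norm (w - x)"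
      using c by (simp flip: scaleR_right_diff_distrib)
    have n': "norm (g (c *\<^sub>R w) - g (c *\<^sub>R x)) = c * norm (g w - g x)"
      using c by (simp add: hom flip: scaleR_right_diff_distrib)
    have "c * norm (g w - g x) \<le> c * ((\<epsilon> + e) * norm (w - x))"
      using d(2)[of "c *\<^sub>R w"] w unfolding n n' by (simp add: mult_ac)
    then show "norm (g w - g x) \<le> (\<epsilon> + e) * norm (w - x)" using c by simp
  qed
qed

section \<open>Lipschitz bounds from the tangent condition\<close>

text \<open>For \<open>k \<ge> 0\<close>, the operator norm of the linear map \<open>(a, b) \<mapsto> (a + k * b, b)\<close> of the plane.\<close>

definition shear_norm :: "real \<Rightarrow> real" where
  "shear_norm k = (k + sqrt (k\<^sup>2 + 4)) / 2"

lemma shear_norm_pos: "0 \<le> k \<Longrightarrow> 0 < shear_norm k"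
  by (simp add: shear_norm_def add_nonneg_pos)

lemma shear_norm_eq: "(shear_norm k)\<^sup>2 = 1 + k * shear_norm k"
proof -
  have "(sqrt (k\<^sup>2 + 4))\<^sup>2 = k\<^sup>2 + 4" by simp
  then show ?thesis unfolding shear_norm_def power_divide power2_sum by (simp add: field_simps power2_eq_square)
qed

lemma shear_norm_bound:
  assumes "\<bar>\<kappa>\<bar> \<le> k"
  shows "(a + \<kappa> * b)\<^sup>2 + b\<^sup>2 \<le> (shear_norm k)\<^sup>2 * (a\<^sup>2 + b\<^sup>2)"
proof -
  let ?K = "shear_norm k"
  have k: "0 \<le> k" using assms by simp
  have K: "0 < ?K" by (rule shear_norm_pos[OF k])
  have KK: "?K * ?K = 1 + k * ?K" using shear_norm_eq[of k] by (simp add: power2_eq_square)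
  have "2 * \<kappa> * a * b \<le> 2 * k * (\<bar>a\<bar> * \<bar>b\<bar>)"
  proof -
    have "2 * \<kappa> * a * b \<le> \<bar>2 * \<kappa> * a * b\<bar>" by simp
    also have "\<dots> = 2 * (\<bar>\<kappa>\<bar> * (\<bar>a\<bar> * \<bar>b\<bar>))" by (simp add: abs_mult)
    also have "\<dots> \<le> 2 * (k * (\<bar>a\<bar> * \<bar>b\<bar>))" by (intro mult_left_mono mult_right_mono assms) auto
    finally show ?thesis by simp
  qed
  then have 1: "?K * (2 * \<kappa> * a * b) \<le> ?K * (2 * k * (\<bar>a\<bar> * \<bar>b\<bar>))" using K by (intro mult_left_mono) auto
  have "\<kappa>\<^sup>2 \<le> k\<^sup>2" using assms by (simp add: abs_le_square_iff[symmetric])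
  then have 2: "?K * (\<kappa>\<^sup>2 * b\<^sup>2) \<le> ?K * (k\<^sup>2 * b\<^sup>2)" using K by (intro mult_left_mono mult_right_mono) auto
  have "0 \<le> k * (?K * \<bar>a\<bar> - \<bar>b\<bar>)\<^sup>2" using k by simp
  also have "\<dots> = k * (?K * ?K) * a\<^sup>2 - ?K * (2 * k * (\<bar>a\<bar> * \<bar>b\<bar>)) + k * b\<^sup>2"
    by (simp add: power2_diff power_mult_distrib power2_eq_square[of ?K] algebra_simps)
  also have "k * b\<^sup>2 = ?K * (k * ?K) * b\<^sup>2 - ?K * (k\<^sup>2 * b\<^sup>2)"
  proof -
    have "?K * (k * ?K) = k * (?K * ?K)" by simp
    also have "\<dots> = k + ?K * k\<^sup>2" unfolding KK by (simp add: algebra_simps power2_eq_square)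
    finally show ?thesis by (simp add: algebra_simps)
  qed
  finally have "?K * (2 * \<kappa> * a * b + \<kappa>\<^sup>2 * b\<^sup>2) \<le> ?K * (k * ?K * (a\<^sup>2 + b\<^sup>2))"
    using 1 2 by (simp add: algebra_simps)
  then have "2 * \<kappa> * a * b + \<kappa>\<^sup>2 * b\<^sup>2 \<le> k * ?K * (a\<^sup>2 + b\<^sup>2)" using K by simp
  then show ?thesis unfolding shear_norm_eq by (simp add: power2_sum power_mult_distrib algebra_simps)
qed

text \<open>The component of \<open>y\<close> orthogonal to \<open>x\<close>.\<close>

definition perp :: "'a::real_inner \<Rightarrow> 'a \<Rightarrow> 'a" where
  "perp x y = y - ((x \<bullet> y) / (x \<bullet> x)) *\<^sub>R x"

lemma perp_orthogonal: "x \<bullet> perp x y = 0"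
  by (simp add: perp_def inner_diff_right)

lemma perp_scale: "perp (c *\<^sub>R x) (d *\<^sub>R y) = d *\<^sub>R perp x y" if "c \<noteq> 0"
  using that by (simp add: perp_def algebra_simps)

lemma norm_perp_decomposition:
  assumes "x \<noteq> 0"
  shows "(norm (c *\<^sub>R (x /\<^sub>R norm x) + perp x y))\<^sup>2 = c\<^sup>2 + (norm (perp x y))\<^sup>2"
proof -
  have "orthogonal (c *\<^sub>R (x /\<^sub>R norm x)) (perp x y)" by (simp add: orthogonal_def perp_orthogonal)
  from norm_add_Pythagorean[OF this]
  have "(norm (c *\<^sub>R (x /\<^sub>R norm x) + perp x y))\<^sup>2
      = (\<bar>c\<bar> * (\<bar>inverse (norm x)\<bar> * norm x))\<^sup>2 + (norm (perp x y))\<^sup>2"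
    by (simp only: norm_scaleR)
  then show ?thesis using assms by simp
qed

lemma norm_perp_sq: "(norm (perp x y))\<^sup>2 = (norm y)\<^sup>2 - (x \<bullet> y)\<^sup>2 / (norm x)\<^sup>2"
  if "x \<noteq> 0"
proof -
  have "norm (perp x y)^2 = y \<bullet> y - (x \<bullet> y)\<^sup>2 / (x \<bullet> x)"
    unfolding power2_norm_eq_inner using that
    by (simp add: perp_def inner_diff_left inner_diff_right inner_commute power2_eq_square)
  then show ?thesis by (simp add: power2_norm_eq_inner)
qed

lemma diff_perp_decomposition:
  assumes "x \<noteq> 0"
  shows "y - x = ((x \<bullet> y) / norm x - norm x) *\<^sub>R (x /\<^sub>R norm x) + perp x y"
proof -
  have "((x \<bullet> y) / norm x - norm x) * inverse (norm x) = (x \<bullet> y) / (x \<bullet> x) - 1"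
    using assms by (simp add: dot_square_norm power2_eq_square field_simps)
  then have "((x \<bullet> y) / norm x - norm x) *\<^sub>R (x /\<^sub>R norm x) = ((x \<bullet> y) / (x \<bullet> x) - 1) *\<^sub>R x"
    by simp
  then show ?thesis by (simp add: perp_def scaleR_left_diff_distrib)
qed

lemma eventually_at_nonzero:
  fixes x :: "'a::real_normed_vector"
  assumes "x \<noteq> 0" shows "\<forall>\<^sub>F y in at x. y \<noteq> 0"
  using assms by (auto simp: eventually_at dist_norm intro!: exI[of _ "norm x"])

context radial_function begin

text \<open>The hypothesis \<open>H\<close> says that the tangential derivative of \<open>ln \<rho>\<close> on the unit sphere is bounded by
  \<open>k0\<close>.  In an orthonormal frame whose first vector is the direction of \<open>x\<close>, the map
  \<open>x \<mapsto> \<rho> x *\<^sub>R x\<close> then acts near \<open>x\<close> as \<open>\<rho> x\<close> times a shear by at most \<open>k0\<close>.\<close>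

lemma pointwise_stretch:
  assumes x: "x \<noteq> 0" and k0: "0 \<le> k0" and C: "\<rho> x * shear_norm k0 < C"
    and H: "\<And>k. k0 < k \<Longrightarrow> \<forall>\<^sub>F y in at x. \<bar>\<rho> y - \<rho> x\<bar> * norm y \<le> k * \<rho> x * norm (perp x y)"
  shows "\<forall>\<^sub>F y in at x. norm (\<rho> y *\<^sub>R y - \<rho> x *\<^sub>R x) \<le> C * norm (y - x)"
proof -
  let ?e = "x /\<^sub>R norm x"
  have rx: "0 < \<rho> x" by (rule pos[OF x])
  obtain k where k: "k0 < k" "\<rho> x * (shear_norm k + k * (k - k0)) < C"
  proof -
    have "((\<lambda>k. \<rho> x * ((k + sqrt (k\<^sup>2 + 4)) / 2 + k * (k - k0))) \<longlongrightarrow>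
        \<rho> x * ((k0 + sqrt (k0\<^sup>2 + 4)) / 2 + k0 * (k0 - k0))) (at_right k0)"
      by (intro tendsto_intros) auto
    then have "\<forall>\<^sub>F k in at_right k0. \<rho> x * (shear_norm k + k * (k - k0)) < C"
      using C unfolding shear_norm_def[symmetric] by (intro order_tendstoD(2)[of _ "\<rho> x * shear_norm k0"]) auto
    moreover have "\<forall>\<^sub>F k in at_right k0. k0 < k" by (rule eventually_at_right_less)
    ultimately have "\<forall>\<^sub>F k in at_right k0. k0 < k \<and> \<rho> x * (shear_norm k + k * (k - k0)) < C"
      by eventually_elim auto
    then show ?thesis using that eventually_happens trivial_limit_at_right_real by blast
  qed
  have "((\<lambda>y. y /\<^sub>R norm y) \<longlongrightarrow> ?e) (at x)"
    using x by (intro tendsto_intros) auto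
  then have dir: "\<forall>\<^sub>F y in at x. dist (y /\<^sub>R norm y) ?e < k - k0"
    using k by (intro tendstoD) auto
  note nz = eventually_at_nonzero[OF x]
  show ?thesis using H[OF k(1)] dir nz
  proof eventually_elim
    case (elim y)
    \<comment> \<open>\<open>a\<close> and \<open>b\<close> are the radial and the tangential part of \<open>y - x\<close>; \<open>\<kappa>\<close> is the slope of the shear.\<close>
    define b where "b = norm (perp x y)"
    define a where "a = (x \<bullet> y) / norm x - norm x"
    define \<kappa> where "\<kappa> = (if b = 0 then 0 else (\<rho> y - \<rho> x) * norm y / (\<rho> x * b))"
    have b0: "0 \<le> b" by (simp add: b_def)
    have z: "\<rho> y = \<rho> x" if "b = 0"
      using elim(1,3) that by (simp add: b_def[symmetric] mult_le_0_iff)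
    have \<kappa>: "\<bar>\<kappa>\<bar> \<le> k" and eq: "(\<rho> y - \<rho> x) * norm y = \<kappa> * \<rho> x * b"
      using elim(1) z rx b0 k k0 by (auto simp: \<kappa>_def b_def[symmetric] abs_mult divide_simps mult_ac)
    have yx: "y - x = a *\<^sub>R ?e + perp x y" unfolding a_def by (rule diff_perp_decomposition[OF x])
    have n: "(norm (y - x))\<^sup>2 = a\<^sup>2 + b\<^sup>2" unfolding yx b_def by (rule norm_perp_decomposition[OF x])
    have "(norm ((a + \<kappa> * b) *\<^sub>R ?e + perp x y))\<^sup>2 = (a + \<kappa> * b)\<^sup>2 + b\<^sup>2"
      unfolding b_def by (rule norm_perp_decomposition[OF x])
    also have "\<dots> \<le> (shear_norm k * norm (y - x))\<^sup>2"
      unfolding power_mult_distrib n by (rule shear_norm_bound[OF \<kappa>])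
    finally have 1: "norm ((a + \<kappa> * b) *\<^sub>R ?e + perp x y) \<le> shear_norm k * norm (y - x)"
      by (rule power2_le_imp_le) (use k k0 shear_norm_pos[of k] in auto)
    have "b\<^sup>2 \<le> (norm (y - x))\<^sup>2" unfolding n by simp
    then have b_le: "b \<le> norm (y - x)" by (rule power2_le_imp_le) simp
    have "((\<rho> y - \<rho> x) * norm y) *\<^sub>R (y /\<^sub>R norm y) = (\<rho> y - \<rho> x) *\<^sub>R y"
      using elim(3) by simp
    then have "\<rho> y *\<^sub>R y - \<rho> x *\<^sub>R x = \<rho> x *\<^sub>R (y - x) + ((\<rho> y - \<rho> x) * norm y) *\<^sub>R (y /\<^sub>R norm y)"
      by (simp only:) (simp add: algebra_simps)
    also have "\<dots> = \<rho> x *\<^sub>R (((a + \<kappa> * b) *\<^sub>R ?e + perp x y) + (\<kappa> * b) *\<^sub>R (y /\<^sub>R norm y - ?e))"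
      unfolding eq yx by (simp add: algebra_simps)
    finally have "norm (\<rho> y *\<^sub>R y - \<rho> x *\<^sub>R x)
        = \<rho> x * norm (((a + \<kappa> * b) *\<^sub>R ?e + perp x y) + (\<kappa> * b) *\<^sub>R (y /\<^sub>R norm y - ?e))"
      using rx by simp
    also have "\<dots> \<le> \<rho> x * (shear_norm k * norm (y - x) + k * norm (y - x) * (k - k0))"
    proof (intro mult_left_mono)
      have "norm ((\<kappa> * b) *\<^sub>R (y /\<^sub>R norm y - ?e)) = (\<bar>\<kappa>\<bar> * b) * dist (y /\<^sub>R norm y) ?e"
        using b0 by (simp add: dist_norm abs_mult)
      also have "\<dots> \<le> (k * norm (y - x)) * (k - k0)"
        using \<kappa> b_le elim(2) b0 k k0 by (intro mult_mono) auto
      finally show "norm (((a + \<kappa> * b) *\<^sub>R ?e + perp x y) + (\<kappa> * b) *\<^sub>R (y /\<^sub>R norm y - ?e))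
          \<le> shear_norm k * norm (y - x) + k * norm (y - x) * (k - k0)"
        using 1 by (intro norm_triangle_le) simp
    qed (use rx in auto)
    also have "\<dots> = \<rho> x * (shear_norm k + k * (k - k0)) * norm (y - x)" by (simp add: algebra_simps)
    also have "\<dots> \<le> C * norm (y - x)" using k by (intro mult_right_mono) auto
    finally show ?case .
  qed
qed

lemma stretch_lipschitz:
  assumes k0: "0 \<le> k0" and R: "\<And>x. x \<noteq> 0 \<Longrightarrow> \<rho> x \<le> R"
    and H: "\<And>x k. x \<noteq> 0 \<Longrightarrow> k0 < k \<Longrightarrow> \<forall>\<^sub>F y in at x. \<bar>\<rho> y - \<rho> x\<bar> * norm y \<le> k * \<rho> x * norm (perp x y)"
  shows "norm (\<rho> x *\<^sub>R x - \<rho> y *\<^sub>R y) \<le> R * shear_norm k0 * norm (x - y)"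
proof (rule lipschitz_of_pointwise)
  have S: "0 < shear_norm k0" by (rule shear_norm_pos[OF k0])
  obtain b :: 'a where "b \<in> Basis" using nonempty_Basis by blast
  then have "b \<noteq> 0" by auto
  then have "0 < \<rho> b" "\<rho> b \<le> R" using pos R by auto
  then show "0 \<le> R * shear_norm k0" using S by simp
  show "pointwise_lipschitz (\<lambda>x. \<rho> x *\<^sub>R x) (R * shear_norm k0) z" for z
    unfolding pointwise_lipschitz_def
  proof (intro allI impI)
    fix e :: real assume e: "0 < e"
    show "\<forall>\<^sub>F w in at z. norm (\<rho> w *\<^sub>R w - \<rho> z *\<^sub>R z) \<le> (R * shear_norm k0 + e) * norm (w - z)"
    proof (cases "z = 0")
      case False
      have "\<rho> z * shear_norm k0 \<le> R * shear_norm k0" using S R[OF False] by (intro mult_right_mono) auto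
      then show ?thesis using e by (intro pointwise_stretch[OF False k0 _ H[OF False]]) auto
    next
      case True
      have S1: "1 \<le> shear_norm k0"
      proof -
        have "2 \<le> sqrt (k0\<^sup>2 + 4)" by (rule real_le_rsqrt) simp
        then show ?thesis using k0 by (simp add: shear_norm_def)
      qed
      have "norm (\<rho> w *\<^sub>R w) \<le> (R * shear_norm k0 + e) * norm w" for w
      proof (cases "w = 0")
        case False
        have "\<rho> w \<le> R" "0 < \<rho> w" using R pos False by auto
        moreover from this have "R * 1 \<le> R * shear_norm k0" using S1 by (intro mult_left_mono) auto
        ultimately have "\<rho> w \<le> R * shear_norm k0 + e" using e by linarith
        then show ?thesis using \<open>0 < \<rho> w\<close> by (auto intro: mult_right_mono)
      qed simp
      then show ?thesis using True by simp
    qed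
  qed
qed

end

context starlike_surface begin

lemma isCont_radial_point: "x \<noteq> 0 \<Longrightarrow> isCont (radial_point M) x"
  using radial_point_continuous by (auto simp: continuous_on_eq_continuous_at open_Compl)

text \<open>With \<open>w\<close> and \<open>z\<close> the points of \<open>M\<close> in the directions of \<open>x\<close> and \<open>y\<close>, an angle of more than \<open>\<beta>\<close>
  between \<open>z - w\<close> and \<open>w\<close> means that the component of \<open>z - w\<close> along \<open>w\<close> is at most \<open>cot \<beta>\<close>
  times the orthogonal one.  The conclusion states this in terms of \<open>\<rho>\<close>.\<close>

lemma chord_slope:
  assumes x: "x \<noteq> 0" and y: "y \<noteq> 0" and b: "0 < \<beta>" "\<beta> < pi / 2"
    and angle: "radial_point M y \<noteq> radial_point M x \<Longrightarrow> \<beta> < tangent_angle (radial_point M y) (radial_point M x)"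
  shows "\<bar>\<rho> y * ((x \<bullet> y) / (norm x * norm y)) - \<rho> x\<bar> \<le> cot \<beta> * (\<rho> y / norm y * norm (perp x y))"
proof (cases "radial_point M y = radial_point M x")
  case True
  have "(\<rho> y / norm y) *\<^sub>R y = (\<rho> x / norm x) *\<^sub>R x"
    using True radial_point_eq[OF x] radial_point_eq[OF y] by metis
  then have "inverse (\<rho> y / norm y) *\<^sub>R ((\<rho> y / norm y) *\<^sub>R y) = inverse (\<rho> y / norm y) *\<^sub>R ((\<rho> x / norm x) *\<^sub>R x)"
    by simp
  then obtain d where d: "y = d *\<^sub>R x" "0 < d"
    using rho_pos[OF x] rho_pos[OF y] x y by (auto simp: field_simps intro!: that)
  have c1: "(x \<bullet> y) / (norm x * norm y) = 1" using d x by (simp add: dot_square_norm power2_eq_square)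
  have "0 \<le> cot \<beta>" using b by (auto simp: cot_def intro!: divide_nonneg_nonneg sin_ge_zero cos_ge_zero)
  then have "0 \<le> cot \<beta> * (\<rho> y / norm y * norm (perp x y))" by (intro mult_nonneg_nonneg) auto
  then show ?thesis unfolding c1 using True by simp
next
  case False
  define z w where "z = radial_point M y" and "w = radial_point M x"
  define p where "p = (z - w) \<bullet> w / norm w"
  have w0: "norm w > 0" using rho_pos[OF x] by (simp add: w_def)
  have zw: "norm (z - w) > 0" using False by (simp add: z_def w_def)
  define r where "r = \<bar>(z - w) \<bullet> w\<bar> / (norm (z - w) * norm w)"
  have r: "0 \<le> r" "r \<le> 1"
    using Cauchy_Schwarz_ineq2[of "z - w" w] zw w0 by (auto simp: r_def)
  have "\<beta> < arccos r" using angle[OF False] by (simp add: tangent_angle_def z_def w_def r_def)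
  then have "cos (arccos r) < cos \<beta>" using b r by (intro cos_monotone_0_pi) (auto intro: arccos_ubound)
  then have rc: "r < cos \<beta>" using r by (simp add: cos_arccos_abs)
  have pr: "\<bar>p\<bar> = r * norm (z - w)" using zw w0 by (simp add: p_def r_def abs_divide)
  define q where "q = norm (perp w z)"
  have "z - w = (w \<bullet> z / norm w - norm w) *\<^sub>R (w /\<^sub>R norm w) + perp w z"
    by (rule diff_perp_decomposition) (use w0 in auto)
  moreover have "w \<bullet> z / norm w - norm w = p"
  proof -
    have "(z - w) \<bullet> w = w \<bullet> z - norm w * norm w"
      by (simp add: inner_diff_left inner_commute[of z w] dot_square_norm power2_eq_square)
    then show ?thesis using w0 by (simp add: p_def field_simps)
  qed
  ultimately have n: "(norm (z - w))\<^sup>2 = p\<^sup>2 + q\<^sup>2"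
    using norm_perp_decomposition[of w p z] w0 by (auto simp: q_def)
  have s: "0 < sin \<beta>" "0 < cos \<beta>" using b by (auto intro: sin_gt_zero cos_gt_zero)
  have "p\<^sup>2 = (r * norm (z - w))\<^sup>2" using pr by (metis power2_abs)
  also have "\<dots> \<le> (cos \<beta> * norm (z - w))\<^sup>2" using r rc by (intro power_mono mult_right_mono) auto
  also have "\<dots> = (cos \<beta>)\<^sup>2 * (p\<^sup>2 + q\<^sup>2)" by (simp add: power_mult_distrib n)
  finally have "(1 - (cos \<beta>)\<^sup>2) * p\<^sup>2 \<le> (cos \<beta>)\<^sup>2 * q\<^sup>2" by (simp add: algebra_simps)
  then have "(sin \<beta> * \<bar>p\<bar>)\<^sup>2 \<le> (cos \<beta> * q)\<^sup>2" by (simp add: power_mult_distrib sin_squared_eq)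
  then have "sin \<beta> * \<bar>p\<bar> \<le> cos \<beta> * q" using s by (intro power2_le_imp_le[of "sin \<beta> * \<bar>p\<bar>"]) (auto simp: q_def)
  then have pq: "\<bar>p\<bar> \<le> cot \<beta> * q" using s by (simp add: cot_def field_simps)
  have wx: "w = (\<rho> x / norm x) *\<^sub>R x" "z = (\<rho> y / norm y) *\<^sub>R y"
    using radial_point_eq x y by (auto simp: w_def z_def)
  have "q = \<rho> y / norm y * norm (perp x y)"
    unfolding q_def wx using rho_pos[OF x] x by (subst perp_scale) auto
  moreover have "p = \<rho> y * ((x \<bullet> y) / (norm x * norm y)) - \<rho> x"
  proof -
    have "p = (z \<bullet> w) / norm w - norm w"
      using w0 by (simp add: p_def inner_diff_left dot_square_norm power2_eq_square field_simps)
    also have "z \<bullet> w = (\<rho> y / norm y) * (\<rho> x / norm x) * (x \<bullet> y)"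
      unfolding wx by (simp add: inner_commute)
    also have "norm w = \<rho> x" by (simp add: w_def)
    finally show ?thesis using rho_pos[OF x] by (simp add: field_simps)
  qed
  ultimately show ?thesis using pq by simp
qed

text \<open>The tangent condition bounds the tangential derivative of \<open>ln \<rho>\<close> by \<open>cot \<alpha>\<close>.  The passage from
  \<open>\<rho> y * c\<close> in \<open>chord_slope\<close> to \<open>\<rho> y\<close>, where \<open>c\<close> is the cosine of the angle between \<open>x\<close> and \<open>y\<close>,
  costs \<open>1 - c\<close>, which is small compared with the sine \<open>S\<close> of that angle.\<close>

lemma tangential_slope:
  assumes tc: "tangent_condition M \<alpha>" and \<alpha>: "0 < \<alpha>" "\<alpha> \<le> pi / 2" and x: "x \<noteq> 0" and k: "cot \<alpha> < k"
  shows "\<forall>\<^sub>F y in at x. \<bar>\<rho> y - \<rho> x\<bar> * norm y \<le> k * \<rho> x * norm (perp x y)"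
proof -
  let ?w = "radial_point M x"
  have rx: "0 < \<rho> x" by (rule rho_pos[OF x])
  note isC = isCont_radial_point[OF x]
  note nz = eventually_at_nonzero[OF x]
  obtain \<beta> where \<beta>: "0 < \<beta>" "\<beta> < \<alpha>" "cot \<beta> < k"
  proof -
    have "sin \<alpha> \<noteq> 0" using \<alpha> sin_gt_zero[of \<alpha>] pi_gt_zero by auto
    then have "(cot \<longlongrightarrow> cot \<alpha>) (at_left \<alpha>)" by (intro tendsto_intros tendsto_cot) auto
    then have "\<forall>\<^sub>F b in at_left \<alpha>. cot b < k" using k by (rule order_tendstoD(2))
    moreover have "\<forall>\<^sub>F b in at_left \<alpha>. b \<in> {0<..<\<alpha>}" using \<alpha> by (intro eventually_at_left_real)
    ultimately have "\<forall>\<^sub>F b in at_left \<alpha>. 0 < b \<and> b < \<alpha> \<and> cot b < k" by eventually_elim auto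
    then show ?thesis using that eventually_happens trivial_limit_at_left_real by blast
  qed
  have b2: "\<beta> < pi / 2" using \<beta> \<alpha> by simp
  have "ereal \<alpha> \<le> Liminf (at ?w within M) (\<lambda>z. ereal (tangent_angle z ?w))"
    using tc radial_point(1)[OF x] by (auto simp: tangent_condition_def)
  from this[unfolded le_Liminf_iff, rule_format, of "ereal \<beta>"]
  have "\<forall>\<^sub>F z in at ?w within M. \<beta> < tangent_angle z ?w" using \<beta> by simp
  then obtain d where d: "0 < d" "\<And>z. z \<in> M \<Longrightarrow> z \<noteq> ?w \<Longrightarrow> dist z ?w < d \<Longrightarrow> \<beta> < tangent_angle z ?w"
    by (auto simp: eventually_at)
  have "\<forall>\<^sub>F y in at x. dist (radial_point M y) ?w < d"
    using isC d(1) by (auto simp: isCont_def intro: tendstoD)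
  then have slope: "\<forall>\<^sub>F y in at x. \<bar>\<rho> y * ((x \<bullet> y) / (norm x * norm y)) - \<rho> x\<bar> \<le> cot \<beta> * (\<rho> y / norm y * norm (perp x y))"
    using nz
  proof eventually_elim
    case (elim y)
    then show ?case using d(2) radial_point(1)[of y] by (intro chord_slope x \<beta>(1) b2) auto
  qed
  obtain \<eta> where \<eta>: "0 < \<eta>" "cot \<beta> + \<eta> < k" using \<beta>(3) by (metis add.commute dense less_diff_eq diff_gt_0_iff_gt)
  have c1: "((\<lambda>y. (x \<bullet> y) / (norm x * norm y)) \<longlongrightarrow> (x \<bullet> x) / (norm x * norm x)) (at x)"
    using x by (intro tendsto_intros) auto
  have cx: "(x \<bullet> x) / (norm x * norm x) = 1" using x by (simp add: dot_square_norm power2_eq_square)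
  have "((\<lambda>y. \<eta>\<^sup>2 * (1 + (x \<bullet> y) / (norm x * norm y)) - (1 - (x \<bullet> y) / (norm x * norm y))) \<longlongrightarrow> \<eta>\<^sup>2 * (1 + 1) - (1 - 1)) (at x)"
    using c1 unfolding cx by (intro tendsto_intros)
  then have cosb: "\<forall>\<^sub>F y in at x. 0 < \<eta>\<^sup>2 * (1 + (x \<bullet> y) / (norm x * norm y)) - (1 - (x \<bullet> y) / (norm x * norm y))"
    by (rule order_tendstoD(1)) (use \<eta> in auto)
  have "((\<lambda>y. \<rho> y * (cot \<beta> + \<eta>)) \<longlongrightarrow> \<rho> x * (cot \<beta> + \<eta>)) (at x)"
    using isC by (intro tendsto_intros) (auto simp: isCont_def)
  then have ratio: "\<forall>\<^sub>F y in at x. \<rho> y * (cot \<beta> + \<eta>) < k * \<rho> x"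
    using rx \<eta> by (intro order_tendstoD(2)) (auto simp: mult.commute)
  show ?thesis using slope cosb ratio nz
  proof eventually_elim
    case (elim y)
    define c where "c = (x \<bullet> y) / (norm x * norm y)"
    define S where "S = norm (perp x y) / norm y"
    have y: "0 < norm y" using elim by simp
    have ry: "0 < \<rho> y" using elim rho_pos by auto
    have c_le: "c \<le> 1" using Cauchy_Schwarz_ineq2[of x y] x y
      by (auto simp: c_def divide_le_eq intro: order_trans[OF abs_ge_self])
    have "S\<^sup>2 = 1 - c\<^sup>2" using y x norm_perp_sq[OF x, of y]
      by (simp add: S_def c_def power_divide field_simps)
    also have "\<dots> = (1 - c) * (1 + c)" by (simp add: algebra_simps power2_eq_square)
    finally have S2: "S\<^sup>2 = (1 - c) * (1 + c)" .
    have "(1 - c)\<^sup>2 = (1 - c) * (1 - c)" by (simp add: power2_eq_square)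
    also have "\<dots> \<le> (1 - c) * (\<eta>\<^sup>2 * (1 + c))" using elim(2) c_le by (intro mult_left_mono) (auto simp: c_def)
    also have "\<dots> = (\<eta> * S)\<^sup>2" by (simp add: power_mult_distrib S2)
    finally have cS: "1 - c \<le> \<eta> * S" by (rule power2_le_imp_le) (use \<eta> in \<open>auto simp: S_def\<close>)
    have "\<bar>\<rho> y - \<rho> x\<bar> \<le> \<rho> y * (1 - c) + \<bar>\<rho> y * c - \<rho> x\<bar>"
    proof -
      have "\<rho> y - \<rho> x = \<rho> y * (1 - c) + (\<rho> y * c - \<rho> x)" by (simp add: algebra_simps)
      then have "\<bar>\<rho> y - \<rho> x\<bar> \<le> \<bar>\<rho> y * (1 - c)\<bar> + \<bar>\<rho> y * c - \<rho> x\<bar>" by (metis abs_triangle_ineq)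
      then show ?thesis using c_le by (simp add: abs_mult)
    qed
    also have "\<dots> \<le> \<rho> y * (\<eta> * S) + cot \<beta> * (\<rho> y * S)"
      using cS elim(1) ry by (intro add_mono mult_left_mono) (auto simp: c_def S_def)
    also have "\<dots> = (\<rho> y * (cot \<beta> + \<eta>)) * S" by (simp add: algebra_simps)
    also have "\<dots> \<le> (k * \<rho> x) * S" using elim(3) by (intro mult_right_mono) (auto simp: S_def)
    finally have "\<bar>\<rho> y - \<rho> x\<bar> * norm y \<le> (k * \<rho> x) * S * norm y" by (intro mult_right_mono) auto
    then show ?case using y by (simp add: S_def)
  qed
qed

lemma inverse_tangential_slope:
  assumes tc: "tangent_condition M \<alpha>" and \<alpha>: "0 < \<alpha>" "\<alpha> \<le> pi / 2" and x: "x \<noteq> 0" and k: "cot \<alpha> < k"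
  shows "\<forall>\<^sub>F y in at x. \<bar>1 / \<rho> y - 1 / \<rho> x\<bar> * norm y \<le> k * (1 / \<rho> x) * norm (perp x y)"
proof -
  have rx: "0 < \<rho> x" by (rule rho_pos[OF x])
  obtain k' where k': "cot \<alpha> < k'" "k' < k" using dense[OF k] by blast
  note isC = isCont_radial_point[OF x]
  note nz = eventually_at_nonzero[OF x]
  have "((\<lambda>y. k * \<rho> y - k' * \<rho> x) \<longlongrightarrow> k * \<rho> x - k' * \<rho> x) (at x)"
    using isC by (intro tendsto_intros) (auto simp: isCont_def)
  then have ratio: "\<forall>\<^sub>F y in at x. 0 < k * \<rho> y - k' * \<rho> x"
    using rx k' by (intro order_tendstoD(1)) auto
  show ?thesis using tangential_slope[OF tc \<alpha> x k'(1)] ratio nz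
  proof eventually_elim
    case (elim y)
    have ry: "0 < \<rho> y" using elim rho_pos by auto
    have "\<bar>1 / \<rho> y - 1 / \<rho> x\<bar> = \<bar>\<rho> y - \<rho> x\<bar> / (\<rho> x * \<rho> y)"
      using rx ry by (simp add: divide_simps abs_divide abs_minus_commute abs_mult)
    then have "\<bar>1 / \<rho> y - 1 / \<rho> x\<bar> * norm y = (\<bar>\<rho> y - \<rho> x\<bar> * norm y) / (\<rho> x * \<rho> y)" by simp
    also have "\<dots> \<le> (k' * \<rho> x * norm (perp x y)) / (\<rho> x * \<rho> y)"
      using elim(1) rx ry by (intro divide_right_mono) auto
    also have "\<dots> \<le> (k * \<rho> y * norm (perp x y)) / (\<rho> x * \<rho> y)"
      using elim(2) rx ry by (intro divide_right_mono mult_right_mono) auto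
    also have "\<dots> = k * (1 / \<rho> x) * norm (perp x y)" using ry by simp
    finally show ?case .
  qed
qed

lemma rho_bounds:
  assumes "x \<noteq> 0"
  shows "\<rho> x \<le> (SUP w\<in>M. norm w)" and "(INF w\<in>M. norm w) \<le> \<rho> x" and "0 < (INF w\<in>M. norm w)"
proof -
  have "compact (norm ` M)" using compact_M by (intro compact_continuous_image continuous_intros)
  then have bdd: "bdd_above (norm ` M)" "bdd_below (norm ` M)"
    by (auto intro: bounded_imp_bdd_above bounded_imp_bdd_below compact_imp_bounded)
  show "\<rho> x \<le> (SUP w\<in>M. norm w)" "(INF w\<in>M. norm w) \<le> \<rho> x"
    using radial_point(1)[OF assms] by (auto intro!: cSUP_upper cINF_lower bdd)
  have "M \<noteq> {}" using radial_point(1)[OF assms] by auto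
  then obtain w where "w \<in> M" "\<And>v. v \<in> M \<Longrightarrow> norm w \<le> norm v"
    using continuous_attains_inf[OF compact_M, of norm] by (auto intro: continuous_intros)
  then have "0 < norm w" "norm w \<le> (INF w\<in>M. norm w)"
    using zero_notin \<open>M \<noteq> {}\<close> by (auto intro!: cINF_greatest)
  then show "0 < (INF w\<in>M. norm w)" by (rule less_le_trans)
qed

lemma tangent_bilipschitz:
  fixes L :: real
  assumes tc: "tangent_condition M \<alpha>" and \<alpha>: "0 < \<alpha>" "\<alpha> \<le> pi / 2"
    and L: "L = max ((SUP w\<in>M. norm w) / 2) (1 / (2 * (INF w\<in>M. norm w))) *
                  (sqrt ((1 / sin \<alpha>)\<^sup>2 - 1) + sqrt ((1 / sin \<alpha>)\<^sup>2 + 3))"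
  shows "bilipschitz_radial_function \<rho> L"
proof -
  interpret R: radial_function \<rho> by (rule radial_function)
  interpret I: radial_function "\<lambda>x. 1 / \<rho> x"
    using R.pos R.hom R.cont by unfold_locales (auto intro!: continuous_on_divide continuous_on_const)
  define rmax rmin where "rmax = (SUP w\<in>M. norm w)" and "rmin = (INF w\<in>M. norm w)"
  have s: "0 < sin \<alpha>" using \<alpha> pi_gt_zero by (intro sin_gt_zero) auto
  have c: "0 \<le> cos \<alpha>" using \<alpha> by (intro cos_ge_zero) auto
  have k0: "0 \<le> cot \<alpha>" using s c by (simp add: cot_def)
  have sq: "(1 / sin \<alpha>)\<^sup>2 - 1 = (cot \<alpha>)\<^sup>2"
    using s by (simp add: cot_def power_divide cos_squared_eq field_simps)
  have "sqrt ((1 / sin \<alpha>)\<^sup>2 - 1) + sqrt ((1 / sin \<alpha>)\<^sup>2 + 3) = 2 * shear_norm (cot \<alpha>)"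
  proof -
    have "(1 / sin \<alpha>)\<^sup>2 + 3 = (cot \<alpha>)\<^sup>2 + 4" using sq by simp
    then show ?thesis unfolding sq shear_norm_def using k0 by simp
  qed
  then have L': "L = max rmax (1 / rmin) * shear_norm (cot \<alpha>)"
    unfolding L rmax_def[symmetric] rmin_def[symmetric] by (simp add: max_def field_simps)
  have sn: "0 < shear_norm (cot \<alpha>)" by (rule shear_norm_pos[OF k0])
  show ?thesis
  proof
    fix x y :: 'a
    have "norm (\<rho> x *\<^sub>R x - \<rho> y *\<^sub>R y) \<le> rmax * shear_norm (cot \<alpha>) * norm (x - y)"
      using rho_bounds(1) tangential_slope[OF tc \<alpha>] unfolding rmax_def
      by (intro R.stretch_lipschitz k0) auto
    also have "\<dots> \<le> L * norm (x - y)" unfolding L' using sn by (intro mult_right_mono) auto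
    finally show "norm (\<rho> x *\<^sub>R x - \<rho> y *\<^sub>R y) \<le> L * norm (x - y)" .
    have "1 / \<rho> z \<le> 1 / rmin" if "z \<noteq> 0" for z
      using rho_bounds(2,3)[OF that] rho_pos[OF that] unfolding rmin_def by (intro divide_left_mono) auto
    then have "norm ((1 / \<rho> x) *\<^sub>R x - (1 / \<rho> y) *\<^sub>R y) \<le> 1 / rmin * shear_norm (cot \<alpha>) * norm (x - y)"
      using inverse_tangential_slope[OF tc \<alpha>] by (intro I.stretch_lipschitz k0) auto
    also have "\<dots> \<le> L * norm (x - y)" unfolding L' using sn by (intro mult_right_mono) auto
    finally show "norm ((1 / \<rho> x) *\<^sub>R x - (1 / \<rho> y) *\<^sub>R y) \<le> L * norm (x - y)" .
  qed
qed

end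

section \<open>Smooth convergence\<close>

lemma AE_sphere_measureD:
  assumes "AE u in (sphere_measure :: 'a::euclidean_space measure). P u"
  shows "AE x in lborel. x \<in> cball 0 1 - {0::'a} \<longrightarrow> P (x /\<^sub>R norm x)"
proof -
  let ?R = "restrict_space lborel (cball 0 1 - {0::'a})" and ?S = "restrict_space borel (sphere 0 (1::real)) :: 'a measure"
  let ?f = "\<lambda>x::'a. x /\<^sub>R norm x"
  have f: "?f \<in> measurable ?R ?S"
  proof (rule measurable_restrict_space2)
    show "?f \<in> space ?R \<rightarrow> sphere 0 1" by (auto simp: space_restrict_space)
    show "?f \<in> borel_measurable ?R" by (rule measurable_restrict_space1) measurable
  qed
  obtain N where N: "N \<in> null_sets (sphere_measure :: 'a measure)"
    "\<And>u. u \<in> space sphere_measure \<Longrightarrow> u \<notin> N \<Longrightarrow> P u"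
    by (rule AE_null_set[OF assms]) blast
  have "N \<in> null_sets (distr ?R ?S ?f)"
  proof (rule null_setsI)
    have "N \<in> sets sphere_measure" "emeasure sphere_measure N = 0" using N(1) by auto
    then show "N \<in> sets (distr ?R ?S ?f)" "emeasure (distr ?R ?S ?f) N = 0"
      by (auto simp: sphere_measure_def)
  qed
  then have "AE u in distr ?R ?S ?f. u \<in> space sphere_measure \<longrightarrow> P u"
    using N(2) by (auto simp: eventually_ae_filter)
  from AE_distrD[OF f this] have "AE x in ?R. ?f x \<in> space sphere_measure \<longrightarrow> P (?f x)" .
  then have "AE x in lborel. x \<in> cball 0 1 - {0} \<longrightarrow> ?f x \<in> space sphere_measure \<longrightarrow> P (?f x)"
    by (subst (asm) AE_restrict_space_iff) auto
  then show ?thesis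
    by eventually_elim (auto simp: sphere_measure_def space_scale_measure space_restrict_space)
qed

lemma derivative_deviation_pointwise_lipschitz:
  fixes \<phi> :: "'a::euclidean_space \<Rightarrow> 'a"
  assumes "derivative_deviation \<phi> r x \<le> ereal \<epsilon>"
  shows "pointwise_lipschitz (\<lambda>y. \<phi> y - r *\<^sub>R y) \<epsilon> x"
proof -
  have diff: "\<phi> differentiable (at x)"
    using assms by (auto simp: derivative_deviation_def split: if_splits)
  let ?D = "frechet_derivative \<phi> (at x)"
  let ?g = "\<lambda>y. \<phi> y - r *\<^sub>R y" and ?g' = "\<lambda>h. ?D h - r *\<^sub>R h"
  have on: "onorm ?g' \<le> \<epsilon>" using assms diff by (simp add: derivative_deviation_def)
  have "(\<phi> has_derivative ?D) (at x)" using diff by (simp add: frechet_derivative_works)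
  then have der: "(?g has_derivative ?g') (at x)" by (auto intro!: derivative_eq_intros)
  have bl: "bounded_linear ?g'" by (rule has_derivative_bounded_linear[OF der])
  show ?thesis
  proof (rule pointwise_lipschitzI)
    fix e :: real assume "0 < e"
    then obtain d where d: "0 < d"
      "\<And>w. norm (w - x) < d \<Longrightarrow> norm (?g w - ?g x - ?g' (w - x)) \<le> e * norm (w - x)"
      using der unfolding has_derivative_at_alt by blast
    have "norm (?g w - ?g x) \<le> (\<epsilon> + e) * norm (w - x)" if "norm (w - x) < d" for w
    proof -
      have "norm (?g w - ?g x) \<le> norm (?g w - ?g x - ?g' (w - x)) + norm (?g' (w - x))"
        by (metis diff_add_cancel norm_triangle_ineq)
      also have "\<dots> \<le> e * norm (w - x) + onorm ?g' * norm (w - x)"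
        by (intro add_mono d(2) that onorm[OF bl])
      also have "\<dots> \<le> e * norm (w - x) + \<epsilon> * norm (w - x)" using on by (intro add_left_mono mult_right_mono) auto
      finally show ?thesis by (simp add: algebra_simps)
    qed
    then show "\<exists>d>0. \<forall>w. norm (w - x) < d \<longrightarrow> norm (?g w - ?g x) \<le> (\<epsilon> + e) * norm (w - x)"
      using d(1) by blast
  qed
qed

context starlike_surface begin

text \<open>The a priori constant \<open>L\<close> only serves to make \<open>x \<mapsto> \<rho> x *\<^sub>R x - x\<close> Lipschitz.  This map is
  positively homogeneous, by which the pointwise bound extends from the sphere to the unit ball, and
  the resulting Lipschitz bound from the unit ball to the whole space.\<close>

lemma small_deviation_bilipschitz:
  assumes L: "bilipschitz_radial_function \<rho> L"
    and ess: "esssup sphere_measure (derivative_deviation (radial_extension M) 1) \<le> ereal \<epsilon>"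
    and \<epsilon>: "0 \<le> \<epsilon>" "\<epsilon> < 1"
  shows "bilipschitz_radial_function \<rho> (1 / (1 - \<epsilon>))"
proof -
  interpret bilipschitz_radial_function \<rho> L by (rule L)
  define g where "g x = \<rho> x *\<^sub>R x - x" for x :: 'a
  have g_eq: "g = (\<lambda>y. radial_extension M y - 1 *\<^sub>R y)"
    by (auto simp: g_def radial_extension_eq)
  have lip: "norm (g x - g y) \<le> (L + 1) * norm (x - y)" for x y
  proof -
    have "g x - g y = (\<rho> x *\<^sub>R x - \<rho> y *\<^sub>R y) - (x - y)" by (simp add: g_def)
    then have "norm (g x - g y) \<le> norm (\<rho> x *\<^sub>R x - \<rho> y *\<^sub>R y) + norm (x - y)"
      by (simp only: norm_triangle_ineq4)
    then show ?thesis using stretch[of x y] by (simp only: distrib_right)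
  qed
  have ghom: "g (c *\<^sub>R z) = c *\<^sub>R g z" if "0 < c" for c z
    using that hom[of z c] by (cases "z = 0") (auto simp: g_def algebra_simps)
  have "AE u in sphere_measure. derivative_deviation (radial_extension M) 1 u \<le> ereal \<epsilon>"
    using esssup_AE[of "derivative_deviation (radial_extension M) 1" sphere_measure]
    by eventually_elim (rule order_trans[OF _ ess])
  then have "AE u in sphere_measure. pointwise_lipschitz (\<lambda>y. radial_extension M y - 1 *\<^sub>R y) \<epsilon> u"
    by eventually_elim (rule derivative_deviation_pointwise_lipschitz)
  then have "AE u in sphere_measure. pointwise_lipschitz g \<epsilon> u" by (simp only: g_eq)
  from AE_sphere_measureD[OF this]
  have "AE x in lborel. x \<in> cball 0 1 - {0} \<longrightarrow> pointwise_lipschitz g \<epsilon> (x /\<^sub>R norm x)" .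
  moreover have "AE x in lborel. x \<notin> {0::'a}" by (intro AE_not_in) auto
  ultimately have ae: "AE x in lborel. norm x < 1 \<longrightarrow> pointwise_lipschitz g \<epsilon> x"
  proof eventually_elim
    case (elim x)
    show ?case
    proof
      assume "norm x < 1"
      then have pl: "pointwise_lipschitz g \<epsilon> (inverse (norm x) *\<^sub>R x)" "0 < inverse (norm x)" using elim by auto
      show "pointwise_lipschitz g \<epsilon> x" by (rule pointwise_lipschitz_scale[OF ghom[OF pl(2)] pl(2,1)])
    qed
  qed
  have small: "norm (g x - g y) \<le> \<epsilon> * norm (x - y)" for x y
  proof -
    define c where "c = 1 / (norm x + norm y + 1)"
    have p: "0 < norm x + norm y + 1" by (simp add: add_nonneg_pos)
    have c: "0 < c" using p by (simp add: c_def)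
    have "norm (g (c *\<^sub>R x) - g (c *\<^sub>R y)) \<le> \<epsilon> * norm (c *\<^sub>R x - c *\<^sub>R y)"
    proof (rule lipschitz_of_ae_pointwise[OF _ lip \<epsilon>(1) ae])
      show "0 \<le> L + 1" using Lambda_ge_1 by simp
      have "c * norm x < 1" "c * norm y < 1" unfolding c_def using p by (simp_all add: pos_divide_less_eq add_nonneg_pos)
      then show "norm (c *\<^sub>R x) < 1" "norm (c *\<^sub>R y) < 1" using c by simp_all
    qed
    moreover have "norm (g (c *\<^sub>R x) - g (c *\<^sub>R y)) = c * norm (g x - g y)"
      using c by (simp only: ghom[OF c] scaleR_right_diff_distrib[symmetric] norm_scaleR abs_of_pos)
    moreover have "norm (c *\<^sub>R x - c *\<^sub>R y) = c * norm (x - y)"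
      using c by (simp only: scaleR_right_diff_distrib[symmetric] norm_scaleR abs_of_pos)
    ultimately have "c * norm (g x - g y) \<le> c * (\<epsilon> * norm (x - y))" by (simp only: mult.left_commute)
    then show ?thesis using c by simp
  qed
  show ?thesis
  proof
    fix x y :: 'a
    have up: "norm (\<rho> x *\<^sub>R x - \<rho> y *\<^sub>R y) \<le> (1 + \<epsilon>) * norm (x - y)" for x y
    proof -
      have "norm (\<rho> x *\<^sub>R x - \<rho> y *\<^sub>R y) \<le> norm (x - y) + norm (g x - g y)"
        using norm_triangle_ineq[of "x - y" "g x - g y"] by (simp add: g_def)
      then show ?thesis using small[of x y] by (simp add: algebra_simps)
    qed
    have low: "(1 - \<epsilon>) * norm (x - y) \<le> norm (\<rho> x *\<^sub>R x - \<rho> y *\<^sub>R y)" for x y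
    proof -
      have "norm (x - y) \<le> norm (\<rho> x *\<^sub>R x - \<rho> y *\<^sub>R y) + norm (g x - g y)"
        using norm_triangle_ineq4[of "\<rho> x *\<^sub>R x - \<rho> y *\<^sub>R y" "g x - g y"] by (simp add: g_def)
      then show ?thesis using small[of x y] by (simp add: algebra_simps)
    qed
    have "(1 + \<epsilon>) * (1 - \<epsilon>) \<le> 1" by (simp add: algebra_simps)
    then have "1 + \<epsilon> \<le> 1 / (1 - \<epsilon>)" using \<epsilon> by (simp add: pos_le_divide_eq)
    then have "(1 + \<epsilon>) * norm (x - y) \<le> 1 / (1 - \<epsilon>) * norm (x - y)" by (rule mult_right_mono) simp
    with up show "norm (\<rho> x *\<^sub>R x - \<rho> y *\<^sub>R y) \<le> 1 / (1 - \<epsilon>) * norm (x - y)" by (rule order_trans)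
    have st: "\<rho> ((1 / \<rho> z) *\<^sub>R z) *\<^sub>R ((1 / \<rho> z) *\<^sub>R z) = z" for z
    proof (cases "z = 0")
      case False
      then have "\<rho> ((1 / \<rho> z) *\<^sub>R z) = \<rho> z" using pos[OF False] by (intro hom) auto
      then show ?thesis using pos[OF False] by simp
    qed simp
    have "(1 - \<epsilon>) * norm ((1 / \<rho> x) *\<^sub>R x - (1 / \<rho> y) *\<^sub>R y) \<le> norm (x - y)"
      using low[of "(1 / \<rho> x) *\<^sub>R x" "(1 / \<rho> y) *\<^sub>R y"] unfolding st .
    then show "norm ((1 / \<rho> x) *\<^sub>R x - (1 / \<rho> y) *\<^sub>R y) \<le> 1 / (1 - \<epsilon>) * norm (x - y)"
      using \<epsilon> by (simp add: field_simps)
  qed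
qed

end

context bilipschitz_radial_function begin

lemma
  assumes G: "open G" "G \<noteq> {}" "G \<noteq> UNIV" and XY: "X = Some ` G" "Y = f ` X"
  shows moebius_bi_lipschitz: "bi_lipschitz (\<Lambda> ^ 8) X (moebius_metric X) Y (moebius_metric Y) f" (is ?M)
    and ferrand_bi_lipschitz: "bi_lipschitz (\<Lambda> ^ 8) X (ferrand_metric X) Y (ferrand_metric Y) f" (is ?F)
    and moebius_bi_lipschitz_constant: "bi_lipschitz_constant X (moebius_metric X) Y (moebius_metric Y) f \<in> {1..\<Lambda> ^ 8}" (is ?CM)
    and ferrand_bi_lipschitz_constant: "bi_lipschitz_constant X (ferrand_metric X) Y (ferrand_metric Y) f \<in> {1..\<Lambda> ^ 8}" (is ?CF)
proof -
  interpret Q: quasi_moebius_involution f m "\<Lambda>\<^sup>2" by (rule quasi_moebius)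
  have X: "openin ext_space X" using G XY by simp
  have Y: "openin ext_space Y" unfolding XY(2) by (rule Q.open_image[OF X])
  obtain a b where ab: "a \<in> ext_boundary X" "b \<in> ext_boundary X" "a \<noteq> b"
    unfolding XY(1) by (rule ext_boundary_two_points[OF G])
  then have two: "\<exists>a\<in>ext_boundary X. \<exists>b\<in>ext_boundary X. a \<noteq> b" by blast
  have ne: "ext_boundary X \<noteq> {}" "ext_boundary Y \<noteq> {}" using ab by (auto simp: XY(2) Q.boundary_image)
  have L8: "(\<Lambda>\<^sup>2) ^ 4 = \<Lambda> ^ 8" by (simp flip: power_mult)
  have L8_ge: "1 \<le> \<Lambda> ^ 8" using Lambda_ge_1 by (rule one_le_power)
  have bij: "bij_betw f X Y" by (simp add: bij_betw_def XY(2))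
  have fY: "f ` Y = X" by (simp add: XY(2))
  have bdd: "bdd_above (ratio_set X p q)" if "p \<in> X" "q \<in> X" for p q
    using that bdd_above_ratio_set[OF X] XY(1) by auto
  show M: ?M
  proof (rule bi_lipschitzI[OF L8_ge bij])
    fix p q assume pq: "p \<in> X" "q \<in> X"
    note 1 = Q.moebius_image[OF X ne(1) pq bdd[OF pq], folded XY(2), unfolded L8]
    show "moebius_metric Y (f p) (f q) \<le> \<Lambda> ^ 8 * moebius_metric X p q" by (rule 1(2))
    have "f p \<in> Y" "f q \<in> Y" using pq by (auto simp: XY(2))
    from Q.moebius_image(2)[OF Y ne(2) this 1(1)]
    show "moebius_metric X p q \<le> \<Lambda> ^ 8 * moebius_metric Y (f p) (f q)" by (simp add: fY L8)
  qed
  show F: ?F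
    using Q.ferrand_metric_image_le[OF X two, folded XY(2), unfolded L8]
    by (intro bi_lipschitzI[OF L8_ge bij]) auto
  obtain x y where xy: "x \<in> G" "y \<in> G" "x \<noteq> y" "0 < ferrand_metric X (Some x) (Some y)"
    unfolding XY(1) by (rule ferrand_metric_pos[OF G])
  then have XX: "Some x \<in> X" "Some y \<in> X" "Some x \<noteq> Some y" by (auto simp: XY(1))
  show ?CF using bi_lipschitz_constant_bounds[OF F XX(1,2) xy(4)] by simp
  show ?CM using bi_lipschitz_constant_bounds[OF M XX(1,2) moebius_metric_pos[OF X XX bdd[OF XX(1,2)] two]] by simp
qed

end

theorem theorem5p10:
  fixes D M G :: "'a::euclidean_space set" and \<alpha> L rmax rmin :: real
  assumes dim: "DIM('a) \<ge> 2"
    and D: "strictly_starlike D 0"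
    and M: "M = frontier D"
    and \<alpha>: "0 < \<alpha>" "\<alpha> \<le> pi / 2"
    and tangent: "tangent_condition M \<alpha>"
    and G: "open G" "connected G" "G \<noteq> {}" "G \<noteq> UNIV"
    and rmax: "rmax = (SUP w\<in>M. norm w)"
    and rmin: "rmin = (INF w\<in>M. norm w)"
    and L: "L = max (rmax / 2) (1 / (2 * rmin)) *
                  (sqrt ((1 / sin \<alpha>)\<^sup>2 - 1) + sqrt ((1 / sin \<alpha>)\<^sup>2 + 3))"
  shows
    "(let X = Some ` G; f = quasi_inversion M; Y = f ` X in
        bi_lipschitz (L ^ 8) X (moebius_metric X) Y (moebius_metric Y) f \<and>
        bi_lipschitz (L ^ 8) X (ferrand_metric X) Y (ferrand_metric Y) f) \<and>
     (\<forall>S. smoothly_converges S 1 \<longrightarrow>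
        (let X = Some ` G; f = (\<lambda>t. quasi_inversion (S t)); Y = (\<lambda>t. f t ` X) in
           ((\<lambda>t. bi_lipschitz_constant X (moebius_metric X) (Y t) (moebius_metric (Y t)) (f t))
              \<longlongrightarrow> 1) (at 0 within {0..1}) \<and>
           ((\<lambda>t. bi_lipschitz_constant X (ferrand_metric X) (Y t) (ferrand_metric (Y t)) (f t))
              \<longlongrightarrow> 1) (at 0 within {0..1})))"
proof (intro conjI allI impI)
  have surf: "starlike_surface D M" using D M by unfold_locales
  interpret starlike_surface D M by (rule surf)
  have bl: "bilipschitz_radial_function \<rho> L"
    by (rule tangent_bilipschitz[OF tangent \<alpha>]) (use L rmax rmin in simp)
  show "let X = Some ` G; f = quasi_inversion M; Y = f ` X in
        bi_lipschitz (L ^ 8) X (moebius_metric X) Y (moebius_metric Y) f \<and>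
        bi_lipschitz (L ^ 8) X (ferrand_metric X) Y (ferrand_metric Y) f"
    unfolding Let_def quasi_inversion_eq
    using bilipschitz_radial_function.moebius_bi_lipschitz[OF bl G(1,3,4) refl refl]
      bilipschitz_radial_function.ferrand_bi_lipschitz[OF bl G(1,3,4) refl refl] by blast
next
  fix S :: "real \<Rightarrow> 'a set" assume S: "smoothly_converges S 1"
  let ?X = "Some ` G" and ?f = "\<lambda>t. quasi_inversion (S t)"
  let ?CM = "\<lambda>t. bi_lipschitz_constant ?X (moebius_metric ?X) (?f t ` ?X) (moebius_metric (?f t ` ?X)) (?f t)"
  let ?CF = "\<lambda>t. bi_lipschitz_constant ?X (ferrand_metric ?X) (?f t ` ?X) (ferrand_metric (?f t ` ?X)) (?f t)"
  let ?at = "at (0::real) within {0..1}"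
  let ?ess = "\<lambda>t. esssup sphere_measure (derivative_deviation (radial_extension (S t)) 1)"
  have bounds: "\<forall>\<^sub>F t in ?at. ?CM t \<in> {1..(1 / (1 - \<epsilon>)) ^ 8} \<and> ?CF t \<in> {1..(1 / (1 - \<epsilon>)) ^ 8}"
    if \<epsilon>: "0 < \<epsilon>" "\<epsilon> < 1" for \<epsilon>
  proof -
    have "\<forall>\<^sub>F t in ?at. ?ess t < ereal \<epsilon>"
      using S \<epsilon> by (intro order_tendstoD(2)) (auto simp: smoothly_converges_def)
    moreover have "\<forall>\<^sub>F t in ?at. t \<in> {0..1}" by (auto simp: eventually_at intro!: exI[of _ 1])
    ultimately show ?thesis
    proof eventually_elim
      case (elim t)
      obtain D' \<alpha>' where D': "strictly_starlike D' 0" "S t = frontier D'" "0 < \<alpha>'" "\<alpha>' \<le> pi / 2" "tangent_condition (S t) \<alpha>'"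
        using S elim(2) unfolding smoothly_converges_def by blast
      interpret starlike_surface D' "S t" using D' by unfold_locales
      have "bilipschitz_radial_function \<rho> (1 / (1 - \<epsilon>))"
        using elim(1) \<epsilon> by (intro small_deviation_bilipschitz[OF tangent_bilipschitz[OF D'(5,3,4) refl]]) auto
      note bl = this
      show ?case unfolding quasi_inversion_eq
        using bilipschitz_radial_function.moebius_bi_lipschitz_constant[OF bl G(1,3,4) refl refl]
          bilipschitz_radial_function.ferrand_bi_lipschitz_constant[OF bl G(1,3,4) refl refl] by blast
    qed
  qed
  have lim: "(c \<longlongrightarrow> 1) ?at"
    if c: "\<And>\<epsilon>. 0 < \<epsilon> \<Longrightarrow> \<epsilon> < 1 \<Longrightarrow> \<forall>\<^sub>F t in ?at. c t \<in> {1..(1 / (1 - \<epsilon>)) ^ 8}" for c :: "real \<Rightarrow> real"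
  proof (rule tendstoI)
    fix e :: real assume "0 < e"
    have "((\<lambda>\<epsilon>. (1 / (1 - \<epsilon>)) ^ 8) \<longlongrightarrow> (1 / (1 - 0)) ^ 8) (at_right (0::real))"
      by (intro tendsto_intros) auto
    then have "\<forall>\<^sub>F \<epsilon> in at_right (0::real). (1 / (1 - \<epsilon>)) ^ 8 < 1 + e"
      using \<open>0 < e\<close> by (intro order_tendstoD(2)) auto
    moreover have "\<forall>\<^sub>F \<epsilon> in at_right (0::real). \<epsilon> \<in> {0<..<1}" by (rule eventually_at_right_real) simp
    ultimately have "\<forall>\<^sub>F \<epsilon> in at_right (0::real). 0 < \<epsilon> \<and> \<epsilon> < 1 \<and> (1 / (1 - \<epsilon>)) ^ 8 < 1 + e"
      by eventually_elim auto
    then obtain \<epsilon> :: real where "0 < \<epsilon>" "\<epsilon> < 1" "(1 / (1 - \<epsilon>)) ^ 8 < 1 + e"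
      using eventually_happens trivial_limit_at_right_real by blast
    from c[OF this(1,2)] show "\<forall>\<^sub>F t in ?at. dist (c t) 1 < e"
      by eventually_elim (use \<open>(1 / (1 - \<epsilon>)) ^ 8 < 1 + e\<close> in \<open>auto simp: dist_real_def\<close>)
  qed
  have "(?CM \<longlongrightarrow> 1) ?at"
    by (rule lim) (rule eventually_mono[OF bounds], assumption+, rule conjunct1)
  moreover have "(?CF \<longlongrightarrow> 1) ?at"
    by (rule lim) (rule eventually_mono[OF bounds], assumption+, rule conjunct2)
  ultimately show "let X = Some ` G; f = (\<lambda>t. quasi_inversion (S t)); Y = (\<lambda>t. f t ` X) in
           ((\<lambda>t. bi_lipschitz_constant X (moebius_metric X) (Y t) (moebius_metric (Y t)) (f t))
              \<longlongrightarrow> 1) (at 0 within {0..1}) \<and>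
           ((\<lambda>t. bi_lipschitz_constant X (ferrand_metric X) (Y t) (ferrand_metric (Y t)) (f t))
              \<longlongrightarrow> 1) (at 0 within {0..1})"
    unfolding Let_def by blast
qed

end
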